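(* If $M = \mathbb{H}^3/\Gamma$ is a finite-volume, complete hyperbolic 3-manifold, then the complex length spectrum $\mathcal{L}(M)$ is of unbounded multiplicity; that is, for every positive integer $n$ there is a complex length which is shared by at least $n$ distinct conjugacy classes of loxodromic elements of $\Gamma$.
   Context: Hyperbolic 3-manifolds are written $M = \mathbb{H}^3/\Gamma$, where $\Gamma \subset PSL_2(\mathbb{C})$ is a Kleinian group, i.e. a discrete subgroup of $PSL_2(\mathbb{C})$ acting on $\mathbb{H}^3$ by orientation-preserving isometries. An element $\gamma \in \Gamma$ is loxodromic if $\mathrm{tr}^2\gamma \notin [0,4]$ (this includes hyperbolic elements); the trace is well-defined up to sign. A loxodromic element $\gamma$ has a complex length $\ell_0(\gamma) = \ell + i\theta$, meaning that $\gamma$ translates by distance $\ell$ along its invariant axis in $\mathbb{H}^3$ and rotates by the angle $\theta$ about it; it is related to the trace by $\ell_0(\gamma) = 2\cosh^{-1}(\mathrm{tr}\,\gamma/2)$ (with $\ell>0$ and $\theta$ taken modulo $2\pi$). A complex length has multiplicity $n$ if it is shared by exactly $n$ conjugacy classes in $\Gamma$. The complex length spectrum $\mathcal{L}(M)$ is the set of complex lengths of loxodromic elements of $\Gamma$, counted with multiplicity. *)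

theory Defs
  imports "HOL-Analysis.Analysis" "HOL-Algebra.Coset"
begin

section \<open>The group $PSL_2(\mathbb{C})$\<close>

definition SL2C :: "(complex^2^2) monoid" where
  "SL2C = \<lparr>carrier = {A. det A = 1}, mult = (**), one = mat 1\<rparr>"

definition PSL2C :: "(complex^2^2) set monoid" where
  "PSL2C = SL2C Mod {mat 1, - mat 1}"

lemma det_uminus_2: "det (- A) = det (A :: complex^2^2)"
  by (simp add: det_2)

lemma uminus_matrix_mult_2:
  fixes A B :: "complex^2^2"
  shows "(- A) ** B = - (A ** B)" and "A ** (- B) = - (A ** B)"
  by (simp_all add: vec_eq_iff matrix_matrix_mult_def sum_negf)

lemma group_SL2C: "group SL2C"
proof (rule groupI)
  fix A assume "A \<in> carrier SL2C"
  then have d: "det A = 1" by (simp add: SL2C_def)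
  then have "invertible A" by (simp add: invertible_det_nz)
  then obtain B where B: "A ** B = mat 1" "B ** A = mat 1"
    by (auto simp: invertible_def)
  have "det B * det A = 1" using B(2) by (metis det_I det_mul)
  with d have "det B = 1" by simp
  with B show "\<exists>B\<in>carrier SL2C. B \<otimes>\<^bsub>SL2C\<^esub> A = \<one>\<^bsub>SL2C\<^esub>"
    by (auto simp: SL2C_def)
qed (auto simp: SL2C_def det_mul matrix_mul_assoc)

lemma normal_centre_SL2C: "{mat 1, - mat 1} \<lhd> SL2C"
proof -
  interpret group SL2C by (rule group_SL2C)
  have inv1: "inv\<^bsub>SL2C\<^esub> (- mat 1) = - mat 1"
    by (rule inv_equality) (auto simp: SL2C_def uminus_matrix_mult_2 det_uminus_2)
  have inv0: "inv\<^bsub>SL2C\<^esub> (mat 1) = mat 1"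
    by (rule inv_equality) (auto simp: SL2C_def)
  have "subgroup {mat 1, - mat 1} SL2C"
    using inv0 inv1
    by (intro subgroupI) (auto simp: SL2C_def uminus_matrix_mult_2 det_uminus_2)
  then show ?thesis
    unfolding normal_def normal_axioms_def
    using is_group
    by (auto simp: r_coset_def l_coset_def SL2C_def uminus_matrix_mult_2)
qed

lemma group_PSL2C: "group PSL2C"
  unfolding PSL2C_def by (rule normal.factorgroup_is_group[OF normal_centre_SL2C])

lemma carrier_PSL2C: "carrier PSL2C = {{A, - A} | A. det A = 1}"
  by (auto simp: PSL2C_def FactGroup_def RCOSETS_def r_coset_def SL2C_def
      uminus_matrix_mult_2)

lemma mult_PSL2C: "{A, - A} \<otimes>\<^bsub>PSL2C\<^esub> {B, - B} = {A ** B, - (A ** B)}"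
  by (auto simp: PSL2C_def FactGroup_def set_mult_def SL2C_def uminus_matrix_mult_2)

lemma one_PSL2C: "\<one>\<^bsub>PSL2C\<^esub> = {mat 1, - mat 1}"
  by (simp add: PSL2C_def FactGroup_def)

text \<open>The quotient topology: since an element of \<open>PSL2C\<close> is a set of matrices, the preimage of
  \<open>U\<close> in \<open>SL2C\<close> is \<open>\<Union>U\<close>.\<close>

definition PSL2C_topology :: "(complex^2^2) set topology" where
  "PSL2C_topology =
     topology (\<lambda>U. U \<subseteq> carrier PSL2C \<and> openin (top_of_set (carrier SL2C)) (\<Union>U))"

lemma openin_PSL2C_topology:
  "openin PSL2C_topology U \<longleftrightarrow>
     U \<subseteq> carrier PSL2C \<and> openin (top_of_set (carrier SL2C)) (\<Union>U)"
proof -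
  have disj: "x = y" if "x \<in> carrier PSL2C" "y \<in> carrier PSL2C" "A \<in> x" "A \<in> y" for x y A
    using that by (auto simp: carrier_PSL2C)
  have "istopology (\<lambda>U. U \<subseteq> carrier PSL2C \<and> openin (top_of_set (carrier SL2C)) (\<Union>U))"
    unfolding istopology_def
  proof (intro conjI allI impI)
    fix S T
    assume S: "S \<subseteq> carrier PSL2C \<and> openin (top_of_set (carrier SL2C)) (\<Union>S)"
      and T: "T \<subseteq> carrier PSL2C \<and> openin (top_of_set (carrier SL2C)) (\<Union>T)"
    show "S \<inter> T \<subseteq> carrier PSL2C" using S by blast
    have "\<Union>(S \<inter> T) = \<Union>S \<inter> \<Union>T"
    proof
      show "\<Union>S \<inter> \<Union>T \<subseteq> \<Union>(S \<inter> T)"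
      proof
        fix A assume "A \<in> \<Union>S \<inter> \<Union>T"
        then obtain x y where xy: "x \<in> S" "A \<in> x" "y \<in> T" "A \<in> y" by blast
        then have "x = y" using S T disj[of x y A] by blast
        with xy show "A \<in> \<Union>(S \<inter> T)" by blast
      qed
    qed blast
    then show "openin (top_of_set (carrier SL2C)) (\<Union>(S \<inter> T))"
      using S T by (simp add: openin_Int)
  next
    fix \<K>
    assume K: "\<forall>K\<in>\<K>. K \<subseteq> carrier PSL2C \<and> openin (top_of_set (carrier SL2C)) (\<Union>K)"
    then show "\<Union>\<K> \<subseteq> carrier PSL2C" by blast
    have "\<Union>(\<Union>\<K>) = \<Union>((\<lambda>K. \<Union>K) ` \<K>)" by blast
    moreover have "openin (top_of_set (carrier SL2C)) (\<Union>((\<lambda>K. \<Union>K) ` \<K>))"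
      using K by (intro openin_Union) blast
    ultimately show "openin (top_of_set (carrier SL2C)) (\<Union>(\<Union>\<K>))" by simp
  qed
  then show ?thesis by (simp add: PSL2C_topology_def topology_inverse')
qed

section \<open>Hyperbolic 3-space\<close>

text \<open>The upper half-space model $\{(z, t) : z \in \mathbb{C},\ t > 0\}$.\<close>

definition H3 :: "(complex \<times> real) set" where
  "H3 = {p. snd p > 0}"

text \<open>The volume form of the metric $(|dz|^2 + dt^2)/t^2$.\<close>

definition H3_volume :: "(complex \<times> real) measure" where
  "H3_volume = density lborel (\<lambda>p. ennreal (1 / snd p ^ 3) * indicator H3 p)"

text \<open>The Poincare extension of the Moebius transformation of a matrix of determinant 1.\<close>

definition SL2C_act :: "complex^2^2 \<Rightarrow> complex \<times> real \<Rightarrow> complex \<times> real" where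
  "SL2C_act A = (\<lambda>(z, t).
     let a = A$1$1; b = A$1$2; c = A$2$1; d = A$2$2;
         N = (cmod (c * z + d))\<^sup>2 + (cmod c)\<^sup>2 * t\<^sup>2
     in (((a * z + b) * cnj (c * z + d) + a * cnj c * of_real (t\<^sup>2)) / of_real N, t / N))"

definition PSL2C_act :: "(complex^2^2) set \<Rightarrow> complex \<times> real \<Rightarrow> complex \<times> real" where
  "PSL2C_act \<gamma> p = the_elem ((\<lambda>A. SL2C_act A p) ` \<gamma>)"

lemma SL2C_act_uminus: "SL2C_act (- A) p = SL2C_act A p"
proof -
  have "cmod (- w - v) = cmod (w + v)" for w v :: complex
    by (metis minus_add_distrib norm_minus_cancel uminus_add_conv_diff add.commute)
  then show ?thesis
    by (cases p) (simp add: SL2C_act_def Let_def algebra_simps)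
qed

lemma PSL2C_act_coset: "PSL2C_act {A, - A} p = SL2C_act A p"
  by (simp add: PSL2C_act_def SL2C_act_uminus)

section \<open>Kleinian groups and hyperbolic 3-manifolds\<close>

definition kleinian_group :: "(complex^2^2) set set \<Rightarrow> bool" where
  "kleinian_group \<Gamma> \<longleftrightarrow>
     subgroup \<Gamma> PSL2C \<and> subtopology PSL2C_topology \<Gamma> = discrete_topology \<Gamma>"

text \<open>For a discrete group, \<open>H3/\<Gamma>\<close> is a hyperbolic 3-manifold (rather than an orbifold) exactly
  when the action is free. The quotient metric is then automatically complete.\<close>

definition acts_freely :: "(complex^2^2) set set \<Rightarrow> bool" where
  "acts_freely \<Gamma> \<longleftrightarrow> (\<forall>\<gamma>\<in>\<Gamma>. \<gamma> \<noteq> \<one>\<^bsub>PSL2C\<^esub> \<longrightarrow> (\<forall>p\<in>H3. PSL2C_act \<gamma> p \<noteq> p))"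

definition hyperbolic_manifold_group :: "(complex^2^2) set set \<Rightarrow> bool" where
  "hyperbolic_manifold_group \<Gamma> \<longleftrightarrow> kleinian_group \<Gamma> \<and> acts_freely \<Gamma>"

definition fundamental_set ::
    "(complex^2^2) set set \<Rightarrow> (complex \<times> real) set \<Rightarrow> bool" where
  "fundamental_set \<Gamma> D \<longleftrightarrow>
     D \<in> sets borel \<and> D \<subseteq> H3 \<and> (\<forall>p\<in>H3. \<exists>!q. q \<in> D \<and> (\<exists>\<gamma>\<in>\<Gamma>. q = PSL2C_act \<gamma> p))"

text \<open>When \<open>\<Gamma>\<close> is discrete and acts freely, Borel fundamental sets exist and the volume of each of
  them is the volume of the quotient manifold.\<close>

definition finite_covolume :: "(complex^2^2) set set \<Rightarrow> bool" where
  "finite_covolume \<Gamma> \<longleftrightarrow> (\<exists>D. fundamental_set \<Gamma> D \<and> emeasure H3_volume D < \<infinity>)"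

section \<open>Complex lengths\<close>

definition trace_sq :: "(complex^2^2) set \<Rightarrow> complex" where
  "trace_sq \<gamma> = the_elem ((\<lambda>A. (trace A)\<^sup>2) ` \<gamma>)"

lemma trace_uminus_2: "trace (- A) = - trace (A :: complex^2^2)"
  by (simp add: trace_def sum_negf)

lemma trace_sq_coset: "trace_sq {A, - A} = (trace A)\<^sup>2"
  by (simp add: trace_sq_def trace_uminus_2)

definition loxodromic :: "(complex^2^2) set \<Rightarrow> bool" where
  "loxodromic \<gamma> \<longleftrightarrow> trace_sq \<gamma> \<notin> complex_of_real ` {0..4}"

text \<open>\<open>has_complex_length \<gamma> L\<close>: after an orientation-preserving isometry \<open>g\<close> carries the axis of
  \<open>\<gamma>\<close> to the vertical line over 0, translating upwards, \<open>\<gamma>\<close> becomes the translation by \<open>Re L > 0\<close>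
  along this line (the map $(z, t) \mapsto (e^{\ell} z, e^{\ell} t)$) composed with the rotation by
  the angle \<open>Im L\<close> about it. This determines \<open>L\<close> modulo $2 \pi i$ only.\<close>

definition has_complex_length :: "(complex^2^2) set \<Rightarrow> complex \<Rightarrow> bool" where
  "has_complex_length \<gamma> L \<longleftrightarrow> Re L > 0 \<and>
     (\<exists>g\<in>carrier PSL2C. \<forall>z t. t > 0 \<longrightarrow>
        PSL2C_act (g \<otimes>\<^bsub>PSL2C\<^esub> \<gamma> \<otimes>\<^bsub>PSL2C\<^esub> inv\<^bsub>PSL2C\<^esub> g) (z, t) =
          (cis (Im L) * (exp (Re L) *\<^sub>R z), exp (Re L) * t))"

lemma diagonalize_2:
  fixes A :: "complex^2^2"
  assumes dA: "det A = 1" and tr: "trace A = m + 1 / m" and m: "m \<noteq> 0" "m\<^sup>2 \<noteq> 1"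
  shows "\<exists>P. det P = 1 \<and> P ** A = vector [vector [m, 0], vector [0, 1/m]] ** P"
proof -
  define a b c d where "a = A$1$1" "b = A$1$2" "c = A$2$1" "d = A$2$2"
  note defs = this
  have det: "a * d - b * c = 1" using dA by (simp add: det_2 defs)
  have t: "d = m + 1 / m - a" using tr by (simp add: trace_def sum_2 defs algebra_simps)
  have m'': "1 / m - m \<noteq> 0" using m by (simp add: field_simps power2_eq_square)
  have *: ?thesis
    if P: "p * s - q * r = D" "D \<noteq> 0" "p * a + q * c = m * p" "p * b + q * d = m * q"
      "r * a + s * c = r / m" "r * b + s * d = s / m" for p q r s D
  proof -
    define P :: "complex^2^2" where "P = vector [vector [p, q], vector [r / D, s / D]]"
    have "det P = (p * s - q * r) / D" by (simp add: det_2 P_def diff_divide_distrib)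
    then have "det P = 1" using P by simp
    moreover have "r / D * a + s / D * c = 1 / m * (r / D)"
    proof -
      have "r / D * a + s / D * c = (r * a + s * c) / D" by (simp add: add_divide_distrib)
      then show ?thesis by (simp add: P)
    qed
    moreover have "r / D * b + s / D * d = 1 / m * (s / D)"
    proof -
      have "r / D * b + s / D * d = (r * b + s * d) / D" by (simp add: add_divide_distrib)
      then show ?thesis by (simp add: P)
    qed
    ultimately show ?thesis using P(3,4)
      by (intro exI[of _ P])
        (simp add: vec_eq_iff forall_2 matrix_matrix_mult_def sum_2 P_def defs)
  qed
  define k where "k = 1 / m"
  have k: "m * k = 1" "x / m = k * x" for x using m by (simp_all add: k_def)
  have q1: "b * c = a * m + a * k - a * a - 1" using det t by (simp add: algebra_simps k_def)
  have m': "k - m \<noteq> 0" "m - k \<noteq> 0" using m'' by (simp_all add: k_def)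
  have t': "d = m + k - a" using t by (simp add: k_def)
  consider "c \<noteq> 0" | "c = 0" "b \<noteq> 0" | "c = 0" "b = 0" by blast
  then show ?thesis
  proof cases
    case 1
    have "c * b + (m - a) * d = m * (m - a)" "c * a + (m - a) * c = m * c"
      "c * a + (k - a) * c = k * c" "c * b + (k - a) * d = k * (k - a)"
      using q1 k(1) unfolding t' by algebra+
    moreover have "c * (k - a) - (m - a) * c = c * (k - m)" by (simp_all add: algebra_simps)
    ultimately show ?thesis
      using 1 m' by (intro *[of c "k - a" "m - a" c "c * (k - m)"]) (simp_all add: k(2))
  next
    case 2
    have "(m - d) * a = m * (m - d)" "(k - d) * a = k * (k - d)"
      using q1 k(1) \<open>c = 0\<close> unfolding t' by algebra+
    moreover have "(m - d) * b + b * d = m * b" "(k - d) * b + b * d = k * b"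
      "(m - d) * b - b * (k - d) = b * (m - k)" by (simp_all add: algebra_simps)
    ultimately show ?thesis
      using 2 m' by (intro *[of "m - d" b b "k - d" "b * (m - k)"]) (simp_all add: k(2))
  next
    case 3
    have "(a - m) * (a - k) = 0" using q1 3 k(1) by (simp add: algebra_simps)
    then consider "a = m" | "a = 1 / m" by (auto simp: k_def)
    then show ?thesis
    proof cases
      case 1 show ?thesis by (rule *[of 1 1 0 0 1]) (use 1 3 t m in auto)
    next
      case 2 show ?thesis by (rule *[of 0 0 1 "-1" 1]) (use 2 3 t m in auto)
    qed
  qed
qed

lemma SL2C_act_eq_screw_iff:
  assumes "det B = 1"
  shows "(\<forall>z t. t > 0 \<longrightarrow> SL2C_act B (z, t) = (cis (Im L) * (exp (Re L) *\<^sub>R z), exp (Re L) * t)) \<longleftrightarrow>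
    B$1$2 = 0 \<and> B$2$1 = 0 \<and> (B$1$1)\<^sup>2 = exp L" (is "?l \<longleftrightarrow> ?r")
proof -
  have eL: "exp L * z = cis (Im L) * (exp (Re L) *\<^sub>R z)" for z
    by (simp add: exp_eq_polar scaleR_conv_of_real mult_ac)
  define a b c d where "a = B$1$1" "b = B$1$2" "c = B$2$1" "d = B$2$2"
  note defs = this
  have det: "a * d - b * c = 1" using assms by (simp add: det_2 defs)
  have act: "SL2C_act B (z, t) = (((a * z + b) * cnj (c * z + d) + a * cnj c * of_real (t\<^sup>2)) /
      of_real ((cmod (c * z + d))\<^sup>2 + (cmod c)\<^sup>2 * t\<^sup>2),
      t / ((cmod (c * z + d))\<^sup>2 + (cmod c)\<^sup>2 * t\<^sup>2))" for z t
    by (simp add: SL2C_act_def Let_def defs)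
  have diag: "SL2C_act B (z, t) = (a\<^sup>2 * z, (cmod a)\<^sup>2 * t)" if "b = 0" "c = 0" for z t
  proof -
    have ad: "a * d = 1" using det that by simp
    then have nz: "d \<noteq> 0" by auto
    have "of_real ((cmod d)\<^sup>2) = d * cnj d" by (rule complex_norm_square)
    then have "cnj d / of_real ((cmod d)\<^sup>2) = 1 / d" using nz by simp
    also have "1 / d = a" using ad nz by (simp add: field_simps)
    finally have 1: "cnj d / of_real ((cmod d)\<^sup>2) = a" .
    have "(cmod a)\<^sup>2 * (cmod d)\<^sup>2 = 1"
      using ad by (metis norm_mult norm_one power_mult_distrib power_one)
    then have 2: "1 / (cmod d)\<^sup>2 = (cmod a)\<^sup>2" using nz by (simp add: field_simps)
    have "SL2C_act B (z, t) =
        (a * z * (cnj d / of_real ((cmod d)\<^sup>2)), t * (1 / (cmod d)\<^sup>2))"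
      by (simp add: act that)
    then show ?thesis unfolding 1 2 by (simp add: power2_eq_square mult_ac)
  qed
  show ?thesis
  proof
    assume r: ?r
    then have a: "a\<^sup>2 = exp L" by (simp add: defs)
    have "(cmod a)\<^sup>2 = exp (Re L)" by (metis a norm_exp_eq_Re norm_power)
    with diag r a show ?l by (simp add: defs eL)
  next
    assume l: ?l
    have ht: "t / ((cmod (c * z + d))\<^sup>2 + (cmod c)\<^sup>2 * t\<^sup>2) = exp (Re L) * t" if "t > 0" for z t
      using l that by (simp add: act)
    have N: "(cmod (c * z + d))\<^sup>2 + (cmod c)\<^sup>2 * t\<^sup>2 = exp (- Re L)" if "t > 0" for z t
    proof -
      define N where "N = (cmod (c * z + d))\<^sup>2 + (cmod c)\<^sup>2 * t\<^sup>2"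
      have e: "t / N = exp (Re L) * t" using ht[OF that, of z] by (simp only: N_def)
      then have "N \<noteq> 0" using that by auto
      then have "t = t * (exp (Re L) * N)" using e by (simp add: divide_eq_eq mult_ac)
      then have "exp (Re L) * N = 1" using that by simp
      then have "N = exp (- Re L)" by (simp add: exp_minus field_simps)
      then show ?thesis by (simp only: N_def)
    qed
    have "(cmod d)\<^sup>2 + (cmod c)\<^sup>2 = exp (- Re L)"
      "(cmod d)\<^sup>2 + (cmod c)\<^sup>2 * 4 = exp (- Re L)"
      using N[of 1 0] N[of 2 0] by simp_all
    then have "(cmod c)\<^sup>2 = 0" by linarith
    then have c: "c = 0" by simp
    have nd: "d \<noteq> 0" using det c by auto
    have "b = 0" using l[rule_format, of 1 0] c nd by (simp add: act)
    moreover have "a\<^sup>2 = exp L"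
      using l[rule_format, of 1 1] diag[OF \<open>b = 0\<close> c, of 1 1] eL[of 1] by simp
    ultimately show ?r using c by (simp add: defs)
  qed
qed

lemma inv_PSL2C:
  assumes "det P = 1" "P ** Q = mat 1"
  shows "inv\<^bsub>PSL2C\<^esub> {P, - P} = {Q, - Q}"
proof -
  interpret group PSL2C by (rule group_PSL2C)
  have "det P * det Q = 1" by (metis assms(2) det_I det_mul)
  then have "det Q = 1" using assms(1) by simp
  moreover have "Q ** P = mat 1" using assms(2) by (simp add: matrix_left_right_inverse)
  ultimately show ?thesis using assms
    by (intro inv_equality) (auto simp: mult_PSL2C one_PSL2C carrier_PSL2C)
qed

text \<open>The relation $\ell_0(\gamma) = 2 \cosh^{-1}(\mathrm{tr}\,\gamma / 2)$.\<close>

lemma has_complex_length_iff_trace: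
  assumes "\<gamma> \<in> carrier PSL2C"
  shows "has_complex_length \<gamma> L \<longleftrightarrow> Re L > 0 \<and> (\<exists>A\<in>\<gamma>. trace A = 2 * cosh (L / 2))"
proof -
  obtain A where A: "\<gamma> = {A, - A}" "det A = 1" using assms by (auto simp: carrier_PSL2C)
  have conj: "\<exists>Q. P ** Q = mat 1 \<and> det (P ** A ** Q) = 1 \<and> trace (P ** A ** Q) = trace A \<and>
      {P, - P} \<otimes>\<^bsub>PSL2C\<^esub> \<gamma> \<otimes>\<^bsub>PSL2C\<^esub> inv\<^bsub>PSL2C\<^esub> {P, - P} = {P ** A ** Q, - (P ** A ** Q)}"
    if P: "det P = 1" for P
  proof -
    have "invertible P" using P by (simp add: invertible_det_nz)
    then obtain Q where Q: "P ** Q = mat 1" "Q ** P = mat 1" by (auto simp: invertible_def)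
    have "det P * det Q = 1" by (metis Q(1) det_I det_mul)
    then have "det Q = 1" using P by simp
    moreover have "trace (P ** A ** Q) = trace A"
      by (metis Q(2) matrix_mul_assoc matrix_mul_lid trace_mul_sym)
    ultimately show ?thesis using Q P A
      by (intro exI[of _ Q]) (simp add: inv_PSL2C mult_PSL2C det_mul)
  qed
  have tc: "2 * cosh (L / 2) = exp (L / 2) + 1 / exp (L / 2)"
    by (simp add: cosh_def exp_minus scaleR_conv_of_real field_simps)
  have sq: "(exp (L / 2))\<^sup>2 = exp L" by (simp flip: exp_double)
  show ?thesis
  proof
    assume h: "has_complex_length \<gamma> L"
    then obtain g where g: "g \<in> carrier PSL2C" and act: "\<forall>z t. t > 0 \<longrightarrow>
        PSL2C_act (g \<otimes>\<^bsub>PSL2C\<^esub> \<gamma> \<otimes>\<^bsub>PSL2C\<^esub> inv\<^bsub>PSL2C\<^esub> g) (z, t) =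
          (cis (Im L) * (exp (Re L) *\<^sub>R z), exp (Re L) * t)" and pos: "Re L > 0"
      by (auto simp: has_complex_length_def)
    obtain P where P: "g = {P, - P}" "det P = 1" using g by (auto simp: carrier_PSL2C)
    obtain B where B: "det B = 1" "trace B = trace A"
      "g \<otimes>\<^bsub>PSL2C\<^esub> \<gamma> \<otimes>\<^bsub>PSL2C\<^esub> inv\<^bsub>PSL2C\<^esub> g = {B, - B}"
      using conj[OF P(2)] P(1) by metis
    have d: "B$1$2 = 0" "B$2$1 = 0" "(B$1$1)\<^sup>2 = exp L"
      using act SL2C_act_eq_screw_iff[OF B(1), of L] by (simp_all add: B(3) PSL2C_act_coset)
    have "B$1$1 * B$2$2 = 1" using B(1) d by (simp add: det_2)
    then have "B$2$2 = 1 / B$1$1" by (metis nonzero_mult_div_cancel_left mult_zero_left zero_neq_one)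
    then have tB: "trace A = B$1$1 + 1 / B$1$1" using B(2) by (simp add: trace_def sum_2)
    have "B$1$1 = exp (L/2) \<or> B$1$1 = - exp (L/2)"
      using d(3) sq by (metis power2_eq_iff)
    then have "trace A = 2 * cosh (L / 2) \<or> trace (- A) = 2 * cosh (L / 2)"
      unfolding tc trace_uminus_2 tB by auto
    with pos A show "Re L > 0 \<and> (\<exists>A\<in>\<gamma>. trace A = 2 * cosh (L / 2))" by auto
  next
    assume h: "Re L > 0 \<and> (\<exists>A\<in>\<gamma>. trace A = 2 * cosh (L / 2))"
    then have pos: "Re L > 0" by simp
    obtain m where m: "trace A = m + 1 / m" "m\<^sup>2 = exp L"
    proof -
      from h A have "trace A = 2 * cosh (L / 2) \<or> - trace A = 2 * cosh (L / 2)"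
        by (auto simp: trace_uminus_2)
      then show ?thesis
      proof
        assume "trace A = 2 * cosh (L / 2)"
        then show ?thesis using that[of "exp (L/2)"] sq tc by simp
      next
        assume "- trace A = 2 * cosh (L / 2)"
        then have "trace A = - (2 * cosh (L / 2))" by (metis minus_minus)
        then show ?thesis using that[of "- exp (L/2)"] sq tc by simp
      qed
    qed
    have "norm (exp L) > 1" using pos by simp
    then have "exp L \<noteq> 1" by (metis less_irrefl norm_one)
    then have m1: "m \<noteq> 0" "m\<^sup>2 \<noteq> 1" using m(2) by auto
    define D :: "complex^2^2" where "D = vector [vector [m, 0], vector [0, 1/m]]"
    obtain P where P: "det P = 1" "P ** A = D ** P"
      using diagonalize_2[OF A(2) m(1) m1] by (auto simp: D_def)
    obtain Q where Q: "P ** Q = mat 1" and c: "{P, - P} \<otimes>\<^bsub>PSL2C\<^esub> \<gamma> \<otimes>\<^bsub>PSL2C\<^esub>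
        inv\<^bsub>PSL2C\<^esub> {P, - P} = {P ** A ** Q, - (P ** A ** Q)}"
      using conj[OF P(1)] by blast
    have PAQ: "P ** A ** Q = D" by (metis P(2) Q matrix_mul_assoc matrix_mul_rid)
    have "det D = 1" using m1 by (simp add: D_def det_2)
    from SL2C_act_eq_screw_iff[OF this, of L]
    have "\<forall>z t. t > 0 \<longrightarrow> SL2C_act D (z, t) =
        (cis (Im L) * (exp (Re L) *\<^sub>R z), exp (Re L) * t)"
      using m(2) by (simp add: D_def)
    then show "has_complex_length \<gamma> L"
      unfolding has_complex_length_def using pos P(1)
      by (intro conjI bexI[of _ "{P, - P}"]) (auto simp: c PAQ PSL2C_act_coset carrier_PSL2C)
  qed
qed

definition conjugacy_class :: "(complex^2^2) set set \<Rightarrow> (complex^2^2) set \<Rightarrow> (complex^2^2) set set"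
  where "conjugacy_class \<Gamma> \<gamma> = {h \<otimes>\<^bsub>PSL2C\<^esub> \<gamma> \<otimes>\<^bsub>PSL2C\<^esub> inv\<^bsub>PSL2C\<^esub> h | h. h \<in> \<Gamma>}"

definition classes_of_length :: "(complex^2^2) set set \<Rightarrow> complex \<Rightarrow> (complex^2^2) set set set" where
  "classes_of_length \<Gamma> L =
     {conjugacy_class \<Gamma> \<gamma> | \<gamma>. \<gamma> \<in> \<Gamma> \<and> loxodromic \<gamma> \<and> has_complex_length \<gamma> L}"

end

theory Submission
  imports Defs
begin

text \<open>
  Let \<open>G\<close> be the group of all lifts of the elements of \<open>\<Gamma>\<close> to matrices of determinant 1. Elements with
  the same trace have the same complex length, so it suffices to find, for every \<open>n\<close>, a set of
  \<open>2 ^ n\<close> elements of \<open>G\<close> with a common trace outside the interval from -2 to 2, no two of which are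
  conjugate in \<open>G\<close>.

  Choose coordinates in which a loxodromic element \<open>a\<close> of \<open>G\<close> is diagonal with entries \<open>\<mu>\<close> and
  \<open>1 / \<mu>\<close>, where \<open>\<mu>\<close> has modulus greater than 1. The trace of \<open>a ^ N x\<close> depends only on the diagonal
  of \<open>x\<close>. If \<open>x\<close> and \<open>x'\<close> have the same diagonal and nonzero off-diagonal entries, a diagonal matrix
  \<open>C\<close>, unique up to sign, conjugates one to the other. The central fact, \<open>conjugate_imp_diag\<close>, is
  that for large \<open>N\<close> the elements \<open>a ^ N x\<close> and \<open>a ^ N x'\<close> can be conjugate in \<open>G\<close> only if \<open>C\<close> belongs
  to \<open>G\<close>. Indeed, any conjugator differs from \<open>C\<close> by an element commuting with \<open>a ^ N x\<close>; after
  multiplication by powers of \<open>a ^ N x\<close> and \<open>a\<close> it lies in a fixed bounded set, where \<open>G\<close> is finite, while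
  one of its entries tends to 0 and hence vanishes for large \<open>N\<close>.

  It remains to find many elements of \<open>G\<close> with the same diagonal that are not related in this way
  by diagonal elements of \<open>G\<close> (\<open>twin_family\<close>). Such families are doubled in \<open>twin_family_double\<close>
  by means of a trace identity: a word in \<open>a\<close> and \<open>x\<close> has the same diagonal when it is read backwards.
  Each \<open>x\<close> is replaced by \<open>x x a ^ k x\<close> and its reversal \<open>x a ^ k x x\<close>. The diagonal matrix that relates
  these two varies with \<open>k\<close> and converges, so by discreteness it is outside \<open>G\<close> for large \<open>k\<close>.

  To start the process, one needs \<open>a\<close> and an element \<open>x\<close> whose upper left and off-diagonal entries do
  not vanish. This is \<open>nonelementary\<close>, where the finite volume is used. If there are no such
  elements, then \<open>G\<close> is conjugate to a group of diagonal matrices or of unipotent matrices and their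
  negatives, and there is a set of infinite volume that contains at most one point of each orbit. As
  the action preserves the volume (\<open>emeasure_H3_volume_image\<close>), no fundamental set has a smaller
  volume. The invariance of the volume is derived from that of the distance: it shows that the
  derivative of each transformation is a multiple of an orthogonal map, which gives the Jacobian.
\<close>

section \<open>Two-by-two complex matrices\<close>

definition mat2 :: "complex \<Rightarrow> complex \<Rightarrow> complex \<Rightarrow> complex \<Rightarrow> complex^2^2" where
  "mat2 a b c d = vector [vector [a, b], vector [c, d]]"

lemma mat2_nth [simp]:
  "mat2 a b c d $ 1 $ 1 = a" "mat2 a b c d $ 1 $ 2 = b"
  "mat2 a b c d $ 2 $ 1 = c" "mat2 a b c d $ 2 $ 2 = d"
  by (simp_all add: mat2_def)

lemma mat2_eq_iff [simp]:
  "mat2 a b c d = mat2 a' b' c' d' \<longleftrightarrow> a = a' \<and> b = b' \<and> c = c' \<and> d = d'"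
  by (auto simp: vec_eq_iff forall_2)

lemma mat2_eta: "A = mat2 (A$1$1) (A$1$2) (A$2$1) (A$2$2)"
  by (simp add: vec_eq_iff forall_2)

lemma mat2_mult [simp]:
  "mat2 a b c d ** mat2 a' b' c' d' =
     mat2 (a * a' + b * c') (a * b' + b * d') (c * a' + d * c') (c * b' + d * d')"
  by (simp add: vec_eq_iff forall_2 matrix_matrix_mult_def sum_2)

lemma det_mat2 [simp]: "det (mat2 a b c d) = a * d - b * c"
  by (simp add: det_2)

lemma trace_mat2 [simp]: "trace (mat2 a b c d) = a + d"
  by (simp add: trace_def sum_2)

lemma uminus_mat2 [simp]: "- mat2 a b c d = mat2 (- a) (- b) (- c) (- d)"
  by (simp add: vec_eq_iff forall_2)

lemma mat_1_mat2: "mat 1 = mat2 1 0 0 1"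
  by (simp add: vec_eq_iff forall_2 mat_def)

lemma norm_mat2_le: "norm (mat2 a b c d) \<le> cmod a + cmod b + cmod c + cmod d"
proof -
  have row: "norm (v :: complex^2) \<le> cmod (v$1) + cmod (v$2)" for v
    by (simp add: norm_vec_def L2_set_def sum_2 sqrt_sum_squares_le_sum)
  have "norm (mat2 a b c d) \<le> norm (mat2 a b c d $ 1) + norm (mat2 a b c d $ 2)"
    by (simp add: norm_vec_def[of "mat2 a b c d"] L2_set_def sum_2 sqrt_sum_squares_le_sum)
  then show ?thesis using row[of "mat2 a b c d $ 1"] row[of "mat2 a b c d $ 2"] by simp
qed

definition adj2 :: "complex^2^2 \<Rightarrow> complex^2^2" where
  "adj2 A = mat2 (A$2$2) (- A$1$2) (- A$2$1) (A$1$1)"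

lemma adj2_mat2 [simp]: "adj2 (mat2 a b c d) = mat2 d (- b) (- c) a"
  by (simp add: adj2_def)

lemma adj2_inverse:
  assumes "det A = 1" shows "A ** adj2 A = mat 1" "adj2 A ** A = mat 1"
proof -
  obtain a b c d where A: "A = mat2 a b c d" by (metis mat2_eta)
  show "A ** adj2 A = mat 1" "adj2 A ** A = mat 1"
    using assms by (simp_all add: A mat_1_mat2 algebra_simps)
qed

lemma det_adj2 [simp]: "det (adj2 A) = det A"
  by (simp add: adj2_def det_2 algebra_simps)

lemma adj2_mult: "adj2 (A ** B) = adj2 B ** adj2 A"
proof -
  obtain a b c d where A: "A = mat2 a b c d" by (metis mat2_eta)
  obtain a' b' c' d' where B: "B = mat2 a' b' c' d'" by (metis mat2_eta)
  show ?thesis by (simp add: A B algebra_simps)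
qed

lemma adj2_adj2 [simp]: "adj2 (adj2 A) = A"
  by (simp add: adj2_def flip: mat2_eta)

section \<open>Discrete groups of matrices\<close>

text \<open>
  The condition \<open>finite_bounded\<close> expresses discreteness. The group contains \<open>-1\<close>, so that it is the
  full preimage of a subgroup of the projective group.
\<close>

locale discrete_SL2 =
  fixes G :: "(complex^2^2) set"
  assumes det_mem: "A \<in> G \<Longrightarrow> det A = 1"
    and mult_mem: "A \<in> G \<Longrightarrow> B \<in> G \<Longrightarrow> A ** B \<in> G"
    and adj2_mem: "A \<in> G \<Longrightarrow> adj2 A \<in> G"
    and uminus_mem: "A \<in> G \<Longrightarrow> - A \<in> G"
    and one_mem: "mat 1 \<in> G"
    and finite_bounded: "finite {A \<in> G. norm A \<le> K}"
begin

lemma diag_power_mem: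
  assumes "mat2 l 0 0 (1 / l) \<in> G"
  shows "mat2 (l ^ n) 0 0 (1 / l ^ n) \<in> G" "mat2 (1 / l ^ n) 0 0 (l ^ n) \<in> G"
proof -
  show *: "mat2 (l ^ n) 0 0 (1 / l ^ n) \<in> G"
  proof (induction n)
    case 0 show ?case using one_mem by (simp add: mat_1_mat2)
  next
    case (Suc n)
    from mult_mem[OF assms Suc] show ?case by simp
  qed
  from adj2_mem[OF *] show "mat2 (1 / l ^ n) 0 0 (l ^ n) \<in> G" by simp
qed

end

section \<open>Conjugacy of elements following a long axis\<close>

lemma norm_divide_le: "cmod b \<ge> 1 \<Longrightarrow> cmod (a / b) \<le> cmod a"
  using divide_left_mono[of 1 "cmod b" "cmod a"] by (cases "b = 0") (simp_all add: norm_divide)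

text \<open>
  The matrices that commute with a non-scalar matrix \<open>M\<close> with eigenvalues \<open>m\<close> and \<open>1 / m\<close> are
  \<open>\<alpha> + \<beta> M\<close>, with eigenvalues \<open>\<eta> = \<alpha> + \<beta> m\<close> and \<open>\<alpha> + \<beta> / m\<close>. If the determinant is 1, the latter
  is \<open>1 / \<eta>\<close>, and the bounds come from solving these two linear equations for \<open>\<alpha>\<close> and \<open>\<beta>\<close>.
\<close>

lemma eigenvalue_estimates:
  fixes m \<alpha> \<beta> \<eta> :: complex
  assumes m: "cmod m \<ge> 2" and eta: "\<eta> = \<alpha> + \<beta> * m"
    and det: "\<alpha>\<^sup>2 + \<alpha> * \<beta> * (m + 1 / m) + \<beta>\<^sup>2 = 1"
    and eta1: "1 \<le> cmod \<eta>" and eta2: "(cmod \<eta>)\<^sup>2 \<le> cmod m"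
  shows "cmod \<beta> \<le> 4 * cmod \<eta> / cmod m" "cmod \<alpha> \<le> 5 / cmod \<eta>" "cmod \<alpha> \<le> 5 * cmod \<eta>"
proof -
  have m0: "m \<noteq> 0" and e0: "\<eta> \<noteq> 0" using m eta1 by auto
  have "(\<alpha> + \<beta> * m) * (\<alpha> + \<beta> / m) = \<alpha>\<^sup>2 + \<alpha> * \<beta> * (m + 1 / m) + \<beta>\<^sup>2"
    using m0 by (simp add: field_simps power2_eq_square)
  then have "\<eta> * (\<alpha> + \<beta> / m) = 1" by (simp only: det flip: eta)
  then have inv: "\<alpha> + \<beta> / m = 1 / \<eta>"
    using e0 by (metis nonzero_mult_div_cancel_left)
  have "\<beta> * (m - 1 / m) = \<eta> - 1 / \<eta>"
    unfolding inv[symmetric] by (simp add: eta algebra_simps)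
  then have b: "cmod \<beta> * cmod (m - 1 / m) = cmod (\<eta> - 1 / \<eta>)"
    by (metis norm_mult)
  have "cmod (1 / \<eta>) \<le> cmod \<eta>"
    using norm_divide_le[OF eta1, of 1] eta1 by simp
  then have e: "cmod (\<eta> - 1 / \<eta>) \<le> 2 * cmod \<eta>"
    using norm_triangle_ineq4[of \<eta> "1 / \<eta>"] by simp
  have "cmod (1 / m) \<le> 1 / 2" using frac_le[of 1 1 2 "cmod m"] m by (simp add: norm_divide)
  then have "cmod m / 2 \<le> cmod (m - 1 / m)"
    using norm_triangle_ineq2[of m "1 / m"] m by linarith
  then have "cmod \<beta> * (cmod m / 2) \<le> cmod \<beta> * cmod (m - 1 / m)"
    by (intro mult_left_mono) auto
  then have "cmod \<beta> * (cmod m / 2) \<le> 2 * cmod \<eta>" using b e by linarith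
  then show \<beta>: "cmod \<beta> \<le> 4 * cmod \<eta> / cmod m"
    using m by (subst pos_le_divide_eq) auto
  have "\<alpha> = 1 / \<eta> - \<beta> / m" using inv by (simp add: algebra_simps)
  then have "cmod \<alpha> \<le> cmod (1 / \<eta>) + cmod (\<beta> / m)" by (simp add: norm_triangle_ineq4)
  also have "cmod (\<beta> / m) \<le> 4 * cmod \<eta> / cmod m / cmod m"
    unfolding norm_divide using \<beta> by (rule divide_right_mono) simp
  also have "4 * cmod \<eta> / cmod m / cmod m \<le> 4 / cmod \<eta>"
  proof -
    have "(cmod \<eta>)\<^sup>2 \<le> cmod m * cmod m"
      using eta2 m mult_left_mono[of 1 "cmod m" "cmod m"] by simp
    then show ?thesis using e0 m0 by (simp add: field_simps power2_eq_square)
  qed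
  finally show \<alpha>: "cmod \<alpha> \<le> 5 / cmod \<eta>" by (simp add: norm_divide)
  also have "\<dots> \<le> 5 * cmod \<eta>"
    using \<open>cmod (1 / \<eta>) \<le> cmod \<eta>\<close> by (simp add: norm_divide)
  finally show "cmod \<alpha> \<le> 5 * cmod \<eta>" .
qed

lemma power_scale_ge_1:
  fixes x k :: real
  assumes "1 \<le> x" "1 < k"
  shows "\<exists>j. (x / k ^ j)\<^sup>2 \<le> k \<and> 1 \<le> k * (x / k ^ j)\<^sup>2"
proof -
  define Q where "Q j \<longleftrightarrow> (x / k ^ j)\<^sup>2 \<le> k" for j :: nat
  obtain n where "x < k ^ n" using real_arch_pow assms by blast
  then have "x / k ^ n \<le> 1" "x / k ^ n \<ge> 0" using assms by (auto simp: field_simps)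
  then have "(x / k ^ n)\<^sup>2 \<le> 1" by (rule power_le_one[rotated])
  then have "Q n" unfolding Q_def using assms by simp
  define j where "j = (LEAST j. Q j)"
  have j: "Q j" unfolding j_def using \<open>Q n\<close> by (rule LeastI)
  have "1 \<le> k * (x / k ^ j)\<^sup>2"
  proof (cases j)
    case 0
    have "1 \<le> x\<^sup>2" using assms by simp
    then show ?thesis using 0 assms mult_mono[of 1 k 1 "x\<^sup>2"] by simp
  next
    case (Suc i)
    have "\<not> Q i" using not_less_Least[of i Q] Suc unfolding j_def by auto
    then have "k < (k * (x / k ^ j))\<^sup>2" using assms Suc by (simp add: Q_def)
    also have "\<dots> = k * (k * (x / k ^ j)\<^sup>2)" by (simp add: power2_eq_square)
    finally show ?thesis using assms by simp
  qed
  with j show ?thesis by (auto simp: Q_def)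
qed

text \<open>
  The interval from \<open>k\<close> to the power \<open>-1/2\<close> to \<open>k\<close> to the power \<open>1/2\<close> meets every orbit of
  multiplication by \<open>k\<close>. It is symmetric under inversion; this is what allows exchanging a conjugator
  with its inverse below.
\<close>

lemma power_scale:
  fixes x k :: real
  assumes "0 < x" "1 < k"
  shows "\<exists>j y. (y = x * k ^ j \<or> y = x / k ^ j) \<and> y\<^sup>2 \<le> k \<and> 1 \<le> k * y\<^sup>2"
proof (cases "x \<ge> 1")
  case True
  then show ?thesis using power_scale_ge_1[OF True assms(2)] by blast
next
  case False
  then have "1 \<le> 1 / x" using assms by simp
  from power_scale_ge_1[OF this assms(2)] obtain j
    where j: "(1 / x / k ^ j)\<^sup>2 \<le> k" "1 \<le> k * (1 / x / k ^ j)\<^sup>2" by blast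
  define y where "y = x * k ^ j"
  have y: "1 / x / k ^ j = 1 / y" "y > 0" using assms by (simp_all add: y_def)
  have "y\<^sup>2 \<le> k \<and> 1 \<le> k * y\<^sup>2"
    using j y(2) unfolding y(1) by (simp add: field_simps)
  then show ?thesis unfolding y_def by blast
qed

text \<open>
  The two rows of the centralizer element \<open>\<alpha> + \<beta> M\<close>, where \<open>M\<close> has the rows \<open>(L p, L q)\<close> and
  \<open>(r / L, s / L)\<close>, are bounded by constant multiples of \<open>\<eta>\<close> and \<open>1 / \<eta>\<close>. Dividing the first row by
  \<open>\<mu> ^ i\<close> and multiplying the second by it, with \<open>cmod \<mu> ^ i\<close> the last power of \<open>cmod \<mu>\<close> not
  above \<open>cmod \<eta>\<close>, makes all entries bounded independently of \<open>L\<close>; and the lower left entry even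
  tends to 0 as \<open>L\<close> grows.
\<close>

lemma conjugator_bound:
  fixes \<mu> m \<alpha> \<beta> \<eta> L p q r s :: complex
  assumes l: "cmod \<mu> > 1" and L: "cmod L \<ge> 1" and p: "p \<noteq> 0" and Lp: "cmod L * cmod p \<le> 4 * cmod m"
    and m: "cmod m \<ge> 2" and eta: "\<eta> = \<alpha> + \<beta> * m"
    and det: "\<alpha>\<^sup>2 + \<alpha> * \<beta> * (m + 1 / m) + \<beta>\<^sup>2 = 1"
    and eta1: "1 \<le> cmod \<eta>" and eta2: "(cmod \<eta>)\<^sup>2 \<le> cmod m"
  shows "\<exists>i. cmod ((\<alpha> + \<beta> * (L * p)) / \<mu> ^ i) \<le> 21 * cmod \<mu> \<and>
    cmod (\<beta> * (L * q) / \<mu> ^ i) \<le> 16 * cmod q / cmod p * cmod \<mu> \<and>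
    cmod (\<mu> ^ i * (\<beta> * (r / L))) \<le> 4 * cmod r / cmod L \<and>
    cmod (\<mu> ^ i * (\<alpha> + \<beta> * (s / L))) \<le> 5 + 4 * cmod s"
proof -
  note est = eigenvalue_estimates[OF m eta det eta1 eta2]
  define e P l M where "e = cmod \<eta>" "P = cmod L" "l = cmod \<mu>" "M = cmod m"
  note d = this
  have pos: "e \<ge> 1" "P \<ge> 1" "l > 1" "M \<ge> 2" "cmod p > 0" using assms by (auto simp: d)
  obtain n where "e < l ^ n" using real_arch_pow pos by blast
  define j where "j = (LEAST n. e < l ^ n)"
  have j: "e < l ^ j" unfolding j_def using \<open>e < l ^ n\<close> by (rule LeastI)
  then have "j \<noteq> 0" using pos by (cases j) auto
  then obtain i where i: "j = Suc i" using not0_implies_Suc by blast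
  have "\<not> e < l ^ i" using not_less_Least[of i "\<lambda>n. e < l ^ n"] i unfolding j_def by auto
  then have li: "l ^ i \<le> e" and li1: "l ^ i > 0" and le: "e / l ^ i \<le> l"
    using j pos by (auto simp: i field_simps)
  have be: "cmod \<beta> \<le> 4 * e / M" and al: "cmod \<alpha> \<le> 5 / e" "cmod \<alpha> \<le> 5 * e"
    using est by (simp_all add: d)
  have e2: "e * e \<le> M" using eta2 by (simp add: d power2_eq_square)
  have PM: "P * cmod p \<le> 4 * M" using Lp by (simp add: d)
  have bP: "cmod \<beta> * P * cmod p \<le> 16 * e"
  proof -
    have "cmod \<beta> * (P * cmod p) \<le> (4 * e / M) * (4 * M)"
      by (rule mult_mono[OF be PM]) (use pos in auto)
    then show ?thesis using pos by (simp add: mult.assoc)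
  qed
  have "cmod (\<alpha> + \<beta> * (L * p)) \<le> cmod \<alpha> + cmod \<beta> * P * cmod p"
    using norm_triangle_ineq[of \<alpha> "\<beta> * (L * p)"] by (simp add: norm_mult d mult.assoc)
  then have "cmod (\<alpha> + \<beta> * (L * p)) \<le> 21 * e" using al bP by linarith
  then have "cmod (\<alpha> + \<beta> * (L * p)) / l ^ i \<le> 21 * e / l ^ i"
    using li1 by (intro divide_right_mono) auto
  then have 1: "cmod ((\<alpha> + \<beta> * (L * p)) / \<mu> ^ i) \<le> 21 * l"
    using le by (simp add: norm_divide norm_power d)
  have "cmod (\<beta> * (L * q) / \<mu> ^ i) = (cmod \<beta> * P * cmod p) / l ^ i * (cmod q / cmod p)"
    using pos by (simp add: norm_divide norm_mult norm_power d)
  also have "\<dots> \<le> (16 * e) / l ^ i * (cmod q / cmod p)"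
    using bP li1 by (intro mult_right_mono divide_right_mono) auto
  also have "\<dots> \<le> 16 * l * (cmod q / cmod p)"
    using le by (intro mult_right_mono) auto
  finally have 2: "cmod (\<beta> * (L * q) / \<mu> ^ i) \<le> 16 * cmod q / cmod p * l"
    by (simp add: mult_ac)
  have b2: "l ^ i * cmod \<beta> \<le> 4"
  proof -
    have "l ^ i * cmod \<beta> \<le> e * (4 * e / M)"
      using li be li1 pos by (intro mult_mono) auto
    also have "\<dots> = 4 * (e * e) / M" by simp
    also have "\<dots> \<le> 4" using e2 pos by (simp add: divide_le_eq)
    finally show ?thesis .
  qed
  have "l ^ i * cmod \<beta> * (cmod r / P) \<le> 4 * (cmod r / P)"
    using b2 pos by (intro mult_right_mono) auto
  then have 3: "cmod (\<mu> ^ i * (\<beta> * (r / L))) \<le> 4 * cmod r / P"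
    by (simp add: norm_mult norm_divide norm_power d mult.assoc)
  have "l ^ i * cmod \<alpha> \<le> e * (5 / e)"
    using li al li1 pos by (intro mult_mono) auto
  then have a5: "l ^ i * cmod \<alpha> \<le> 5" using pos by simp
  have "cmod (\<beta> * (s / L)) \<le> cmod \<beta> * cmod s"
  proof -
    have "cmod s / P \<le> cmod s" using norm_divide_le[OF L, of s] by (simp add: d norm_divide)
    then show ?thesis by (simp only: norm_mult norm_divide d) (metis mult_left_mono norm_ge_zero)
  qed
  then have "cmod (\<alpha> + \<beta> * (s / L)) \<le> cmod \<alpha> + cmod \<beta> * cmod s"
    using norm_triangle_ineq[of \<alpha> "\<beta> * (s / L)"] by linarith
  then have "l ^ i * cmod (\<alpha> + \<beta> * (s / L)) \<le> l ^ i * (cmod \<alpha> + cmod \<beta> * cmod s)"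
    using li1 by (intro mult_left_mono) auto
  also have "\<dots> = l ^ i * cmod \<alpha> + l ^ i * cmod \<beta> * cmod s" by (simp add: algebra_simps)
  also have "\<dots> \<le> 5 + 4 * cmod s" using a5 b2 by (intro add_mono mult_right_mono) auto
  finally have 4: "cmod (\<mu> ^ i * (\<alpha> + \<beta> * (s / L))) \<le> 5 + 4 * cmod s"
    by (simp add: norm_mult norm_power d)
  show ?thesis using 1 2 3 4 unfolding d by blast
qed

lemma filterlim_realpow_at_top:
  fixes x :: real assumes "x > 1" shows "filterlim (\<lambda>n. x ^ n) at_top sequentially"
  using filterlim_realpow_sequentially_gt1[of x] assms
  by (simp add: filterlim_at_infinity_conv_norm_at_top norm_power)

text \<open>
  The trace is dominated by \<open>\<mu> ^ N * p\<close>, and hence so is the large eigenvalue.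
\<close>

lemma large_trace_eigenvalue:
  fixes \<mu> p s :: complex
  assumes l: "cmod \<mu> > 1" and p: "p \<noteq> 0"
  shows "\<forall>\<^sub>F N in sequentially. \<forall>m. cmod m \<ge> 1 \<longrightarrow> m + 1 / m = \<mu> ^ N * p + s / \<mu> ^ N \<longrightarrow>
    cmod m \<ge> 2 \<and> cmod (\<mu> ^ N) * cmod p \<le> 4 * cmod m"
proof -
  have lim: "filterlim (\<lambda>N. cmod \<mu> ^ N) at_top sequentially"
    using l by (rule filterlim_realpow_at_top)
  have "\<forall>\<^sub>F N in sequentially. cmod \<mu> ^ N \<ge> (8 + 2 * cmod s) / cmod p"
    using lim by (simp add: filterlim_at_top)
  then show ?thesis
  proof eventually_elim
    case (elim N)
    define P where "P = cmod \<mu> ^ N"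
    have P1: "P \<ge> 1" using l by (simp add: P_def one_le_power)
    have P2: "P * cmod p \<ge> 8 + 2 * cmod s" using elim p by (simp add: P_def field_simps)
    show ?case
    proof (intro allI impI)
      fix m assume m1: "cmod m \<ge> 1" and m: "m + 1 / m = \<mu> ^ N * p + s / \<mu> ^ N"
      have "cmod (1 / m) \<le> cmod m" using norm_divide_le[OF m1, of 1] m1 by simp
      then have "cmod (m + 1 / m) \<le> 2 * cmod m" using norm_triangle_ineq[of m "1 / m"] by linarith
      moreover have "cmod (\<mu> ^ N * p) - cmod (s / \<mu> ^ N) \<le> cmod (\<mu> ^ N * p + s / \<mu> ^ N)"
        by (metis add.commute diff_le_eq norm_diff_triangle_ineq norm_triangle_ineq4 add_diff_cancel_right')
      moreover have "cmod (s / \<mu> ^ N) \<le> cmod s"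
        using P1 by (intro norm_divide_le) (simp add: P_def norm_power)
      ultimately have "P * cmod p - cmod s \<le> 2 * cmod m"
        by (simp add: m norm_mult norm_power P_def)
      then have "P * cmod p \<le> 4 * cmod m" "cmod m \<ge> 2" using P2 norm_ge_zero[of s] by linarith+
      then show "cmod m \<ge> 2 \<and> cmod (\<mu> ^ N) * cmod p \<le> 4 * cmod m"
        by (simp add: norm_power P_def)
    qed
  qed
qed

context discrete_SL2
begin

text \<open>
  Write \<open>M\<close> and \<open>M'\<close> for the two displayed matrices and \<open>C\<close> for the diagonal matrix with entries \<open>\<tau>\<close>
  and \<open>1 / \<tau>\<close>. Since \<open>C\<close> also conjugates \<open>M\<close> to \<open>M'\<close>, every conjugator \<open>\<gamma>\<close> is \<open>C\<close> times an element
  \<open>\<alpha> + \<beta> M\<close> of the centralizer of \<open>M\<close>, and \<open>\<eta>\<close> is the eigenvalue of that element for the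
  eigenvector of \<open>M\<close> with eigenvalue \<open>m\<close>. Multiplying \<open>\<gamma>\<close> by a power of the given diagonal element
  of \<open>G\<close> puts it in a bounded set, which contains finitely many elements of \<open>G\<close>. Its lower left
  entry tends to 0, so it is 0 once \<open>N\<close> is large; then \<open>\<beta> = 0\<close> and \<open>\<gamma>\<close> is \<open>C\<close> up to sign.
\<close>

lemma conjugate_imp_diag_if_expanding:
  assumes l: "cmod \<mu> > 1" and lG: "mat2 \<mu> 0 0 (1 / \<mu>) \<in> G" and p: "p \<noteq> 0" and q: "q \<noteq> 0" and r: "r \<noteq> 0"
    and ps: "p * s - q * r = 1" and t: "\<tau> \<noteq> 0"
  shows "\<forall>\<^sub>F N in sequentially. \<forall>\<gamma>\<in>G. \<forall>m \<eta>.
    cmod m \<ge> 1 \<and> m + 1 / m = \<mu> ^ N * p + s / \<mu> ^ N \<and>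
    \<gamma> ** mat2 (\<mu> ^ N * p) (\<mu> ^ N * q) (r / \<mu> ^ N) (s / \<mu> ^ N) =
      mat2 (\<mu> ^ N * p) (\<mu> ^ N * (\<tau>\<^sup>2 * q)) (r / \<tau>\<^sup>2 / \<mu> ^ N) (s / \<mu> ^ N) ** \<gamma> \<and>
    \<eta> = (\<gamma>$1$1 + \<gamma>$1$2 * ((m - \<mu> ^ N * p) / (\<mu> ^ N * q))) / \<tau> \<and>
    1 \<le> cmod \<eta> \<and> (cmod \<eta>)\<^sup>2 \<le> cmod m \<longrightarrow> mat2 \<tau> 0 0 (1 / \<tau>) \<in> G"
proof -
  define K where "K = cmod \<tau> * (21 * cmod \<mu>) + cmod \<tau> * (16 * cmod q / cmod p * cmod \<mu>)
    + 4 * cmod r / cmod \<tau> + (5 + 4 * cmod s) / cmod \<tau>"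
  define Fs where "Fs = {A \<in> G. norm A \<le> K}"
  have fin: "finite Fs" unfolding Fs_def by (rule finite_bounded)
  have lim: "(\<lambda>N. 4 * cmod r / cmod \<tau> / cmod \<mu> ^ N) \<longlonglongrightarrow> 0"
    by (intro real_tendsto_divide_at_top[OF tendsto_const] filterlim_realpow_at_top l)
  have "\<forall>\<^sub>F N in sequentially. \<forall>f\<in>Fs. f$2$1 \<noteq> 0 \<longrightarrow> 4 * cmod r / cmod \<tau> / cmod \<mu> ^ N < cmod (f$2$1)"
  proof (rule eventually_ball_finite[OF fin], intro ballI)
    fix f
    show "\<forall>\<^sub>F N in sequentially. f$2$1 \<noteq> 0 \<longrightarrow> 4 * cmod r / cmod \<tau> / cmod \<mu> ^ N < cmod (f$2$1)"
      using order_tendstoD(2)[OF lim, of "cmod (f$2$1)"] by (cases "f$2$1 = 0") auto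
  qed
  then show ?thesis using large_trace_eigenvalue[OF l p, of s]
  proof eventually_elim
    case (elim N)
    show ?case
    proof (intro ballI allI impI, elim conjE)
      fix \<gamma> m \<eta>
      assume \<gamma>: "\<gamma> \<in> G" and m1: "cmod m \<ge> 1" and mT: "m + 1 / m = \<mu> ^ N * p + s / \<mu> ^ N"
        and comm: "\<gamma> ** mat2 (\<mu> ^ N * p) (\<mu> ^ N * q) (r / \<mu> ^ N) (s / \<mu> ^ N) =
          mat2 (\<mu> ^ N * p) (\<mu> ^ N * (\<tau>\<^sup>2 * q)) (r / \<tau>\<^sup>2 / \<mu> ^ N) (s / \<mu> ^ N) ** \<gamma>"
        and \<eta>: "\<eta> = (\<gamma>$1$1 + \<gamma>$1$2 * ((m - \<mu> ^ N * p) / (\<mu> ^ N * q))) / \<tau>"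
        and eta: "1 \<le> cmod \<eta>" "(cmod \<eta>)\<^sup>2 \<le> cmod m"
      define L where "L = \<mu> ^ N"
      have L1: "cmod L \<ge> 1" using l by (simp add: L_def norm_power one_le_power)
      then have L0: "L \<noteq> 0" by auto
      obtain g1 g2 g3 g4 where g: "\<gamma> = mat2 g1 g2 g3 g4" by (metis mat2_eta)
      define \<beta> where "\<beta> = g2 / (\<tau> * L * q)"
      define \<alpha> where "\<alpha> = g1 / \<tau> - \<beta> * (L * p)"
      have g2: "g2 = \<tau> * (\<beta> * (L * q))" using L0 q t by (simp add: \<beta>_def)
      have g1: "g1 = \<tau> * (\<alpha> + \<beta> * (L * p))" using t by (simp add: \<alpha>_def)
      have "g1 * (L * p) + g2 * (r / L) = L * p * g1 + L * (\<tau>\<^sup>2 * q) * g3"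
        and "g1 * (L * q) + g2 * (s / L) = L * p * g2 + L * (\<tau>\<^sup>2 * q) * g4"
        using comm by (simp_all add: g L_def)
      moreover have nz: "\<tau>\<^sup>2 * q * L \<noteq> 0" using L0 q t by simp
      ultimately have "(\<tau>\<^sup>2 * q * L) * g3 = (\<tau>\<^sup>2 * q * L) * (\<beta> * (r / L) / \<tau>)"
        and "(\<tau>\<^sup>2 * q * L) * g4 = (\<tau>\<^sup>2 * q * L) * ((\<alpha> + \<beta> * (s / L)) / \<tau>)"
        unfolding g1 g2 using L0 t by (auto simp: field_simps power2_eq_square)
      then have g3: "g3 = \<beta> * (r / L) / \<tau>" and g4: "g4 = (\<alpha> + \<beta> * (s / L)) / \<tau>"
        using L0 q t by (simp_all only: mult_left_cancel[OF nz])
      have "g1 * g4 - g2 * g3 = 1" using det_mem[OF \<gamma>] by (simp add: g)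
      then have "(\<alpha> + \<beta> * (L * p)) * (\<alpha> + \<beta> * (s / L)) - \<beta> * (L * q) * (\<beta> * (r / L)) = 1"
        using t unfolding g1 g2 g3 g4 by simp
      moreover have "(\<alpha> + \<beta> * (L * p)) * (\<alpha> + \<beta> * (s / L)) - \<beta> * (L * q) * (\<beta> * (r / L)) =
          \<alpha>\<^sup>2 + \<alpha> * \<beta> * (L * p + s / L) + \<beta>\<^sup>2 * (p * s - q * r)"
        using L0 by (simp add: field_simps power2_eq_square)
      ultimately have det: "\<alpha>\<^sup>2 + \<alpha> * \<beta> * (m + 1 / m) + \<beta>\<^sup>2 = 1"
        by (simp add: ps mT L_def)
      have eta': "\<eta> = \<alpha> + \<beta> * m"
        using t L0 q by (simp add: \<eta> g flip: L_def) (simp add: g1 g2 field_simps)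
      have m2: "cmod m \<ge> 2" "cmod L * cmod p \<le> 4 * cmod m"
        using elim(2) m1 mT by (auto simp: L_def)
      obtain i where i: "cmod ((\<alpha> + \<beta> * (L * p)) / \<mu> ^ i) \<le> 21 * cmod \<mu>"
        "cmod (\<beta> * (L * q) / \<mu> ^ i) \<le> 16 * cmod q / cmod p * cmod \<mu>"
        "cmod (\<mu> ^ i * (\<beta> * (r / L))) \<le> 4 * cmod r / cmod L"
        "cmod (\<mu> ^ i * (\<alpha> + \<beta> * (s / L))) \<le> 5 + 4 * cmod s"
        using conjugator_bound[OF l L1 p m2(2,1) eta' det eta, of q r s] by blast
      define f where "f = mat2 (1 / \<mu> ^ i) 0 0 (\<mu> ^ i) ** \<gamma>"
      have fG: "f \<in> G" unfolding f_def by (intro mult_mem diag_power_mem lG \<gamma>)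
      have f: "f = mat2 (\<tau> * ((\<alpha> + \<beta> * (L * p)) / \<mu> ^ i)) (\<tau> * (\<beta> * (L * q) / \<mu> ^ i))
          (\<mu> ^ i * (\<beta> * (r / L)) / \<tau>) (\<mu> ^ i * (\<alpha> + \<beta> * (s / L)) / \<tau>)"
        by (simp add: f_def g g1 g2 g3 g4)
      have "4 * cmod r / cmod L \<le> 4 * cmod r" using norm_divide_le[OF L1, of r] by (simp add: norm_divide)
      then have i3: "cmod (\<mu> ^ i * (\<beta> * (r / L))) \<le> 4 * cmod r" using i(3) by linarith
      have t0: "cmod \<tau> > 0" using t by simp
      have "norm f \<le> K"
        unfolding f K_def
        by (rule order_trans[OF norm_mat2_le], intro add_mono)
          (use i(1,2,4) i3 t0 in \<open>simp_all only: norm_mult[of \<tau>] norm_divide[of _ \<tau>]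
            mult_left_mono divide_right_mono norm_ge_zero\<close>)
      then have "f \<in> Fs" using fG by (simp add: Fs_def)
      moreover have "cmod (f$2$1) \<le> 4 * cmod r / cmod \<tau> / cmod \<mu> ^ N"
        using divide_right_mono[OF i(3), of "cmod \<tau>"] t0
        by (simp only: f mat2_nth norm_divide[of _ \<tau>] L_def norm_power divide_divide_eq_left mult.commute less_imp_le)
      ultimately have "f$2$1 = 0" using elim(1) by force
      then have "\<beta> = 0" using L0 t r l by (auto simp: f)
      then have "\<alpha>\<^sup>2 = 1" using det by simp
      then have "\<alpha> = 1 \<or> \<alpha> = -1" by (simp add: power2_eq_1_iff)
      moreover have "\<gamma> = mat2 (\<tau> * \<alpha>) 0 0 (\<alpha> / \<tau>)" using \<open>\<beta> = 0\<close> by (simp add: g g1 g2 g3 g4)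
      ultimately have "\<gamma> = mat2 \<tau> 0 0 (1 / \<tau>) \<or> - \<gamma> = mat2 \<tau> 0 0 (1 / \<tau>)" by auto
      then show "mat2 \<tau> 0 0 (1 / \<tau>) \<in> G" using \<gamma> uminus_mem[OF \<gamma>] by metis
    qed
  qed
qed


text \<open>
  Here \<open>(v1, v2)\<close> is an eigenvector of \<open>M\<close>, so replacing \<open>\<gamma>\<close> by \<open>\<gamma> M\<close>, which is again a conjugator,
  multiplies the first coordinate of \<open>\<gamma> (v1, v2)\<close> by \<open>m\<close>.
\<close>

lemma conjugator_adjust:
  fixes m v1 v2 :: complex
  assumes \<gamma>: "\<gamma> \<in> G" "\<gamma> ** M = M' ** \<gamma>" and M: "M \<in> G" and m: "cmod m > 1"
    and v: "M$1$1 * v1 + M$1$2 * v2 = m * v1" "M$2$1 * v1 + M$2$2 * v2 = m * v2"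
    and eta: "\<gamma>$1$1 * v1 + \<gamma>$1$2 * v2 \<noteq> 0" and t: "\<tau> \<noteq> 0"
  shows "\<exists>\<gamma>'\<in>G. \<gamma>' ** M = M' ** \<gamma>' \<and>
    (cmod ((\<gamma>'$1$1 * v1 + \<gamma>'$1$2 * v2) / \<tau>))\<^sup>2 \<le> cmod m \<and>
    1 \<le> cmod m * (cmod ((\<gamma>'$1$1 * v1 + \<gamma>'$1$2 * v2) / \<tau>))\<^sup>2"
proof -
  define \<phi> where "\<phi> B = cmod ((B$1$1 * v1 + B$1$2 * v2) / \<tau>)" for B :: "complex^2^2"
  have m0: "m \<noteq> 0" using m by auto
  have lin: "(B ** M)$1$1 * v1 + (B ** M)$1$2 * v2 = m * (B$1$1 * v1 + B$1$2 * v2)" for B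
  proof -
    have "(B ** M)$1$1 * v1 + (B ** M)$1$2 * v2 =
        B$1$1 * (M$1$1 * v1 + M$1$2 * v2) + B$1$2 * (M$2$1 * v1 + M$2$2 * v2)"
      by (simp add: matrix_matrix_mult_def sum_2 algebra_simps)
    then show ?thesis unfolding v by (simp add: algebra_simps)
  qed
  have up: "\<phi> (B ** M) = \<phi> B * cmod m" for B
    by (simp add: \<phi>_def lin norm_mult norm_divide)
  have down: "\<phi> (B ** adj2 M) = \<phi> B / cmod m" for B
  proof -
    have "(B ** adj2 M) ** M = B"
      by (metis M adj2_inverse(2) det_mem matrix_mul_assoc matrix_mul_rid)
    then show ?thesis using up[of "B ** adj2 M"] m0 by simp
  qed
  have "\<exists>B\<in>G. B ** M = M' ** B \<and> \<phi> B = \<phi> \<gamma> * cmod m ^ j" for j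
  proof (induction j)
    case 0 then show ?case using \<gamma> by auto
  next
    case (Suc j)
    then obtain B where B: "B \<in> G" "B ** M = M' ** B" "\<phi> B = \<phi> \<gamma> * cmod m ^ j" by blast
    have "(B ** M) ** M = M' ** (B ** M)" by (metis B(2) matrix_mul_assoc)
    then show ?case using B mult_mem[OF B(1) M] up[of B]
      by (intro bexI[of _ "B ** M"]) (simp_all only: power_Suc mult_ac simp_thms)
  qed
  moreover have "\<exists>B\<in>G. B ** M = M' ** B \<and> \<phi> B = \<phi> \<gamma> / cmod m ^ j" for j
  proof (induction j)
    case 0 then show ?case using \<gamma> by auto
  next
    case (Suc j)
    then obtain B where B: "B \<in> G" "B ** M = M' ** B" "\<phi> B = \<phi> \<gamma> / cmod m ^ j" by blast
    have "M ** adj2 M = mat 1" "adj2 M ** M = mat 1" using M det_mem adj2_inverse by auto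
    then have "(B ** adj2 M) ** M = M' ** (B ** adj2 M)"
      by (metis B(2) matrix_mul_assoc matrix_mul_rid)
    then show ?case using B mult_mem[OF B(1) adj2_mem[OF M]] down[of B]
      by (intro bexI[of _ "B ** adj2 M"]) (auto simp: mult.commute)
  qed
  moreover have "\<phi> \<gamma> > 0" using eta t by (simp add: \<phi>_def)
  then obtain j y where y: "y = \<phi> \<gamma> * cmod m ^ j \<or> y = \<phi> \<gamma> / cmod m ^ j"
    "y\<^sup>2 \<le> cmod m" "1 \<le> cmod m * y\<^sup>2"
    using power_scale[OF _ m] by metis
  ultimately obtain B where "B \<in> G" "B ** M = M' ** B" "\<phi> B = y" by metis
  with y(2,3) show ?thesis unfolding \<phi>_def by auto
qed

end

lemma exists_eigenvalue_ge_1: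
  fixes T :: complex
  shows "\<exists>m. cmod m \<ge> 1 \<and> m + 1 / m = T"
proof -
  define r where "r = csqrt (T\<^sup>2 - 4)"
  define m where "m = (T + r) / 2"
  have "r * r = T * T - 4" by (simp add: r_def flip: power2_eq_square)
  then have 1: "m * (T - m) = 1" by (simp add: m_def field_simps)
  then have m0: "m \<noteq> 0" by auto
  then have m: "T - m = 1 / m" using 1 by (metis nonzero_mult_div_cancel_left)
  show ?thesis
  proof (cases "cmod m \<ge> 1")
    case True
    then show ?thesis using m by (intro exI[of _ m]) (auto simp: algebra_simps)
  next
    case False
    then show ?thesis using m m0
      by (intro exI[of _ "1 / m"]) (auto simp: algebra_simps norm_divide le_divide_eq)
  qed
qed

text \<open>
  Geometrically, the axis of the product of a high power \<open>a ^ N\<close> of a diagonal loxodromic element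
  with \<open>x\<close> runs along translates of the axis of \<open>a\<close> for almost all of its period. A conjugator in \<open>G\<close>
  between two such products must, by discreteness, respect these long stretches, so it can only be
  the obvious diagonal one. For the proof, the conjugator is adjusted so that the size of its
  eigenvalue \<open>\<eta>\<close> lies between the square roots of \<open>cmod m\<close> and of its inverse. If \<open>\<eta>\<close> has modulus
  less than 1, the inverse conjugator is used, with the roles of the two products exchanged.
\<close>

lemma (in discrete_SL2) conjugate_imp_diag:
  assumes l: "cmod \<mu> > 1" and lG: "mat2 \<mu> 0 0 (1 / \<mu>) \<in> G" and p: "p \<noteq> 0" and q: "q \<noteq> 0" and r: "r \<noteq> 0"
    and xG: "mat2 p q r s \<in> G" and t: "\<tau> \<noteq> 0" and x'G: "mat2 p (\<tau>\<^sup>2 * q) (r / \<tau>\<^sup>2) s \<in> G"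
  shows "\<forall>\<^sub>F N in sequentially. \<forall>\<gamma>\<in>G.
    \<gamma> ** (mat2 (\<mu> ^ N) 0 0 (1 / \<mu> ^ N) ** mat2 p q r s) =
      (mat2 (\<mu> ^ N) 0 0 (1 / \<mu> ^ N) ** mat2 p (\<tau>\<^sup>2 * q) (r / \<tau>\<^sup>2) s) ** \<gamma> \<longrightarrow>
    mat2 \<tau> 0 0 (1 / \<tau>) \<in> G"
proof -
  have ps: "p * s - q * r = 1" using det_mem[OF xG] by simp
  have t': "1 / \<tau> \<noteq> 0" "\<tau>\<^sup>2 * q \<noteq> 0" "r / \<tau>\<^sup>2 \<noteq> 0" "p * s - \<tau>\<^sup>2 * q * (r / \<tau>\<^sup>2) = 1"
    using t q r ps by simp_all
  note 1 = conjugate_imp_diag_if_expanding[OF l lG p q r ps t]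
  note 2 = conjugate_imp_diag_if_expanding[OF l lG p t'(2,3,4,1)]
  show ?thesis using 1 2 large_trace_eigenvalue[OF l p, of s]
  proof eventually_elim
    case (elim N)
    show ?case
    proof (intro ballI impI)
      fix \<gamma> assume \<gamma>: "\<gamma> \<in> G" and comm: "\<gamma> ** (mat2 (\<mu> ^ N) 0 0 (1 / \<mu> ^ N) ** mat2 p q r s) =
          (mat2 (\<mu> ^ N) 0 0 (1 / \<mu> ^ N) ** mat2 p (\<tau>\<^sup>2 * q) (r / \<tau>\<^sup>2) s) ** \<gamma>"
      define L where "L = \<mu> ^ N"
      have L0: "L \<noteq> 0" using l by (auto simp: L_def)
      define M where "M = mat2 (L * p) (L * q) (r / L) (s / L)"
      define M' where "M' = mat2 (L * p) (L * (\<tau>\<^sup>2 * q)) (r / \<tau>\<^sup>2 / L) (s / L)"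
      have D: "mat2 L 0 0 (1 / L) \<in> G" using diag_power_mem(1)[OF lG] by (simp add: L_def)
      have MG: "M \<in> G" using mult_mem[OF D xG] by (simp add: M_def)
      have M'G: "M' \<in> G" using mult_mem[OF D x'G] by (simp add: M'_def mult.commute)
      have comm': "\<gamma> ** M = M' ** \<gamma>" using comm by (simp add: L_def M_def M'_def mult.commute)
      obtain m where m: "cmod m \<ge> 1" "m + 1 / m = L * p + s / L" using exists_eigenvalue_ge_1 by blast
      have m2: "cmod m \<ge> 2" using elim(3) m by (simp add: L_def)
      then have m1: "cmod m > 1" and m0: "m \<noteq> 0" by auto
      define v2 where "v2 = (m - L * p) / (L * q)"
      have char: "(m - L * p) * (m - s / L) = q * r"
      proof -
        have "m * m + 1 = m * (L * p + s / L)" unfolding m(2)[symmetric] using m0 by (simp add: field_simps)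
        moreover have "(m - L * p) * (m - s / L) = m * m - m * (L * p + s / L) + p * s"
          using L0 by (simp add: algebra_simps)
        moreover have "p * s = 1 + q * r" using ps by (simp add: algebra_simps)
        ultimately show ?thesis by (simp add: algebra_simps)
      qed
      have v: "M$1$1 * 1 + M$1$2 * v2 = m * 1" "M$2$1 * 1 + M$2$2 * v2 = m * v2"
      proof -
        show "M$1$1 * 1 + M$1$2 * v2 = m * 1" using L0 q by (simp add: M_def v2_def)
        have "(m - s / L) * v2 = q * r / (L * q)" using char by (simp add: v2_def mult.commute)
        also have "\<dots> = r / L" using q by simp
        finally show "M$2$1 * 1 + M$2$2 * v2 = m * v2" by (simp add: M_def algebra_simps)
      qed
      define e where "e B = (B$1$1 + B$1$2 * v2) / \<tau>" for B :: "complex^2^2"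
      have row: "\<gamma>$1$1 * 1 + \<gamma>$1$2 * v2 = \<tau> * e \<gamma>" for \<gamma> :: "complex^2^2" using t by (simp add: e_def)
      \<comment> \<open>\<open>e B\<close> is the eigenvalue, on the eigenvector \<open>(1, v2)\<close> of \<open>M\<close>, of the inverse of the
        diagonal conjugator times \<open>B\<close>; for the inverse conjugation from \<open>M'\<close> to \<open>M\<close> the eigenvalue is inverted.\<close>
      have inverse_e: "e B * ((adj2 B $1$1 + adj2 B $1$2 * ((m - L * p) / (L * (\<tau>\<^sup>2 * q)))) / (1 / \<tau>)) = 1"
        if B: "B \<in> G" "B ** M = M' ** B" for B
      proof -
        obtain b1 b2 b3 b4 where b: "B = mat2 b1 b2 b3 b4" by (metis mat2_eta)
        have e: "b1 + b2 * v2 = \<tau> * e B" using t by (simp add: e_def b)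
        have v2': "(m - L * p) / (L * (\<tau>\<^sup>2 * q)) = v2 / \<tau>\<^sup>2" by (simp add: v2_def)
        have "(B ** M)$1$1 + (B ** M)$1$2 * v2 = m * (b1 + b2 * v2)"
        proof -
          have "(B ** M)$1$1 + (B ** M)$1$2 * v2 = b1 * (M$1$1 * 1 + M$1$2 * v2) + b2 * (M$2$1 * 1 + M$2$2 * v2)"
            by (simp add: b M_def algebra_simps)
          then show ?thesis unfolding v by (simp add: algebra_simps)
        qed
        moreover have "(M' ** B)$1$1 + (M' ** B)$1$2 * v2 = L * p * (b1 + b2 * v2) + L * (\<tau>\<^sup>2 * q) * (b3 + b4 * v2)"
          by (simp add: b M'_def algebra_simps)
        ultimately have "L * (\<tau>\<^sup>2 * q) * (b3 + b4 * v2) = (m - L * p) * (\<tau> * e B)"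
          using B(2) by (simp add: e algebra_simps)
        also have "m - L * p = L * q * v2" using L0 q by (simp add: v2_def)
        finally have "(L * q * \<tau>) * (\<tau> * (b3 + b4 * v2)) = (L * q * \<tau>) * (v2 * e B)"
          by (simp add: power2_eq_square mult_ac)
        then have e3: "\<tau> * (b3 + b4 * v2) = v2 * e B"
          using mult_left_cancel[of "L * q * \<tau>"] L0 q t by (metis mult_eq_0_iff)
        have "b1 * b4 - b2 * b3 = 1" using det_mem[OF B(1)] by (simp add: b)
        then have "1 = b4 * (b1 + b2 * v2) - b2 * (b3 + b4 * v2)" by (simp add: algebra_simps)
        also have "\<dots> = b4 * (\<tau> * e B) - b2 * (v2 * e B / \<tau>)" using e e3 t by (simp add: eq_divide_eq mult.commute)
        also have "\<dots> = e B * ((b4 - b2 * (v2 / \<tau>\<^sup>2)) / (1 / \<tau>))"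
          using t by (simp add: field_simps power2_eq_square)
        finally show ?thesis by (simp only: b adj2_mat2 mat2_nth v2') simp
      qed
      have "e \<gamma> \<noteq> 0" using inverse_e[OF \<gamma> comm'] by auto
      then have "\<gamma>$1$1 * 1 + \<gamma>$1$2 * v2 \<noteq> 0" unfolding row mult_eq_0_iff using t by blast
      from conjugator_adjust[OF \<gamma> comm' MG m1 v this t]
      have "\<exists>B\<in>G. B ** M = M' ** B \<and> (cmod (e B))\<^sup>2 \<le> cmod m \<and> 1 \<le> cmod m * (cmod (e B))\<^sup>2"
        unfolding e_def mult_1_right .
      then obtain B where B: "B \<in> G" "B ** M = M' ** B" and
        eB: "(cmod (e B))\<^sup>2 \<le> cmod m" "1 \<le> cmod m * (cmod (e B))\<^sup>2"
        by blast
      show "mat2 \<tau> 0 0 (1 / \<tau>) \<in> G"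
      proof (cases "cmod (e B) \<ge> 1")
        case True
        show ?thesis
          by (rule elim(1)[rule_format, OF B(1), of m "e B", folded L_def, folded M_def M'_def],
              intro conjI m B(2) True eB(1)) (simp only: e_def v2_def)
      next
        case False
        define e' where "e' = (adj2 B $1$1 + adj2 B $1$2 * ((m - L * p) / (L * (\<tau>\<^sup>2 * q)))) / (1 / \<tau>)"
        have ee: "e B * e' = 1" using inverse_e[OF B] by (simp add: e'_def)
        have ee': "cmod (e B) * cmod e' = 1" using ee by (metis norm_mult norm_one)
        have "1 \<le> cmod e'"
        proof (rule ccontr)
          assume "\<not> 1 \<le> cmod e'"
          then have "cmod (e B) * cmod e' < 1 * 1" using False by (intro mult_strict_mono') auto
          then show False using ee' by simp
        qed
        moreover have "(cmod e')\<^sup>2 \<le> cmod m"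
        proof -
          have "(cmod e')\<^sup>2 * 1 \<le> (cmod e')\<^sup>2 * (cmod m * (cmod (e B))\<^sup>2)"
            using eB(2) by (intro mult_left_mono) auto
          also have "\<dots> = cmod m * (cmod (e B) * cmod e')\<^sup>2" by (simp add: power2_eq_square)
          finally show ?thesis by (simp add: ee')
        qed
        moreover have "adj2 B ** M' = M ** adj2 B"
        proof -
          have "B ** adj2 B = mat 1" "adj2 B ** B = mat 1" using B det_mem adj2_inverse by auto
          then have "adj2 B ** (M' ** B) ** adj2 B = adj2 B ** M'"
            by (metis matrix_mul_assoc matrix_mul_rid)
          moreover have "adj2 B ** (B ** M) ** adj2 B = M ** adj2 B"
            using \<open>adj2 B ** B = mat 1\<close> by (simp add: matrix_mul_assoc)
          ultimately show ?thesis by (simp add: B(2))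
        qed
        moreover have \<tau>': "(1 / \<tau>)\<^sup>2 * (\<tau>\<^sup>2 * q) = q" "r / \<tau>\<^sup>2 / (1 / \<tau>)\<^sup>2 = r"
          using t by (simp_all add: power_divide)
        ultimately have "mat2 (1 / \<tau>) 0 0 (1 / (1 / \<tau>)) \<in> G"
          by (intro elim(2)[rule_format, OF adj2_mem[OF B(1)], of m e', folded L_def,
                unfolded \<tau>', folded M_def M'_def] conjI m) (simp_all only: e'_def)
        from adj2_mem[OF this] show ?thesis by simp
      qed
    qed
  qed
qed

section \<open>Families of matrices with a common diagonal\<close>

context discrete_SL2
begin

text \<open>
  The Moebius transformation of the diagonal matrix with entries \<open>t\<close> and \<open>1 / t\<close> is multiplication by
  \<open>t\<^sup>2\<close>. Conjugation by this matrix also multiplies upper right entries by \<open>t\<^sup>2\<close>.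
\<close>

definition multipliers :: "complex set" where
  "multipliers = {t\<^sup>2 | t. t \<noteq> 0 \<and> mat2 t 0 0 (1 / t) \<in> G}"

lemma multipliers_one: "1 \<in> multipliers"
  using one_mem by (auto simp: multipliers_def mat_1_mat2 intro!: exI[of _ 1])

lemma multipliers_inverse: "u \<in> multipliers \<Longrightarrow> 1 / u \<in> multipliers"
proof -
  assume "u \<in> multipliers"
  then obtain t where "u = t\<^sup>2" "t \<noteq> 0" "mat2 t 0 0 (1 / t) \<in> G" by (auto simp: multipliers_def)
  then show ?thesis using adj2_mem[of "mat2 t 0 0 (1 / t)"]
    by (auto simp: multipliers_def power_divide intro!: exI[of _ "1 / t"])
qed

text \<open>
  If \<open>t\<^sup>2\<close> is near \<open>z \<noteq> 0\<close>, then \<open>t\<close> and \<open>1 / t\<close> are both bounded.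
\<close>

lemma multipliers_discrete:
  assumes z: "z \<noteq> 0" shows "\<not> z islimpt multipliers"
proof -
  define K where "K = sqrt (2 * cmod z) + 1 / sqrt (cmod z / 2)"
  have "multipliers \<inter> ball z (cmod z / 2) \<subseteq> (\<lambda>A. (A$1$1)\<^sup>2) ` {A \<in> G. norm A \<le> K}"
  proof
    fix u assume u: "u \<in> multipliers \<inter> ball z (cmod z / 2)"
    then obtain t where t: "u = t\<^sup>2" "t \<noteq> 0" "mat2 t 0 0 (1 / t) \<in> G" by (auto simp: multipliers_def)
    have "cmod (z - u) < cmod z / 2" using u by (simp add: dist_norm)
    then have c: "cmod u \<le> 2 * cmod z" "cmod z / 2 \<le> cmod u"
      using norm_triangle_ineq2[of z u] norm_triangle_ineq2[of u z] norm_minus_commute[of z u]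
        norm_ge_zero[of z] by linarith+
    have "cmod u = (cmod t)\<^sup>2" by (simp add: t norm_power)
    then have s: "cmod t = sqrt (cmod u)" by simp
    have t1: "cmod t \<le> sqrt (2 * cmod z)" "sqrt (cmod z / 2) \<le> cmod t"
      unfolding s using c by simp_all
    have "1 / cmod t \<le> 1 / sqrt (cmod z / 2)"
      using t1(2) z by (intro divide_left_mono) (auto simp: t(2))
    then have "norm (mat2 t 0 0 (1 / t)) \<le> K"
      using norm_mat2_le[of t 0 0 "1 / t"] t1(1) by (simp add: K_def norm_divide)
    then show "u \<in> (\<lambda>A. (A$1$1)\<^sup>2) ` {A \<in> G. norm A \<le> K}"
      using t by (intro image_eqI[of _ _ "mat2 t 0 0 (1 / t)"]) auto
  qed
  then have "finite (multipliers \<inter> ball z (cmod z / 2))"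
    using finite_bounded finite_surj by blast
  moreover have "cmod z / 2 > 0" using z by simp
  ultimately show ?thesis unfolding islimpt_eq_infinite_ball by blast
qed

text \<open>
  Two matrices of determinant 1 with the same diagonal and nonzero off-diagonal entries are conjugate
  by a diagonal matrix, whose multiplier is the quotient of their upper right entries. The last
  condition says that no element of \<open>G\<close> is such a matrix. The off-diagonal entries have the product
  \<open>p * s - 1\<close>, which explains the condition \<open>p * s \<noteq> 1\<close>.
\<close>

definition twin_family :: "complex \<Rightarrow> complex \<Rightarrow> (complex^2^2) set \<Rightarrow> bool" where
  "twin_family p s X \<longleftrightarrow> p \<noteq> 0 \<and> p * s \<noteq> 1 \<and> finite X \<and> X \<subseteq> G \<and>
     (\<forall>x\<in>X. x$1$1 = p \<and> x$2$2 = s) \<and>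
     (\<forall>x\<in>X. \<forall>y\<in>X. x \<noteq> y \<longrightarrow> y$1$2 / x$1$2 \<notin> multipliers)"

lemma twin_familyD:
  assumes "twin_family p s X" "x \<in> X"
  shows "x = mat2 p (x$1$2) (x$2$1) s" "p * s - x$1$2 * x$2$1 = 1" "x$1$2 \<noteq> 0" "x$2$1 \<noteq> 0"
proof -
  have x: "x$1$1 = p" "x$2$2 = s" "x \<in> G" "p * s \<noteq> 1" using assms by (auto simp: twin_family_def)
  then show 1: "x = mat2 p (x$1$2) (x$2$1) s" by (metis mat2_eta)
  show "p * s - x$1$2 * x$2$1 = 1" using det_mem[OF x(3)] x by (simp add: det_2)
  then show "x$1$2 \<noteq> 0" "x$2$1 \<noteq> 0" using x(4) by auto
qed

lemma twin_family_shift: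
  assumes X: "twin_family p s X" and d: "d \<noteq> 0" and dG: "mat2 d 0 0 (1 / d) \<in> G"
  shows "twin_family (d * p) (s / d) ((\<lambda>x. mat2 d 0 0 (1 / d) ** x) ` X)"
    and "inj_on (\<lambda>x. mat2 d 0 0 (1 / d) ** x) X"
proof -
  define f where "f x = mat2 d 0 0 (1 / d) ** x" for x :: "complex^2^2"
  have f: "f x = mat2 (d * p) (d * x$1$2) (x$2$1 / d) (s / d)" if "x \<in> X" for x
    unfolding f_def by (subst twin_familyD(1)[OF X that]) simp
  have "twin_family (d * p) (s / d) (f ` X)"
    unfolding twin_family_def
  proof (intro conjI ballI impI)
    show "d * p \<noteq> 0" "d * p * (s / d) \<noteq> 1" "finite (f ` X)"
      using X d by (auto simp: twin_family_def)
    show "f ` X \<subseteq> G" using X mult_mem[OF dG] by (auto simp: twin_family_def f_def)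
    fix x assume "x \<in> f ` X"
    then show "x$1$1 = d * p" "x$2$2 = s / d" by (auto simp: f)
  next
    fix x y assume "x \<in> f ` X" "y \<in> f ` X" "x \<noteq> y"
    then obtain x' y' where "x' \<in> X" "y' \<in> X" "x' \<noteq> y'" "x = f x'" "y = f y'" by auto
    then show "y$1$2 / x$1$2 \<notin> multipliers" using X d by (auto simp: twin_family_def f)
  qed
  then show "twin_family (d * p) (s / d) ((\<lambda>x. mat2 d 0 0 (1 / d) ** x) ` X)"
    by (simp add: f_def[abs_def])
  have "inj_on f X"
  proof (rule inj_onI)
    fix x y assume xy: "x \<in> X" "y \<in> X" "f x = f y"
    then have "x$1$2 = y$1$2" "x$2$1 = y$2$1" using d by (auto simp: f)
    then show "x = y" using twin_familyD(1)[OF X] xy by metis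
  qed
  then show "inj_on (\<lambda>x. mat2 d 0 0 (1 / d) ** x) X" by (simp add: f_def[abs_def])
qed

text \<open>
  These two words are each other's reversals. Reversing a word in \<open>x\<close> and a diagonal matrix has the
  same effect on it as conjugating its transpose by a diagonal matrix, which is why the diagonal does
  not change. The entries follow from \<open>x ** x = \<tau> x - 1\<close>.
\<close>

lemma twin_words:
  fixes p q r s d e \<tau> :: complex
  assumes "p * s - q * r = 1" "\<tau> = p + s"
  defines "x \<equiv> mat2 p q r s" and "D \<equiv> mat2 d 0 0 e"
  shows "x ** x ** D ** x = mat2 (\<tau> * (p * p * d + q * r * e) - d * p) (q * (\<tau> * (p * d + s * e) - d))
      (r * (\<tau> * (p * d + s * e) - e)) (\<tau> * (q * r * d + s * s * e) - e * s)"
    and "x ** D ** x ** x = mat2 (\<tau> * (p * p * d + q * r * e) - d * p) (q * (\<tau> * (p * d + s * e) - e))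
      (r * (\<tau> * (p * d + s * e) - d)) (\<tau> * (q * r * d + s * s * e) - e * s)"
  using assms(1) unfolding x_def D_def assms(2)
  by (simp_all; intro conjI; algebra)+

text \<open>
  Each \<open>x\<close> is replaced by the two words \<open>x x D x\<close> and \<open>x D x x\<close>, where \<open>D\<close> is a high power of the
  diagonal element. All the new matrices have the same diagonal. Their upper right entries are those
  of \<open>X\<close> times \<open>F\<close> or \<open>H\<close>, so the family condition has to be checked only for the quotient
  \<open>H / F\<close> times the finitely many quotients that occur in \<open>X\<close>. As the power grows, \<open>H / F\<close>
  converges to a nonzero limit \<open>A\<close> without being equal to it. The multipliers do not accumulate at a
  nonzero number, so they are avoided from some power on.
\<close>

lemma twin_family_double:
  assumes X: "twin_family p s X" and l: "cmod \<mu> > 1" and lG: "mat2 \<mu> 0 0 (1 / \<mu>) \<in> G"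
    and generic: "\<tau> = p + s" "\<tau> \<noteq> 0" "\<tau> * p \<noteq> 1" "\<tau>\<^sup>2 \<noteq> 1"
  shows "\<exists>p' s' X'. twin_family p' s' X' \<and> card X' = 2 * card X"
proof -
  have p: "p \<noteq> 0" and ps: "p * s \<noteq> 1" and fin: "finite X" and XG: "X \<subseteq> G" using X by (auto simp: twin_family_def)
  define d where "d k = \<mu> ^ k" for k :: nat
  have d0: "d k \<noteq> 0" for k using l by (auto simp: d_def)
  have dG: "mat2 (d k) 0 0 (1 / d k) \<in> G" for k using diag_power_mem(1)[OF lG] by (simp add: d_def)
  define F where "F k = \<tau> * (p * d k + s * (1 / d k)) - d k" for k
  define H where "H k = \<tau> * (p * d k + s * (1 / d k)) - 1 / d k" for k
  define P where "P k = \<tau> * (p * p * d k + (p * s - 1) * (1 / d k)) - d k * p" for k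
  define S where "S k = \<tau> * ((p * s - 1) * d k + s * s * (1 / d k)) - 1 / d k * s" for k
  \<comment> \<open>Up to the factor \<open>d k\<close>, the entries are affine functions of \<open>w k\<close>, which tends to 0.\<close>
  define w where "w k = (1 / d k)\<^sup>2" for k
  have w0: "w k \<noteq> 0" for k using d0 by (simp add: w_def)
  have Fw: "F k = d k * ((\<tau> * p - 1) + \<tau> * s * w k)" and Hw: "H k = d k * (\<tau> * p + (\<tau> * s - 1) * w k)"
    and Pw: "P k = d k * (p * (\<tau> * p - 1) + \<tau> * (p * s - 1) * w k)" for k
    using d0[of k] by (simp_all add: F_def H_def P_def w_def field_simps power2_eq_square)
  have "(\<lambda>k. inverse (\<mu> ^ k)) \<longlonglongrightarrow> 0"
    using filterlim_compose[OF tendsto_inverse_0 filterlim_realpow_sequentially_gt1[OF l]] .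
  from tendsto_power[OF this, of 2] have w: "w \<longlonglongrightarrow> 0"
    by (simp add: w_def[abs_def] d_def divide_inverse)
  define A where "A = \<tau> * p / (\<tau> * p - 1)"
  have A0: "A \<noteq> 0" using generic p by (simp add: A_def)
  have tp1: "\<tau> * p - 1 \<noteq> 0" using generic by simp
  have F': "(\<lambda>k. (\<tau> * p - 1) + \<tau> * s * w k) \<longlonglongrightarrow> (\<tau> * p - 1) + \<tau> * s * 0"
    and H': "(\<lambda>k. \<tau> * p + (\<tau> * s - 1) * w k) \<longlonglongrightarrow> \<tau> * p + (\<tau> * s - 1) * 0"
    and P': "(\<lambda>k. p * (\<tau> * p - 1) + \<tau> * (p * s - 1) * w k) \<longlonglongrightarrow> p * (\<tau> * p - 1) + \<tau> * (p * s - 1) * 0"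
    by (intro tendsto_intros w)+
  have F0: "\<forall>\<^sub>F k in sequentially. F k \<noteq> 0"
    using tendsto_imp_eventually_ne[OF F', of 0] tp1 d0 by (simp add: Fw)
  have H0: "\<forall>\<^sub>F k in sequentially. H k \<noteq> 0"
    using tendsto_imp_eventually_ne[OF H', of 0] generic p d0 by (simp add: Hw)
  have P0: "\<forall>\<^sub>F k in sequentially. P k \<noteq> 0"
    using tendsto_imp_eventually_ne[OF P', of 0] tp1 p d0 by (simp add: Pw)
  have HF: "H k / F k = (\<tau> * p + (\<tau> * s - 1) * w k) / ((\<tau> * p - 1) + \<tau> * s * w k)" for k
    using d0[of k] by (simp add: Fw Hw)
  have lim: "(\<lambda>k. H k / F k) \<longlonglongrightarrow> A"
    unfolding HF using tendsto_divide[OF H' F'] tp1 by (simp add: A_def)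
  \<comment> \<open>The quotient is a Moebius transformation of \<open>w k\<close> with determinant \<open>\<tau>\<^sup>2 - 1\<close> up to sign, so it is
    injective, and it takes the value \<open>A\<close> at 0 only.\<close>
  have ne: "\<forall>\<^sub>F k in sequentially. H k / F k \<noteq> A"
    using F0
  proof eventually_elim
    case (elim k)
    then have "(\<tau> * p - 1) + \<tau> * s * w k \<noteq> 0" by (auto simp: Fw)
    moreover have "(\<tau> * p + (\<tau> * s - 1) * w k) * (\<tau> * p - 1) - \<tau> * p * ((\<tau> * p - 1) + \<tau> * s * w k)
        = w k * (1 - \<tau>\<^sup>2)"
      unfolding generic(1) by (simp add: algebra_simps power2_eq_square)
    ultimately show ?case using tp1 w0[of k] generic unfolding HF A_def
      by (auto simp: frac_eq_eq)
  qed
  have avoid: "\<forall>\<^sub>F k in sequentially. H k / F k * c \<notin> multipliers" if c: "c \<noteq> 0" for c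
  proof -
    have "filterlim (\<lambda>k. H k / F k * c) (at (A * c)) sequentially"
    proof (rule filterlim_atI)
      show "(\<lambda>k. H k / F k * c) \<longlonglongrightarrow> A * c" by (intro tendsto_mult_right lim)
      show "\<forall>\<^sub>F k in sequentially. H k / F k * c \<noteq> A * c"
        using ne by eventually_elim (use c in \<open>metis mult_right_cancel\<close>)
    qed
    moreover have "\<forall>\<^sub>F u in at (A * c). u \<notin> multipliers"
      using multipliers_discrete[of "A * c"] A0 c by (simp add: islimpt_iff_eventually)
    ultimately show ?thesis by (rule eventually_compose_filterlim[rotated])
  qed
  have "\<forall>\<^sub>F k in sequentially. \<forall>xy\<in>X \<times> X. H k / F k * (snd xy $1$2 / fst xy $1$2) \<notin> multipliers"
  proof (rule eventually_ball_finite)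
    show "finite (X \<times> X)" using fin by simp
    show "\<forall>xy\<in>X \<times> X. \<forall>\<^sub>F k in sequentially. H k / F k * (snd xy $1$2 / fst xy $1$2) \<notin> multipliers"
      using twin_familyD(3)[OF X] by (intro ballI avoid) auto
  qed
  with F0 H0 P0 have "\<forall>\<^sub>F k in sequentially. F k \<noteq> 0 \<and> H k \<noteq> 0 \<and> P k \<noteq> 0 \<and>
      (\<forall>xy\<in>X \<times> X. H k / F k * (snd xy $1$2 / fst xy $1$2) \<notin> multipliers)"
    by eventually_elim blast
  then obtain k where k: "F k \<noteq> 0" "H k \<noteq> 0" "P k \<noteq> 0"
    and away: "\<And>x y. x \<in> X \<Longrightarrow> y \<in> X \<Longrightarrow> H k / F k * (y$1$2 / x$1$2) \<notin> multipliers"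
    using eventually_happens'[OF sequentially_bot] by force
  define D where "D = mat2 (d k) 0 0 (1 / d k)"
  have DG: "D \<in> G" using dG by (simp add: D_def)
  define f where "f x = x ** x ** D ** x" for x
  define h where "h x = x ** D ** x ** x" for x
  have fh: "f x = mat2 (P k) (x$1$2 * F k) (x$2$1 * H k) (S k)"
    "h x = mat2 (P k) (x$1$2 * H k) (x$2$1 * F k) (S k)" if x: "x \<in> X" for x
  proof -
    have qr: "x$1$2 * x$2$1 = p * s - 1" using twin_familyD(2)[OF X x] by (simp add: algebra_simps)
    have x': "x = mat2 p (x$1$2) (x$2$1) s" using twin_familyD(1)[OF X x] .
    note tw = twin_words[OF twin_familyD(2)[OF X x] generic(1), of "d k" "1 / d k", unfolded qr, folded x' D_def]
    show "f x = mat2 (P k) (x$1$2 * F k) (x$2$1 * H k) (S k)"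
      unfolding f_def tw(1) by (simp add: P_def F_def H_def S_def)
    show "h x = mat2 (P k) (x$1$2 * H k) (x$2$1 * F k) (S k)"
      unfolding h_def tw(2) by (simp add: P_def F_def H_def S_def)
  qed
  have fG: "f x \<in> G" "h x \<in> G" if "x \<in> X" for x
    using that XG DG by (auto simp: f_def h_def intro!: mult_mem)
  have ratio: "y$1$2 / x$1$2 \<notin> multipliers" if "x \<in> X" "y \<in> X" "x \<noteq> y" for x y
    using X that by (auto simp: twin_family_def)
  have q0: "x$1$2 \<noteq> 0" "x$2$1 \<noteq> 0" if "x \<in> X" for x using twin_familyD[OF X that] by auto
  have inj: "inj_on f X" "inj_on h X"
  proof -
    have "x = y" if "x \<in> X" "y \<in> X" "x$1$2 = y$1$2" for x y
      using ratio[OF that(1,2)] multipliers_one q0[OF that(1)] that(3) by auto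
    then show "inj_on f X" "inj_on h X" using k by (auto intro!: inj_onI simp: fh)
  qed
  have disj: "f ` X \<inter> h ` X = {}"
  proof -
    have "f x \<noteq> h y" if xy: "x \<in> X" "y \<in> X" for x y
    proof
      assume "f x = h y"
      then have "x$1$2 * F k = y$1$2 * H k" using xy by (simp add: fh)
      then have "H k / F k * (y$1$2 / x$1$2) = 1" using k q0[OF xy(1)] q0[OF xy(2)] by (simp add: field_simps)
      then show False using away[OF xy] multipliers_one by simp
    qed
    then show ?thesis by auto
  qed
  have "twin_family (P k) (S k) (f ` X \<union> h ` X)" if ne: "X \<noteq> {}"
    unfolding twin_family_def
  proof (intro conjI ballI impI)
    show "P k \<noteq> 0" "finite (f ` X \<union> h ` X)" "f ` X \<union> h ` X \<subseteq> G" using k fin fG by auto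
    obtain x where x: "x \<in> X" using ne by blast
    have "P k * S k - x$1$2 * F k * (x$2$1 * H k) = 1" using det_mem[OF fG(1)[OF x]] by (simp add: fh x)
    then show "P k * S k \<noteq> 1" using k q0[OF x] by auto
    fix x assume "x \<in> f ` X \<union> h ` X"
    then show "x$1$1 = P k" "x$2$2 = S k" by (auto simp: fh)
  next
    fix x y assume "x \<in> f ` X \<union> h ` X" "y \<in> f ` X \<union> h ` X" "x \<noteq> y"
    then consider x' y' where "x' \<in> X" "y' \<in> X" "x = f x'" "y = f y'" "x' \<noteq> y'"
      | x' y' where "x' \<in> X" "y' \<in> X" "x = h x'" "y = h y'" "x' \<noteq> y'"
      | x' y' where "x' \<in> X" "y' \<in> X" "x = f x'" "y = h y'"
      | x' y' where "x' \<in> X" "y' \<in> X" "x = h x'" "y = f y'" by blast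
    then show "y$1$2 / x$1$2 \<notin> multipliers"
    proof cases
      case 1 then show ?thesis using ratio[of x' y'] k by (simp add: fh)
    next
      case 2 then show ?thesis using ratio[of x' y'] k by (simp add: fh)
    next
      case 3 then show ?thesis using away[of x' y'] by (simp add: fh mult.commute)
    next
      case 4
      then have "1 / (y$1$2 / x$1$2) = H k / F k * (x'$1$2 / y'$1$2)" by (simp add: fh mult.commute)
      then show ?thesis using away[of y' x'] 4 multipliers_inverse by metis
    qed
  qed
  moreover have "card (f ` X \<union> h ` X) = 2 * card X"
    using card_Un_disjoint[OF _ _ disj] fin inj by (simp add: card_image)
  ultimately show ?thesis
  proof (cases "X = {}")
    case True then show ?thesis using X by (intro exI[of _ p] exI[of _ s] exI[of _ X]) simp
  qed blast
qed

lemma twin_family_large: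
  assumes l: "cmod \<mu> > 1" and lG: "mat2 \<mu> 0 0 (1 / \<mu>) \<in> G"
    and x: "mat2 p q r s \<in> G" "p \<noteq> 0" "q \<noteq> 0" "r \<noteq> 0"
  shows "\<exists>p s X. twin_family p s X \<and> card X = 2 ^ n"
proof (induction n)
  case 0
  have "p * s \<noteq> 1" using det_mem[OF x(1)] x by auto
  then have "twin_family p s {mat2 p q r s}" using x by (simp add: twin_family_def)
  then show ?case by fastforce
next
  case (Suc n)
  then obtain p s X where X: "twin_family p s X" "card X = 2 ^ n" by blast
  have p: "p \<noteq> 0" using X by (simp add: twin_family_def)
  have "filterlim (\<lambda>N. cmod \<mu> ^ N) at_top sequentially"
    using l by (rule filterlim_realpow_at_top)
  then have "\<forall>\<^sub>F N in sequentially. cmod \<mu> ^ N \<ge> (2 + cmod s) / cmod p"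
    by (simp add: filterlim_at_top)
  \<comment> \<open>Multiplying the family by a high power of the diagonal element makes its trace large, so that
    the genericity conditions of the doubling step hold.\<close>
  then obtain N where N: "cmod \<mu> ^ N \<ge> (2 + cmod s) / cmod p"
    using eventually_happens'[OF sequentially_bot] by blast
  define d where "d = \<mu> ^ N"
  have d: "d \<noteq> 0" "mat2 d 0 0 (1 / d) \<in> G" using l diag_power_mem(1)[OF lG] by (auto simp: d_def)
  have d1: "cmod d \<ge> 1" using l by (simp add: d_def norm_power one_le_power)
  have dp: "cmod (d * p) \<ge> 2 + cmod s" using N p by (simp add: d_def norm_mult norm_power field_simps)
  define \<tau> where "\<tau> = d * p + s / d"
  have "cmod (s / d) \<le> cmod s" using d1 by (rule norm_divide_le)
  then have t2: "cmod \<tau> \<ge> 2"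
    using dp norm_triangle_ineq2[of "d * p" "- (s / d)"] by (simp add: \<tau>_def)
  have "\<tau> \<noteq> 0" "\<tau>\<^sup>2 \<noteq> 1" using t2 by (auto simp: power2_eq_1_iff)
  moreover have "cmod (\<tau> * (d * p)) \<ge> 2 * 2"
    unfolding norm_mult[of \<tau>] using t2 dp norm_ge_zero[of s] by (intro mult_mono) linarith+
  then have "\<tau> * (d * p) \<noteq> 1" by auto
  ultimately show ?case
    using twin_family_double[OF twin_family_shift(1)[OF X(1) d] l lG \<tau>_def]
      card_image[OF twin_family_shift(2)[OF X(1) d]] X(2) by simp
qed

text \<open>
  Multiply a large twin family by a high power of the diagonal element: the traces agree because they
  depend only on the diagonals, and a conjugator would put the diagonal matrix relating two members
  of the family into \<open>G\<close>.
\<close>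

lemma many_nonconjugate_same_trace:
  assumes l: "cmod \<mu> > 1" and lG: "mat2 \<mu> 0 0 (1 / \<mu>) \<in> G"
    and x: "mat2 p q r s \<in> G" "p \<noteq> 0" "q \<noteq> 0" "r \<noteq> 0"
  shows "\<exists>Y T. finite Y \<and> card Y = 2 ^ n \<and> Y \<subseteq> G \<and> cmod T > 2 \<and> (\<forall>y\<in>Y. trace y = T) \<and>
    (\<forall>y\<in>Y. \<forall>z\<in>Y. \<forall>\<gamma>\<in>G. \<gamma> ** y = z ** \<gamma> \<longrightarrow> y = z)"
proof -
  obtain p s X where X: "twin_family p s X" "card X = 2 ^ n" using twin_family_large[OF assms] by blast
  have p: "p \<noteq> 0" and fin: "finite X" and XG: "X \<subseteq> G" using X by (auto simp: twin_family_def)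
  define D where "D N = mat2 (\<mu> ^ N) 0 0 (1 / \<mu> ^ N)" for N
  have DG: "D N \<in> G" for N using diag_power_mem(1)[OF lG] by (simp add: D_def)
  have pair: "\<forall>\<^sub>F N in sequentially. \<forall>\<gamma>\<in>G. \<gamma> ** (D N ** x) = (D N ** y) ** \<gamma> \<longrightarrow> x = y"
    if xy: "x \<in> X" "y \<in> X" for x y
  proof (cases "x = y")
    case False
    note x = twin_familyD[OF X(1) xy(1)] and y = twin_familyD[OF X(1) xy(2)]
    define t where "t = csqrt (y$1$2 / x$1$2)"
    have t2: "t\<^sup>2 = y$1$2 / x$1$2" by (simp add: t_def)
    have t: "t \<noteq> 0" using x y by (auto simp: t_def)
    have "x$1$2 * x$2$1 = y$1$2 * y$2$1" using x(2) y(2) by (simp add: algebra_simps)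
    then have y': "y = mat2 p (t\<^sup>2 * x$1$2) (x$2$1 / t\<^sup>2) s"
      using x y by (subst y(1)) (simp add: t2 field_simps)
    have notG: "mat2 t 0 0 (1 / t) \<notin> G"
    proof
      assume "mat2 t 0 0 (1 / t) \<in> G"
      then have "y$1$2 / x$1$2 \<in> multipliers" unfolding multipliers_def mem_Collect_eq
        by (intro exI[of _ t] conjI) (use t t2 in simp_all)
      then show False using X(1) xy False by (auto simp: twin_family_def)
    qed
    have G: "mat2 p (x$1$2) (x$2$1) s \<in> G" "mat2 p (t\<^sup>2 * x$1$2) (x$2$1 / t\<^sup>2) s \<in> G"
      using XG xy x(1) y' by auto
    show ?thesis using conjugate_imp_diag[OF l lG p x(3,4) G(1) t G(2), folded x(1) y' D_def]
      by eventually_elim (use notG in blast)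
  qed simp
  have "\<forall>\<^sub>F N in sequentially. \<forall>xy\<in>X \<times> X. \<forall>\<gamma>\<in>G.
      \<gamma> ** (D N ** fst xy) = (D N ** snd xy) ** \<gamma> \<longrightarrow> fst xy = snd xy"
    using fin pair by (intro eventually_ball_finite) auto
  moreover have "\<forall>\<^sub>F N in sequentially. cmod \<mu> ^ N \<ge> (3 + cmod s) / cmod p"
    using filterlim_realpow_at_top[OF l] by (simp add: filterlim_at_top)
  ultimately have "\<forall>\<^sub>F N in sequentially. (\<forall>xy\<in>X \<times> X. \<forall>\<gamma>\<in>G.
      \<gamma> ** (D N ** fst xy) = (D N ** snd xy) ** \<gamma> \<longrightarrow> fst xy = snd xy) \<and>
      cmod \<mu> ^ N \<ge> (3 + cmod s) / cmod p"
    by eventually_elim blast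
  then obtain N where N: "\<And>x y \<gamma>. x \<in> X \<Longrightarrow> y \<in> X \<Longrightarrow> \<gamma> \<in> G \<Longrightarrow>
      \<gamma> ** (D N ** x) = (D N ** y) ** \<gamma> \<Longrightarrow> x = y" "cmod \<mu> ^ N \<ge> (3 + cmod s) / cmod p"
    using eventually_happens'[OF sequentially_bot] by force
  define d where "d = \<mu> ^ N"
  have d: "d \<noteq> 0" "mat2 d 0 0 (1 / d) \<in> G" "D N = mat2 d 0 0 (1 / d)" using DG l by (auto simp: d_def D_def)
  note shift = twin_family_shift[OF X(1) d(1,2), folded d(3)]
  have d1: "cmod d \<ge> 1" using l by (simp add: d_def norm_power one_le_power)
  have dp: "cmod (d * p) \<ge> 3 + cmod s" using N(2) p by (simp add: d_def norm_mult norm_power field_simps)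
  have "cmod (s / d) \<le> cmod s" using d1 by (rule norm_divide_le)
  then have T: "cmod (d * p + s / d) > 2"
    using dp norm_triangle_ineq2[of "d * p" "- (s / d)"] by simp
  have tr: "trace (D N ** x) = d * p + s / d" if "x \<in> X" for x
    using shift(1) that by (auto simp: twin_family_def trace_def sum_2)
  show ?thesis
  proof (intro exI conjI ballI impI)
    show "finite ((\<lambda>x. D N ** x) ` X)" using fin by simp
    show "card ((\<lambda>x. D N ** x) ` X) = 2 ^ n" using card_image[OF shift(2)] X(2) by simp
    show "(\<lambda>x. D N ** x) ` X \<subseteq> G" using XG DG mult_mem by blast
    show "cmod (d * p + s / d) > 2" by (rule T)
    show "trace y = d * p + s / d" if "y \<in> (\<lambda>x. D N ** x) ` X" for y using that tr by auto
    show "y = z" if "y \<in> (\<lambda>x. D N ** x) ` X" "z \<in> (\<lambda>x. D N ** x) ` X" "\<gamma> \<in> G" "\<gamma> ** y = z ** \<gamma>" for y z \<gamma>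
      using that N(1) by auto
  qed
qed

end

section \<open>The action on hyperbolic space\<close>

definition adjoint2 :: "complex^2^2 \<Rightarrow> complex^2^2" where
  "adjoint2 A = mat2 (cnj (A$1$1)) (cnj (A$2$1)) (cnj (A$1$2)) (cnj (A$2$2))"

lemma adjoint2_mat2 [simp]: "adjoint2 (mat2 a b c d) = mat2 (cnj a) (cnj c) (cnj b) (cnj d)"
  by (simp add: adjoint2_def)

lemma adjoint2_mult: "adjoint2 (A ** B) = adjoint2 B ** adjoint2 A"
proof -
  obtain a b c d where A: "A = mat2 a b c d" by (metis mat2_eta)
  obtain a' b' c' d' where B: "B = mat2 a' b' c' d'" by (metis mat2_eta)
  show ?thesis by (simp add: A B mult.commute)
qed

lemma det_adjoint2 [simp]: "det (adjoint2 A) = cnj (det A)"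
  by (simp add: adjoint2_def det_2 mult.commute)

text \<open>
  The usual identification of the upper half-space with the positive definite Hermitian matrices of
  determinant 1. It turns the action of \<open>A\<close> into the linear map taking \<open>H\<close> to \<open>A H A\<^sup>*\<close>.
\<close>

definition hermitian_of :: "complex \<times> real \<Rightarrow> complex^2^2" where
  "hermitian_of = (\<lambda>(z, t). mat2 (((cmod z)\<^sup>2 + t\<^sup>2) / t) (z / t) (cnj z / t) (1 / t))"

lemma det_hermitian_of: "snd p > 0 \<Longrightarrow> det (hermitian_of p) = 1"
proof -
  assume "snd p > 0"
  then obtain z t where p: "p = (z, t)" "t > 0" by (cases p) auto
  show ?thesis unfolding p hermitian_of_def split_conv of_real_add of_real_divide complex_norm_square
    using p(2) by (simp add: field_simps power2_eq_square)
qed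

lemma hermitian_of_inj:
  assumes "snd p > 0" "snd q > 0" "hermitian_of p = hermitian_of q" shows "p = q"
proof -
  obtain z t w u where pq: "p = (z, t)" "q = (w, u)" by (metis surj_pair)
  have "complex_of_real (1 / t) = of_real (1 / u)" using assms by (simp add: pq hermitian_of_def)
  then have "t = u" by (subst (asm) of_real_eq_iff) (use assms pq in auto)
  then show ?thesis using assms by (auto simp: pq hermitian_of_def)
qed

lemma SL2C_act_height_denominator_pos:
  fixes A :: "complex^2^2"
  assumes "det A = 1" "t > 0"
  shows "(cmod (A$2$1 * z + A$2$2))\<^sup>2 + (cmod (A$2$1))\<^sup>2 * t\<^sup>2 > 0"
proof (cases "A$2$1 = 0")
  case True
  then have "A$2$2 \<noteq> 0" using assms(1) by (auto simp: det_2)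
  with True show ?thesis by simp
next
  case False
  then show ?thesis using assms(2) by (simp add: add_nonneg_pos)
qed

lemma SL2C_act_pos:
  assumes "det A = 1" "snd p > 0" shows "snd (SL2C_act A p) > 0"
  using SL2C_act_height_denominator_pos[OF assms(1), of "snd p" "fst p"] assms(2)
  by (cases p) (simp add: SL2C_act_def Let_def)

text \<open>
  The second row and column are compared by computation. The upper left entry is then determined by
  the determinant, which is 1 on both sides.
\<close>

lemma hermitian_of_act:
  assumes A: "det A = 1" and p: "snd p > 0"
  shows "hermitian_of (SL2C_act A p) = A ** hermitian_of p ** adjoint2 A"
proof -
  obtain a b c d where abcd: "A = mat2 a b c d" by (metis mat2_eta)
  obtain z t where zt: "p = (z, t)" "t > 0" using p by (cases p) auto
  define N where "N = (cmod (c * z + d))\<^sup>2 + (cmod c)\<^sup>2 * t\<^sup>2"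
  define n where "n = (a * z + b) * cnj (c * z + d) + a * cnj c * of_real (t\<^sup>2)"
  have N: "N > 0" using SL2C_act_height_denominator_pos[OF A zt(2), of z] by (simp add: N_def abcd)
  have act: "SL2C_act A p = (n / of_real N, t / N)"
    by (simp add: SL2C_act_def Let_def abcd zt N_def n_def)
  define X where "X = complex_of_real (((cmod (n / of_real N))\<^sup>2 + (t / N)\<^sup>2) / (t / N))"
  have L: "hermitian_of (SL2C_act A p) = mat2 X (n / t) (cnj n / t) (N / t)"
    using N by (simp add: act hermitian_of_def X_def)
  define R where "R = A ** hermitian_of p ** adjoint2 A"
  have t0: "complex_of_real t \<noteq> 0" using zt by simp
  have zz: "complex_of_real ((cmod w)\<^sup>2) = w * cnj w" for w by (rule complex_norm_square)
  have H: "hermitian_of p = mat2 ((z * cnj z + of_real t * of_real t) / of_real t) (z / t) (cnj z / t) (1 / t)"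
    unfolding hermitian_of_def zt split_conv of_real_add of_real_divide zz by (simp add: power2_eq_square)
  have R12: "R$1$2 = n / t" and R21: "R$2$1 = cnj n / t"
    unfolding R_def abcd H n_def using t0 by (simp_all add: field_simps power2_eq_square)
  have R22: "R$2$2 = N / t"
    unfolding R_def abcd H N_def of_real_add of_real_mult zz of_real_divide
    using t0 by (simp add: field_simps power2_eq_square)
  have "det R = 1" using A p by (simp add: R_def det_mul det_hermitian_of)
  moreover have "det (hermitian_of (SL2C_act A p)) = 1"
    using SL2C_act_pos[OF A p] by (rule det_hermitian_of)
  ultimately have "R$1$1 * (N / t) - n / t * (cnj n / t) = 1" "X * (N / t) - n / t * (cnj n / t) = 1"
    by (simp_all only: L det_2 R12 R21 R22 mat2_nth)
  then have "R$1$1 * (N / t) = X * (N / t)" by (metis diff_eq_eq)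
  then have "R$1$1 = X" using N t0 by simp
  then show ?thesis unfolding L R_def[symmetric] using R12 R21 R22 by (subst mat2_eta[of R]) simp
qed

lemma SL2C_act_mult:
  assumes "det A = 1" "det B = 1" "snd p > 0"
  shows "SL2C_act (A ** B) p = SL2C_act A (SL2C_act B p)"
proof (rule hermitian_of_inj)
  show "snd (SL2C_act (A ** B) p) > 0" "snd (SL2C_act A (SL2C_act B p)) > 0"
    using assms by (simp_all add: SL2C_act_pos det_mul)
  show "hermitian_of (SL2C_act (A ** B) p) = hermitian_of (SL2C_act A (SL2C_act B p))"
    using assms by (simp add: hermitian_of_act SL2C_act_pos det_mul adjoint2_mult matrix_mul_assoc)
qed

lemma SL2C_act_one: "SL2C_act (mat 1) p = p"
  by (cases p) (simp add: SL2C_act_def Let_def mat_1_mat2)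

lemma SL2C_act_adj2:
  assumes "det A = 1" "snd p > 0"
  shows "SL2C_act A (SL2C_act (adj2 A) p) = p" "SL2C_act (adj2 A) (SL2C_act A p) = p"
  using assms by (simp_all add: adj2_inverse SL2C_act_one flip: SL2C_act_mult)

text \<open>
  The trace is twice the hyperbolic cosine of the hyperbolic distance of \<open>p\<close> and \<open>q\<close>.
\<close>

lemma trace_hermitian_of:
  assumes "snd p > 0" "snd q > 0"
  shows "trace (hermitian_of p ** adj2 (hermitian_of q)) = of_real ((dist p q)\<^sup>2 / (snd p * snd q) + 2)"
proof -
  obtain z t w u where pq: "p = (z, t)" "q = (w, u)" by (metis surj_pair)
  have tu: "t > 0" "u > 0" using assms by (auto simp: pq)
  have d: "(dist p q)\<^sup>2 = (cmod (z - w))\<^sup>2 + (t - u)\<^sup>2"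
    by (simp add: pq dist_Pair_Pair dist_complex_def dist_real_def)
  have "complex_of_real ((dist p q)\<^sup>2 / (t * u) + 2) =
      ((z - w) * cnj (z - w) + (of_real t - of_real u)\<^sup>2) / (of_real t * of_real u) + 2"
    unfolding d of_real_add of_real_divide complex_norm_square by simp
  also have "\<dots> = trace (hermitian_of p ** adj2 (hermitian_of q))"
    using tu unfolding pq hermitian_of_def of_real_add of_real_divide complex_norm_square
    by (simp add: field_simps power2_eq_square complex_norm_square)
  finally show ?thesis by (simp add: pq)
qed

text \<open>
  The Euclidean form of the invariance of the hyperbolic distance.
\<close>

lemma dist_SL2C_act:
  assumes A: "det A = 1" and p: "snd p > 0" and q: "snd q > 0"
  shows "(dist (SL2C_act A p) (SL2C_act A q))\<^sup>2 =
    (dist p q)\<^sup>2 * (snd (SL2C_act A p) * snd (SL2C_act A q) / (snd p * snd q))"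
proof -
  have p': "snd (SL2C_act A p) > 0" "snd (SL2C_act A q) > 0" using assms by (simp_all add: SL2C_act_pos)
  have "trace (hermitian_of (SL2C_act A p) ** adj2 (hermitian_of (SL2C_act A q))) =
      trace (A ** (hermitian_of p ** (adjoint2 A ** adj2 (adjoint2 A)) ** adj2 (hermitian_of q)) ** adj2 A)"
    using assms by (simp add: hermitian_of_act adj2_mult matrix_mul_assoc)
  also have "adjoint2 A ** adj2 (adjoint2 A) = mat 1" using A by (intro adj2_inverse) simp
  also have "trace (A ** (hermitian_of p ** mat 1 ** adj2 (hermitian_of q)) ** adj2 A) =
      trace (adj2 A ** (A ** (hermitian_of p ** mat 1 ** adj2 (hermitian_of q))))"
    by (rule trace_mul_sym)
  also have "\<dots> = trace (hermitian_of p ** adj2 (hermitian_of q))"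
    using A by (simp add: matrix_mul_assoc adj2_inverse)
  finally have "complex_of_real ((dist (SL2C_act A p) (SL2C_act A q))\<^sup>2 / (snd (SL2C_act A p) * snd (SL2C_act A q)) + 2) =
      complex_of_real ((dist p q)\<^sup>2 / (snd p * snd q) + 2)"
    using trace_hermitian_of[OF p q] trace_hermitian_of[OF p'] by metis
  then have "(dist (SL2C_act A p) (SL2C_act A q))\<^sup>2 / (snd (SL2C_act A p) * snd (SL2C_act A q)) =
      (dist p q)\<^sup>2 / (snd p * snd q)"
    by (subst (asm) of_real_eq_iff) simp
  then show ?thesis using p' p q by (simp add: divide_eq_eq)
qed

lemma differentiable_SL2C_act:
  assumes A: "det A = 1" and p: "snd p > 0"
  shows "SL2C_act A differentiable (at p)"
proof -
  define N where "N q = (cmod (A$2$1 * fst q + A$2$2))\<^sup>2 + (cmod (A$2$1))\<^sup>2 * (snd q)\<^sup>2" for q :: "complex \<times> real"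
  define n where "n q = (A$1$1 * fst q + A$1$2) * cnj (A$2$1 * fst q + A$2$2) + A$1$1 * cnj (A$2$1) * of_real (snd q) * of_real (snd q)" for q :: "complex \<times> real"
  have Re: "Re (w * cnj w) = (cmod w)\<^sup>2" for w by (simp add: cmod_power2) (simp add: power2_eq_square)
  have act: "SL2C_act A = (\<lambda>q. (n q / of_real (N q), snd q / N q))"
    by (rule ext) (simp add: SL2C_act_def Let_def N_def n_def case_prod_unfold power2_eq_square mult.assoc)
  have Np: "N p \<noteq> 0" using SL2C_act_height_denominator_pos[OF A p, of "fst p"]
    by (simp add: N_def)
  have bl: "(\<lambda>q. F (g q)) differentiable (at p)"
    if "bounded_linear F" "g differentiable (at p)" for F :: "'a::real_normed_vector \<Rightarrow> 'b::real_normed_vector" and g :: "complex \<times> real \<Rightarrow> 'a"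
    using that unfolding differentiable_def by (blast intro: bounded_linear.has_derivative)
  have fst: "fst differentiable (at p)" and snd: "snd differentiable (at p)"
    using bl[OF bounded_linear_fst, of "\<lambda>x. x"] bl[OF bounded_linear_snd, of "\<lambda>x. x"] by (auto simp: )
  have c: "(\<lambda>q. complex_of_real (snd q)) differentiable (at p)"
    by (rule bl[OF bounded_linear_of_real snd])
  have l: "(\<lambda>q. a * fst q + b) differentiable (at p)" for a b :: complex
    by (intro differentiable_add differentiable_mult differentiable_const fst)
  have l': "(\<lambda>q. cnj (a * fst q + b)) differentiable (at p)" for a b :: complex
    by (rule bl[OF bounded_linear_cnj l])
  have "n differentiable (at p)" unfolding n_def[abs_def]
    by (intro differentiable_add differentiable_mult differentiable_const l l' c)
  moreover have Nd: "N differentiable (at p)" unfolding N_def[abs_def] Re[symmetric]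
    by (intro differentiable_add differentiable_mult differentiable_const differentiable_power snd
        bl[OF bounded_linear_Re] l l')
  moreover have "(\<lambda>q. complex_of_real (N q)) differentiable (at p)"
    by (rule bl[OF bounded_linear_of_real Nd])
  ultimately show ?thesis unfolding act using Np
    by (intro differentiable_Pair differentiable_divide snd) auto
qed

lemma continuous_on_SL2C_act: "det A = 1 \<Longrightarrow> continuous_on H3 (SL2C_act A)"
  by (auto simp: H3_def continuous_on_eq_continuous_at open_Collect_less continuous_on_snd
      intro!: continuous_at_imp_continuous_on differentiable_imp_continuous_within differentiable_SL2C_act)

text \<open>
  Letting \<open>q\<close> tend to \<open>p\<close> in \<open>dist_SL2C_act\<close> gives the norm of the derivative, without any formula
  for the derivative itself.
\<close>

lemma derivative_SL2C_act_conformal: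
  assumes A: "det A = 1" and p: "snd p > 0" and D: "(SL2C_act A has_derivative D) (at p)"
  shows "norm (D h) = snd (SL2C_act A p) / snd p * norm h"
proof (cases "h = 0")
  case True
  then show ?thesis using has_derivative_bounded_linear[OF D] by (simp add: linear_simps)
next
  case False
  define f where "f = SL2C_act A"
  define k where "k = snd (f p) / snd p"
  have k: "k > 0" using SL2C_act_pos[OF A p] p by (simp add: k_def f_def)
  have lin: "bounded_linear D" using D by (rule has_derivative_bounded_linear)
  have "filterlim (\<lambda>s. s *\<^sub>R h) (at 0) (at (0::real))"
    by (rule filterlim_atI) (use False in \<open>auto intro!: tendsto_eq_intros simp: eventually_at_filter\<close>)
  then have e: "((\<lambda>s. norm (f (p + s *\<^sub>R h) - f p - D (s *\<^sub>R h)) / norm (s *\<^sub>R h)) \<longlongrightarrow> 0) (at (0::real))"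
  proof -
    have "((\<lambda>h. norm (f (p + h) - f p - D h) / norm h) \<longlongrightarrow> 0) (at 0)"
      using D by (simp add: has_derivative_at f_def)
    from filterlim_compose[OF this \<open>filterlim (\<lambda>s. s *\<^sub>R h) (at 0) (at (0::real))\<close>] show ?thesis .
  qed
  have "((\<lambda>s. norm (f (p + s *\<^sub>R h) - f p) / \<bar>s\<bar> - norm (D h)) \<longlongrightarrow> 0) (at (0::real))"
  proof (rule Lim_null_comparison)
    show "((\<lambda>s. norm (f (p + s *\<^sub>R h) - f p - D (s *\<^sub>R h)) / norm (s *\<^sub>R h) * norm h) \<longlongrightarrow> 0) (at (0::real))"
      using tendsto_mult_right[OF e, of "norm h"] by simp
    have "\<bar>norm (f (p + s *\<^sub>R h) - f p) / \<bar>s\<bar> - norm (D h)\<bar> \<le>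
        norm (f (p + s *\<^sub>R h) - f p - D (s *\<^sub>R h)) / norm (s *\<^sub>R h) * norm h" if "s \<noteq> 0" for s
    proof -
      have "\<bar>norm (f (p + s *\<^sub>R h) - f p) - norm (D (s *\<^sub>R h))\<bar> \<le> norm (f (p + s *\<^sub>R h) - f p - D (s *\<^sub>R h))"
        by (rule norm_triangle_ineq3)
      then have "\<bar>norm (f (p + s *\<^sub>R h) - f p) - norm (D (s *\<^sub>R h))\<bar> / \<bar>s\<bar> \<le> norm (f (p + s *\<^sub>R h) - f p - D (s *\<^sub>R h)) / \<bar>s\<bar>"
        by (intro divide_right_mono) auto
      moreover have "norm (D (s *\<^sub>R h)) = \<bar>s\<bar> * norm (D h)" using lin by (simp add: linear_simps)
      moreover have "norm (f (p + s *\<^sub>R h) - f p) / \<bar>s\<bar> - norm (D h) = (norm (f (p + s *\<^sub>R h) - f p) - \<bar>s\<bar> * norm (D h)) / \<bar>s\<bar>"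
        using that by (simp add: diff_divide_distrib)
      ultimately show ?thesis using that False by (simp add: abs_divide)
    qed
    then show "\<forall>\<^sub>F s in at (0::real). norm (norm (f (p + s *\<^sub>R h) - f p) / \<bar>s\<bar> - norm (D h)) \<le>
        norm (f (p + s *\<^sub>R h) - f p - D (s *\<^sub>R h)) / norm (s *\<^sub>R h) * norm h"
      by (simp add: eventually_at_filter)
  qed
  then have 1: "((\<lambda>s. norm (f (p + s *\<^sub>R h) - f p) / \<bar>s\<bar>) \<longlongrightarrow> norm (D h)) (at (0::real))"
    by (simp add: LIM_zero_iff)
  define \<kappa> where "\<kappa> s = snd (f (p + s *\<^sub>R h)) * snd (f p) / (snd (p + s *\<^sub>R h) * snd p)" for s
  have path: "((\<lambda>s. p + s *\<^sub>R h) \<longlongrightarrow> p) (at (0::real))"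
    by (auto intro!: tendsto_eq_intros)
  have "isCont f p" using D unfolding f_def by (rule has_derivative_continuous)
  then have fpath: "((\<lambda>s. f (p + s *\<^sub>R h)) \<longlongrightarrow> f p) (at (0::real))"
    by (rule isCont_tendsto_compose[OF _ path])
  have "(\<kappa> \<longlongrightarrow> snd (f p) * snd (f p) / (snd p * snd p)) (at 0)"
    unfolding \<kappa>_def[abs_def] using p by (intro tendsto_intros path fpath) auto
  moreover have "snd (f p) * snd (f p) / (snd p * snd p) = k * k" by (simp add: k_def)
  ultimately have "(\<kappa> \<longlongrightarrow> k * k) (at 0)" by simp
  from tendsto_mult[OF tendsto_real_sqrt[OF this] tendsto_const[of "norm h"]]
  have 2: "((\<lambda>s. sqrt (\<kappa> s) * norm h) \<longlongrightarrow> k * norm h) (at 0)"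
    using k by simp
  have "\<forall>\<^sub>F s in at (0::real). snd (p + s *\<^sub>R h) > 0"
    using order_tendstoD(1)[OF tendsto_snd[OF path] p] by simp
  then have "\<forall>\<^sub>F s in at (0::real). sqrt (\<kappa> s) * norm h = norm (f (p + s *\<^sub>R h) - f p) / \<bar>s\<bar>"
    using eventually_neq_at_within[of 0 0 UNIV]
  proof eventually_elim
    case (elim s)
    have "(dist (f (p + s *\<^sub>R h)) (f p))\<^sup>2 = (dist (p + s *\<^sub>R h) p)\<^sup>2 * \<kappa> s"
      unfolding f_def \<kappa>_def using dist_SL2C_act[OF A elim(1) p] .
    then have "(norm (f (p + s *\<^sub>R h) - f p))\<^sup>2 = (\<bar>s\<bar> * norm h)\<^sup>2 * \<kappa> s"
      by (simp add: dist_norm)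
    then have "sqrt ((norm (f (p + s *\<^sub>R h) - f p))\<^sup>2) = sqrt ((\<bar>s\<bar> * norm h)\<^sup>2) * sqrt (\<kappa> s)"
      by (simp only: real_sqrt_mult)
    then have "norm (f (p + s *\<^sub>R h) - f p) = \<bar>s\<bar> * norm h * sqrt (\<kappa> s)"
      unfolding real_sqrt_abs by (simp add: abs_mult)
    then show ?case using elim by simp
  qed
  with 1 2 have "norm (D h) = k * norm h"
    by (intro tendsto_unique[OF trivial_limit_at 1]) (auto elim: Lim_transform_eventually)
  then show ?thesis by (simp add: k_def f_def)
qed

section \<open>Invariance of the hyperbolic volume\<close>

text \<open>
  Coordinates for upper half-space, since the change-of-variables theorem is about the types
  \<open>real^'n\<close>.
\<close>

definition of_real3 :: "real^3 \<Rightarrow> complex \<times> real" where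
  "of_real3 v = (Complex (v$1) (v$2), v$3)"

definition to_real3 :: "complex \<times> real \<Rightarrow> real^3" where
  "to_real3 p = vector [Re (fst p), Im (fst p), snd p]"

lemma to_real3_nth [simp]:
  "to_real3 p $ 1 = Re (fst p)" "to_real3 p $ 2 = Im (fst p)" "to_real3 p $ 3 = snd p"
  by (simp_all add: to_real3_def)

lemma to_of_real3 [simp]: "to_real3 (of_real3 v) = v" "of_real3 (to_real3 p) = p"
  by (simp_all add: vec_eq_iff forall_3 of_real3_def complex_eq_iff prod_eq_iff)

lemma linear_of_real3: "linear of_real3" "linear to_real3"
  by (auto intro!: linearI simp: of_real3_def vec_eq_iff forall_3 complex_eq_iff)

lemma norm_of_real3 [simp]: "norm (of_real3 v) = norm v" "norm (to_real3 p) = norm p"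
proof -
  show *: "norm (of_real3 v) = norm v" for v
    by (simp add: of_real3_def norm_Pair cmod_def norm_vec_def L2_set_def sum_3)
  show "norm (to_real3 p) = norm p" using *[of "to_real3 p"] by simp
qed

lemma bounded_linear_of_real3: "bounded_linear of_real3" "bounded_linear to_real3"
  using linear_of_real3 by (simp_all add: linear_conv_bounded_linear)

lemma measurable_of_real3 [measurable]: "of_real3 \<in> borel_measurable borel"
  by (intro borel_measurable_continuous_onI linear_continuous_on bounded_linear_of_real3)

lemma lborel_of_real3: "distr lborel borel of_real3 = lborel"
proof (rule lborel_eqI[symmetric])
  fix l u :: "complex \<times> real" assume le: "\<And>b. b \<in> Basis \<Longrightarrow> l \<bullet> b \<le> u \<bullet> b"
  have BC: "(Basis :: (complex \<times> real) set) = {(1, 0), (\<i>, 0), (0, 1)}"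
    by (auto simp: Basis_prod_def Basis_complex_def)
  have B3: "(Basis :: (real^3) set) = {axis 1 1, axis 2 1, axis 3 1}"
    by (auto simp: Basis_vec_def UNIV_3)
  have dist3: "axis 1 (1::real) \<noteq> (axis 2 1 :: real^3)" "axis 1 (1::real) \<noteq> (axis 3 1 :: real^3)"
    "axis 2 (1::real) \<noteq> (axis 3 1 :: real^3)" by (simp_all add: axis_eq_axis)
  have inner: "p \<bullet> (1, 0) = Re (fst p)" "p \<bullet> (\<i>, 0) = Im (fst p)" "p \<bullet> (0, 1) = snd p" for p :: "complex \<times> real"
    by (simp_all add: inner_prod_def inner_complex_def)
  have l: "Re (fst l) \<le> Re (fst u)" "Im (fst l) \<le> Im (fst u)" "snd l \<le> snd u"
    using le[of "(1, 0)"] le[of "(\<i>, 0)"] le[of "(0, 1)"] by (simp_all add: BC inner)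
  have "of_real3 -` box l u = box (to_real3 l) (to_real3 u)"
    by (simp add: set_eq_iff mem_box BC B3 inner inner_axis of_real3_def)
  then have "emeasure (distr lborel borel of_real3) (box l u) = emeasure lborel (box (to_real3 l) (to_real3 u))"
    by (simp add: emeasure_distr)
  also have "\<dots> = ennreal (\<Prod>b\<in>Basis. (to_real3 u - to_real3 l) \<bullet> b)"
    by (rule emeasure_lborel_box) (use l in \<open>auto simp: B3 inner_axis\<close>)
  also have "(\<Prod>b\<in>Basis. (to_real3 u - to_real3 l) \<bullet> b) =
      (Re (fst u) - Re (fst l)) * ((Im (fst u) - Im (fst l)) * (snd u - snd l))"
    using dist3 by (simp add: B3 inner_axis)
  also have "\<dots> = (\<Prod>b\<in>Basis. (u - l) \<bullet> b)"
    by (simp add: BC inner)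
  finally show "emeasure (distr lborel borel of_real3) (box l u) = ennreal (\<Prod>b\<in>Basis. (u - l) \<bullet> b)" .
qed simp

lemma H3_measurable [measurable]: "H3 \<in> sets borel"
  by (simp add: H3_def borel_open open_Collect_less continuous_on_snd)

lemma snd_measurable [measurable]: "snd \<in> borel_measurable (borel :: (complex \<times> real) measure)"
  by (intro borel_measurable_continuous_onI continuous_on_snd continuous_on_id)

lemma sets_H3_volume [simp, measurable_cong]: "sets H3_volume = sets borel" "space H3_volume = UNIV"
  by (simp_all add: H3_volume_def)

lemma emeasure_H3_volume:
  assumes [measurable]: "E \<in> sets borel" and "E \<subseteq> H3"
  shows "emeasure H3_volume E = (\<integral>\<^sup>+v. ennreal (1 / (v$3) ^ 3) * indicator (of_real3 -` E) v \<partial>(lborel :: (real^3) measure))"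
proof -
  have "emeasure H3_volume E = (\<integral>\<^sup>+p. ennreal (1 / snd p ^ 3) * indicator H3 p * indicator E p \<partial>lborel)"
    unfolding H3_volume_def
    by (rule emeasure_density) (use assms(1) in \<open>auto intro!: borel_measurable_times_ennreal\<close>)
  also have "\<dots> = (\<integral>\<^sup>+p. ennreal (1 / snd p ^ 3) * indicator E p \<partial>lborel)"
    using assms(2) by (intro nn_integral_cong) (auto simp: indicator_def)
  also have "\<dots> = (\<integral>\<^sup>+p. ennreal (1 / snd p ^ 3) * indicator E p \<partial>(distr lborel borel of_real3))"
    by (simp add: lborel_of_real3)
  also have "\<dots> = (\<integral>\<^sup>+v. ennreal (1 / snd (of_real3 v) ^ 3) * indicator E (of_real3 v) \<partial>lborel)"
    by (rule nn_integral_distr) measurable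
  also have "\<dots> = (\<integral>\<^sup>+v. ennreal (1 / (v$3) ^ 3) * indicator (of_real3 -` E) v \<partial>lborel)"
    by (intro nn_integral_cong) (auto simp: of_real3_def indicator_def)
  finally show ?thesis .
qed

lemma abs_det_conformal:
  fixes g :: "real^3 \<Rightarrow> real^3"
  assumes lin: "linear g" and k: "k > 0" and n: "\<And>v. norm (g v) = k * norm v"
  shows "\<bar>det (matrix g)\<bar> = k ^ 3"
proof -
  define h where "h v = g v /\<^sub>R k" for v
  have "linear h" unfolding h_def[abs_def] using lin by (intro linear_compose_scale_right)
  moreover have "norm (h v) = norm v" for v using k by (simp add: h_def n)
  ultimately have oh: "orthogonal_transformation h" by (simp add: orthogonal_transformation)
  have "g = (*\<^sub>R) k \<circ> h" using k by (auto simp: h_def)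
  then have "det (matrix g) = det (matrix ((*\<^sub>R) k :: real^3 \<Rightarrow> real^3)) * det (matrix h)"
    using \<open>linear h\<close> by (simp add: matrix_compose det_mul)
  also have "det (matrix ((*\<^sub>R) k :: real^3 \<Rightarrow> real^3)) = k ^ 3" by (simp add: det_matrix_scaleR)
  finally show ?thesis using oh k by (simp add: abs_mult orthogonal_transformation_det)
qed

lemma SL2C_act_image_eq:
  assumes A: "det A = 1" and E: "E \<subseteq> H3"
  shows "SL2C_act A ` E = {p \<in> H3. SL2C_act (adj2 A) p \<in> E}"
proof (intro subset_antisym subsetI)
  fix p assume "p \<in> SL2C_act A ` E"
  then show "p \<in> {p \<in> H3. SL2C_act (adj2 A) p \<in> E}"
    using E A by (auto simp: H3_def SL2C_act_pos SL2C_act_adj2 subset_eq)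
next
  fix p assume "p \<in> {p \<in> H3. SL2C_act (adj2 A) p \<in> E}"
  then show "p \<in> SL2C_act A ` E"
    using A by (intro image_eqI[of _ _ "SL2C_act (adj2 A) p"]) (auto simp: H3_def SL2C_act_adj2)
qed

lemma SL2C_act_preimage_measurable:
  assumes A: "det A = 1" and E: "E \<in> sets borel"
  shows "{p \<in> H3. SL2C_act A p \<in> E} \<in> sets borel"
proof -
  have "SL2C_act A \<in> measurable (restrict_space borel H3) borel"
    by (rule borel_measurable_continuous_on_restrict[OF continuous_on_SL2C_act[OF A]])
  from measurable_sets[OF this E]
  have "SL2C_act A -` E \<inter> H3 \<in> sets (restrict_space borel H3)" by (simp add: space_restrict_space)
  then have "SL2C_act A -` E \<inter> H3 \<in> sets borel"
    by (subst (asm) sets_restrict_space_iff) auto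
  moreover have "SL2C_act A -` E \<inter> H3 = {p \<in> H3. SL2C_act A p \<in> E}" by auto
  ultimately show ?thesis by simp
qed

lemma SL2C_act_image_measurable:
  assumes "det A = 1" "E \<subseteq> H3" "E \<in> sets borel" shows "SL2C_act A ` E \<in> sets borel"
  using assms by (simp add: SL2C_act_image_eq SL2C_act_preimage_measurable)

text \<open>
  The derivative is the ratio of the heights times an orthogonal map. The Jacobian is therefore the
  third power of this ratio, which is exactly the factor by which the density of the volume changes.
\<close>

lemma emeasure_H3_volume_image_finite:
  assumes A: "det A = 1" and E: "E \<subseteq> H3" "E \<in> sets borel" and fin: "emeasure H3_volume E < \<infinity>"
  shows "emeasure H3_volume (SL2C_act A ` E) = emeasure H3_volume E"
proof -
  define f where "f = SL2C_act A"
  define S where "S = of_real3 -` E"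
  define g where "g = to_real3 \<circ> f \<circ> of_real3"
  define \<rho> where "\<rho> v = 1 / (v$3) ^ 3" for v :: "real^3"
  have S[measurable]: "S \<in> sets borel"
    unfolding S_def using measurable_sets[OF measurable_of_real3 E(2)] by simp
  have pos: "snd (of_real3 v) > 0" "v$3 > 0" if "v \<in> S" for v
    using that E(1) by (auto simp: S_def H3_def of_real3_def)
  have "\<exists>D. \<forall>v\<in>S. (f has_derivative D v) (at (of_real3 v))"
    using differentiable_SL2C_act[OF A] pos unfolding f_def differentiable_def by (intro bchoice) auto
  then obtain D where D: "\<And>v. v \<in> S \<Longrightarrow> (f has_derivative D v) (at (of_real3 v))" by blast
  define g' where "g' v = to_real3 \<circ> D v \<circ> of_real3" for v
  have der: "(g has_derivative g' v) (at v within S)" if v: "v \<in> S" for v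
  proof -
    have "((\<lambda>v. f (of_real3 v)) has_derivative (\<lambda>h. D v (of_real3 h))) (at v)"
      by (rule has_derivative_compose[OF bounded_linear_imp_has_derivative[OF bounded_linear_of_real3(1)] D[OF v]])
    then have "((\<lambda>v. to_real3 (f (of_real3 v))) has_derivative (\<lambda>h. to_real3 (D v (of_real3 h)))) (at v)"
      by (rule bounded_linear.has_derivative[OF bounded_linear_of_real3(2)])
    then show ?thesis by (simp add: g_def g'_def comp_def has_derivative_at_withinI)
  qed
  have inj: "inj_on g S"
  proof (rule inj_onI)
    fix v w assume vw: "v \<in> S" "w \<in> S" "g v = g w"
    then have "of_real3 (to_real3 (f (of_real3 v))) = of_real3 (to_real3 (f (of_real3 w)))"
      by (simp add: g_def)
    then have "SL2C_act (adj2 A) (f (of_real3 v)) = SL2C_act (adj2 A) (f (of_real3 w))" by simp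
    then have "to_real3 (of_real3 v) = to_real3 (of_real3 w)"
      using pos vw by (simp add: f_def SL2C_act_adj2(2)[OF A])
    then show "v = w" by simp
  qed
  have gS: "of_real3 -` (f ` E) = g ` S"
  proof (intro subset_antisym subsetI)
    fix v assume "v \<in> of_real3 -` (f ` E)"
    then obtain p where p: "p \<in> E" "f p = of_real3 v" by auto
    then show "v \<in> g ` S"
      by (intro image_eqI[of _ _ "to_real3 p"]) (simp_all add: g_def S_def)
  qed (auto simp: g_def S_def)
  have \<rho>pos: "0 \<le> \<rho> v" if "v \<in> S" for v using pos[OF that] by (simp add: \<rho>_def)
  have \<rho>pos': "0 \<le> \<rho> v" if "v \<in> g ` S" for v
    using that SL2C_act_pos[OF A pos(1)] by (auto simp: \<rho>_def g_def f_def less_imp_le)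
  have jac: "\<bar>det (matrix (g' v))\<bar> * \<rho> (g v) = \<rho> v" if v: "v \<in> S" for v
  proof -
    define k where "k = snd (f (of_real3 v)) / snd (of_real3 v)"
    have p': "snd (f (of_real3 v)) > 0" using SL2C_act_pos[OF A pos(1)[OF v]] by (simp add: f_def)
    have k: "k > 0" using p' pos[OF v] by (simp add: k_def)
    have "linear (g' v)" using has_derivative_linear[OF der[OF v]] .
    moreover have "norm (g' v h) = k * norm h" for h
      using derivative_SL2C_act_conformal[OF A pos(1)[OF v] D[OF v, unfolded f_def], of "of_real3 h"]
      by (simp add: g'_def k_def f_def)
    ultimately have "\<bar>det (matrix (g' v))\<bar> = k ^ 3" using k by (intro abs_det_conformal)
    moreover have "g v $ 3 = snd (f (of_real3 v))" by (simp add: g_def)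
    moreover have "snd (of_real3 v) = v$3" by (simp add: of_real3_def)
    ultimately show ?thesis using p' pos[OF v] by (simp add: \<rho>_def k_def power_divide)
  qed
  have mE: "emeasure H3_volume E = (\<integral>\<^sup>+v\<in>S. ennreal (\<rho> v) \<partial>lborel)"
    unfolding emeasure_H3_volume[OF E(2,1)] S_def \<rho>_def ..
  have meas: "set_borel_measurable borel S \<rho>"
    unfolding set_borel_measurable_def \<rho>_def[abs_def] by measurable
  have int: "\<rho> integrable_on S"
  proof -
    have "set_integrable lborel S \<rho>"
      unfolding set_integrable_def
    proof (rule integrableI_bounded)
      show "(\<lambda>v. indicator S v *\<^sub>R \<rho> v) \<in> borel_measurable lborel"
        using meas by (simp add: set_borel_measurable_def)
      have "(\<integral>\<^sup>+v. ennreal (norm (indicator S v *\<^sub>R \<rho> v)) \<partial>lborel) = (\<integral>\<^sup>+v\<in>S. ennreal (\<rho> v) \<partial>lborel)"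
        using \<rho>pos by (intro nn_integral_cong) (auto simp: indicator_def)
      then show "(\<integral>\<^sup>+v. ennreal (norm (indicator S v *\<^sub>R \<rho> v)) \<partial>lborel) < \<infinity>"
        using fin mE by simp
    qed
    then show ?thesis by (rule set_borel_integral_eq_integral(1))
  qed
  have mE': "emeasure H3_volume E = ennreal (integral S \<rho>)"
    unfolding mE using nn_integral_has_integral_lebesgue'[where f = \<rho>, OF \<rho>pos integrable_integral[OF int]] .
  have "(\<lambda>v. vec (\<rho> v) :: real^1) absolutely_integrable_on S"
    using absolutely_integrable_on_iff_nonneg[of S \<rho>] \<rho>pos int by (simp add: absolutely_integrable_on_1_iff)
  then have abs: "(\<lambda>v. \<bar>det (matrix (g' v))\<bar> *\<^sub>R (vec (\<rho> (g v)) :: real^1)) absolutely_integrable_on S"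
    by (subst set_integrable_cong[where f' = "\<lambda>v. vec (\<rho> v)", OF refl refl]) (simp_all add: vec_eq_iff jac)
  have eq: "integral S (\<lambda>v. \<bar>det (matrix (g' v))\<bar> *\<^sub>R (vec (\<rho> (g v)) :: real^1)) = vec (integral S \<rho>)"
    (is "integral S ?F = _")
  proof -
    have "integral S ?F = integral S (\<lambda>v. vec (\<rho> v))"
      by (rule integral_cong) (simp add: vec_eq_iff jac)
    then show ?thesis by (simp add: integral_on_1_eq)
  qed
  have S': "S \<in> sets lebesgue" using S by (simp add: sets_completionI_sets)
  have "(\<lambda>v. vec (\<rho> v) :: real^1) absolutely_integrable_on (g ` S) \<and> integral (g ` S) (\<lambda>v. vec (\<rho> v) :: real^1) = vec (integral S \<rho>)"
    using has_absolute_integral_change_of_variables[OF S' der inj, of "\<lambda>v. vec (\<rho> v) :: real^1" "vec (integral S \<rho>)"]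
      abs eq by blast
  then have "\<rho> absolutely_integrable_on (g ` S)" and *: "vec (integral (g ` S) \<rho>) = (vec (integral S \<rho>) :: real^1)"
    by (simp_all add: absolutely_integrable_on_1_iff integral_on_1_eq)
  then have "\<rho> integrable_on (g ` S)" by (blast dest: set_lebesgue_integral_eq_integral(1))
  moreover have "integral (g ` S) \<rho> = integral S \<rho>" using * by (simp add: vec_eq_iff)
  ultimately have "(\<rho> has_integral integral S \<rho>) (g ` S)" by (metis integrable_integral)
  from nn_integral_has_integral_lebesgue'[where f = \<rho>, OF \<rho>pos' this]
  have "(\<integral>\<^sup>+v. ennreal (\<rho> v) * indicator (g ` S) v \<partial>lborel) = ennreal (integral S \<rho>)" .
  moreover have "SL2C_act A ` E \<subseteq> H3" using E(1) A by (auto simp: H3_def SL2C_act_pos subset_eq)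
  ultimately show ?thesis
    using emeasure_H3_volume[OF SL2C_act_image_measurable[OF A E]] by (simp add: mE' gS[unfolded f_def] \<rho>_def)
qed

lemma emeasure_H3_volume_image:
  assumes A: "det A = 1" and E: "E \<subseteq> H3" "E \<in> sets borel"
  shows "emeasure H3_volume (SL2C_act A ` E) = emeasure H3_volume E"
proof (cases "emeasure H3_volume E < \<infinity>")
  case True then show ?thesis using emeasure_H3_volume_image_finite assms by blast
next
  case False
  have E': "SL2C_act A ` E \<subseteq> H3" using E(1) A by (auto simp: H3_def SL2C_act_pos subset_eq)
  have "SL2C_act (adj2 A) ` SL2C_act A ` E = E"
    using E(1) A by (force simp: H3_def SL2C_act_adj2 subset_eq image_image)
  then have "\<not> emeasure H3_volume (SL2C_act A ` E) < \<infinity>"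
    using emeasure_H3_volume_image_finite[of "adj2 A" "SL2C_act A ` E"] E' SL2C_act_image_measurable[OF A E] A False
    by auto
  then show ?thesis using False by (simp add: less_top[symmetric])
qed

section \<open>Wandering sets\<close>

lemma PSL2C_cosetE:
  assumes "\<gamma> \<in> carrier PSL2C"
  obtains A where "\<gamma> = {A, - A}" "det A = 1"
  using assms by (auto simp: carrier_PSL2C)

lemma PSL2C_act_mult:
  assumes "\<gamma> \<in> carrier PSL2C" "\<delta> \<in> carrier PSL2C" "p \<in> H3"
  shows "PSL2C_act (\<gamma> \<otimes>\<^bsub>PSL2C\<^esub> \<delta>) p = PSL2C_act \<gamma> (PSL2C_act \<delta> p)"
proof -
  obtain A where A: "\<gamma> = {A, - A}" "det A = 1" using PSL2C_cosetE[OF assms(1)] .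
  obtain B where B: "\<delta> = {B, - B}" "det B = 1" using PSL2C_cosetE[OF assms(2)] .
  show ?thesis using A B assms(3) by (simp add: mult_PSL2C PSL2C_act_coset SL2C_act_mult H3_def)
qed

lemma PSL2C_act_inverse:
  assumes "\<gamma> \<in> carrier PSL2C" "p \<in> H3"
  shows "PSL2C_act (inv\<^bsub>PSL2C\<^esub> \<gamma>) (PSL2C_act \<gamma> p) = p"
proof -
  interpret group PSL2C by (rule group_PSL2C)
  have "PSL2C_act \<one>\<^bsub>PSL2C\<^esub> p = p" by (simp add: one_PSL2C PSL2C_act_coset SL2C_act_one)
  then show ?thesis using assms PSL2C_act_mult[of "inv\<^bsub>PSL2C\<^esub> \<gamma>" \<gamma> p] by simp
qed

text \<open>
  Cut \<open>E\<close> into the pieces \<open>S \<gamma>\<close> that \<open>\<gamma>\<close> moves into \<open>D\<close>. The images of the pieces are disjoint, since \<open>E\<close>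
  contains at most one point of each orbit, and they have the volumes of the pieces.
\<close>

lemma emeasure_wandering_le_fundamental_set:
  assumes sub: "subgroup \<Gamma> PSL2C" and cnt: "countable \<Gamma>" and D: "fundamental_set \<Gamma> D"
    and E: "E \<subseteq> H3" "E \<in> sets borel"
    and wander: "\<And>\<gamma> p. \<gamma> \<in> \<Gamma> \<Longrightarrow> p \<in> E \<Longrightarrow> PSL2C_act \<gamma> p \<in> E \<Longrightarrow> \<gamma> = \<one>\<^bsub>PSL2C\<^esub>"
  shows "emeasure H3_volume E \<le> emeasure H3_volume D"
proof -
  interpret group PSL2C by (rule group_PSL2C)
  have carr: "\<gamma> \<in> carrier PSL2C" if "\<gamma> \<in> \<Gamma>" for \<gamma> using subgroup.mem_carrier[OF sub that] .
  have DH: "D \<subseteq> H3" and Db: "D \<in> sets borel"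
    and ex1: "\<And>p. p \<in> H3 \<Longrightarrow> \<exists>!q. q \<in> D \<and> (\<exists>\<gamma>\<in>\<Gamma>. q = PSL2C_act \<gamma> p)"
    using D by (auto simp: fundamental_set_def)
  have eq: "\<gamma> = \<delta>" if "\<gamma> \<in> \<Gamma>" "\<delta> \<in> \<Gamma>" "p \<in> E" "q \<in> E" "PSL2C_act \<gamma> p = PSL2C_act \<delta> q" for \<gamma> \<delta> p q
  proof -
    have "PSL2C_act (inv\<^bsub>PSL2C\<^esub> \<delta> \<otimes>\<^bsub>PSL2C\<^esub> \<gamma>) p = PSL2C_act (inv\<^bsub>PSL2C\<^esub> \<delta>) (PSL2C_act \<delta> q)"
      using that carr E(1) by (simp add: PSL2C_act_mult subset_eq)
    also have "\<dots> = q" using that carr E(1) by (intro PSL2C_act_inverse) auto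
    finally have "inv\<^bsub>PSL2C\<^esub> \<delta> \<otimes>\<^bsub>PSL2C\<^esub> \<gamma> = \<one>\<^bsub>PSL2C\<^esub>"
      using that sub by (intro wander) (auto simp: subgroup.m_closed subgroup.m_inv_closed)
    then show ?thesis using carr that by (metis inv_closed inv_inv inv_equality m_closed inv_comm)
  qed
  define S where "S \<gamma> = {p \<in> E. PSL2C_act \<gamma> p \<in> D}" for \<gamma>
  have meas: "S \<gamma> \<in> sets borel" "PSL2C_act \<gamma> ` S \<gamma> \<in> sets borel"
    "emeasure H3_volume (PSL2C_act \<gamma> ` S \<gamma>) = emeasure H3_volume (S \<gamma>)" if \<gamma>: "\<gamma> \<in> \<Gamma>" for \<gamma>
  proof -
    obtain A where A: "\<gamma> = {A, - A}" "det A = 1" using PSL2C_cosetE[OF carr[OF \<gamma>]] .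
    have act: "PSL2C_act \<gamma> = SL2C_act A" by (simp add: fun_eq_iff A(1) PSL2C_act_coset)
    have "S \<gamma> = E \<inter> {p \<in> H3. SL2C_act A p \<in> D}" using E(1) by (auto simp: S_def act)
    then show 1: "S \<gamma> \<in> sets borel" using SL2C_act_preimage_measurable[OF A(2) Db] E(2) by simp
    have 2: "S \<gamma> \<subseteq> H3" using E(1) by (auto simp: S_def)
    show "PSL2C_act \<gamma> ` S \<gamma> \<in> sets borel" "emeasure H3_volume (PSL2C_act \<gamma> ` S \<gamma>) = emeasure H3_volume (S \<gamma>)"
      unfolding act using SL2C_act_image_measurable[OF A(2) 2 1] emeasure_H3_volume_image[OF A(2) 2 1] by auto
  qed
  have "E = (\<Union>\<gamma>\<in>\<Gamma>. S \<gamma>)"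
  proof -
    have "\<exists>\<gamma>\<in>\<Gamma>. PSL2C_act \<gamma> p \<in> D" if "p \<in> E" for p using ex1[of p] that E(1) by blast
    then show ?thesis by (auto simp: S_def)
  qed
  moreover have "emeasure H3_volume (\<Union>\<gamma>\<in>\<Gamma>. S \<gamma>) = (\<integral>\<^sup>+\<gamma>. emeasure H3_volume (S \<gamma>) \<partial>count_space \<Gamma>)"
  proof (rule emeasure_UN_countable[OF _ cnt])
    show "S \<gamma> \<in> sets H3_volume" if "\<gamma> \<in> \<Gamma>" for \<gamma> using meas(1)[OF that] by simp
    show "disjoint_family_on S \<Gamma>"
    proof (unfold disjoint_family_on_def, intro ballI impI)
      fix \<gamma> \<delta> assume gd: "\<gamma> \<in> \<Gamma>" "\<delta> \<in> \<Gamma>" "\<gamma> \<noteq> \<delta>"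
      have False if "p \<in> S \<gamma>" "p \<in> S \<delta>" for p
      proof -
        have "p \<in> E" "p \<in> H3" using that E(1) by (auto simp: S_def)
        moreover have "PSL2C_act \<gamma> p = PSL2C_act \<delta> p"
          using ex1[OF \<open>p \<in> H3\<close>] that gd by (auto simp: S_def)
        ultimately show False using eq[of \<gamma> \<delta> p p] gd by blast
      qed
      then show "S \<gamma> \<inter> S \<delta> = {}" by blast
    qed
  qed
  moreover have "(\<integral>\<^sup>+\<gamma>. emeasure H3_volume (S \<gamma>) \<partial>count_space \<Gamma>) =
      (\<integral>\<^sup>+\<gamma>. emeasure H3_volume (PSL2C_act \<gamma> ` S \<gamma>) \<partial>count_space \<Gamma>)"
    by (intro nn_integral_cong) (simp add: meas(3))
  moreover have "\<dots> = emeasure H3_volume (\<Union>\<gamma>\<in>\<Gamma>. PSL2C_act \<gamma> ` S \<gamma>)"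
  proof (rule emeasure_UN_countable[OF _ cnt, symmetric])
    show "PSL2C_act \<gamma> ` S \<gamma> \<in> sets H3_volume" if "\<gamma> \<in> \<Gamma>" for \<gamma> using meas(2)[OF that] by simp
    show "disjoint_family_on (\<lambda>\<gamma>. PSL2C_act \<gamma> ` S \<gamma>) \<Gamma>"
      using eq unfolding disjoint_family_on_def S_def by blast
  qed
  moreover have "\<dots> \<le> emeasure H3_volume D"
    using Db by (intro emeasure_mono) (auto simp: S_def)
  ultimately show ?thesis by simp
qed

lemma emeasure_H3_volume_product_ge:
  assumes A: "A \<in> sets borel" and B: "B \<in> sets borel" "B \<subseteq> {0<..<T}" and T: "T > 0"
  shows "ennreal (1 / T ^ 3) * (emeasure lborel A * emeasure lborel B) \<le> emeasure H3_volume (A \<times> B)"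
proof -
  have AB: "A \<times> B \<in> sets (borel :: (complex \<times> real) measure)"
    using A B(1) by (simp add: borel_prod[symmetric])
  have "ennreal (1 / T ^ 3) * (emeasure lborel A * emeasure lborel B) = ennreal (1 / T ^ 3) * emeasure lborel (A \<times> B)"
    using lborel.emeasure_pair_measure_Times[of A lborel B] A B(1) by (simp add: lborel_prod)
  also have "\<dots> = (\<integral>\<^sup>+p. ennreal (1 / T ^ 3) * indicator (A \<times> B) p \<partial>lborel)"
    by (rule nn_integral_cmult_indicator[symmetric]) (use AB in simp)
  also have "\<dots> \<le> (\<integral>\<^sup>+p. ennreal (1 / snd p ^ 3) * indicator H3 p * indicator (A \<times> B) p \<partial>lborel)"
  proof (intro nn_integral_mono)
    fix p :: "complex \<times> real"
    have "1 / T ^ 3 \<le> 1 / snd p ^ 3" "p \<in> H3" if "p \<in> A \<times> B"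
    proof -
      have "0 < snd p" "snd p < T" using that B(2) by auto
      then show "1 / T ^ 3 \<le> 1 / snd p ^ 3" "p \<in> H3"
        by (auto intro!: divide_left_mono power_mono simp: H3_def)
    qed
    then show "ennreal (1 / T ^ 3) * indicator (A \<times> B) p \<le>
        ennreal (1 / snd p ^ 3) * indicator H3 p * indicator (A \<times> B) p"
      by (auto simp: indicator_def intro!: ennreal_leI)
  qed
  also have "\<dots> = emeasure H3_volume (A \<times> B)"
    unfolding H3_volume_def using AB by (intro emeasure_density[symmetric]) (auto intro!: borel_measurable_times_ennreal)
  finally show ?thesis .
qed

text \<open>
  The part of height less than \<open>T\<close> has volume at least a constant divided by \<open>T\<^sup>2\<close>,
  which is unbounded as \<open>T\<close> tends to 0.
\<close>

lemma emeasure_cylinder_infinite: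
  assumes r: "r > 0"
  shows "emeasure H3_volume (ball 0 r \<times> {0<..}) = \<infinity>"
proof (rule ccontr)
  define M where "M = emeasure H3_volume (ball 0 r \<times> {0<..})"
  define c where "c = measure lborel (ball (0::complex) r)"
  assume "\<not> emeasure H3_volume (ball 0 r \<times> {0<..}) = \<infinity>"
  then obtain m where m: "M = ennreal m" "m \<ge> 0" by (cases M) (auto simp: M_def)
  have c: "c > 0" using content_ball_pos[OF r, of "0::complex"] by (simp add: c_def)
  have em: "emeasure lborel (ball (0::complex) r) = ennreal c"
    unfolding c_def by (rule emeasure_eq_ennreal_measure) (use emeasure_lborel_ball_finite[of "0::complex" r] in auto)
  have "c / T ^ 2 \<le> m" if T: "T > 0" for T :: real
  proof -
    have "ennreal (1 / T ^ 3) * (emeasure lborel (ball (0::complex) r) * emeasure lborel {0<..<T}) \<le>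
        emeasure H3_volume (ball 0 r \<times> {0<..<T})"
      using T by (intro emeasure_H3_volume_product_ge) auto
    also have "\<dots> \<le> M" unfolding M_def
      by (intro emeasure_mono) (auto simp: borel_prod[symmetric])
    also have "ennreal (1 / T ^ 3) * (emeasure lborel (ball (0::complex) r) * emeasure lborel {0<..<T}) = ennreal (c / T ^ 2)"
      using T c by (simp add: em power2_eq_square power3_eq_cube flip: ennreal_mult)
    finally show ?thesis using m by simp
  qed
  from this[of "sqrt (c / (m + 1))"] show False using c m by simp
qed

lemma emeasure_slab_infinite:
  assumes c: "c > 1"
  shows "emeasure H3_volume (UNIV \<times> {1..<c}) = \<infinity>"
proof -
  have "ennreal (1 / c ^ 3) * (emeasure lborel (UNIV :: complex set) * emeasure lborel {1..<c}) \<le>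
      emeasure H3_volume (UNIV \<times> {1..<c})"
    using c by (intro emeasure_H3_volume_product_ge) auto
  moreover have "ennreal (1 / c ^ 3) * (emeasure lborel (UNIV :: complex set) * emeasure lborel {1..<c}) = \<infinity>"
    using c by (simp add: ennreal_top_mult ennreal_mult_top ennreal_mult_eq_top_iff)
  ultimately show ?thesis by (simp add: top_unique)
qed

section \<open>The group of lifts\<close>

text \<open>
  Elements of \<open>PSL2C\<close> are sets of matrices, so the preimage of a subgroup in \<open>SL2C\<close> is its union.
\<close>

definition lifts :: "(complex^2^2) set set \<Rightarrow> (complex^2^2) set" where
  "lifts \<Gamma> = \<Union>\<Gamma>"

lemma mem_lifts_iff:
  assumes "\<Gamma> \<subseteq> carrier PSL2C"
  shows "A \<in> lifts \<Gamma> \<longleftrightarrow> {A, - A} \<in> \<Gamma>"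
proof
  assume "A \<in> lifts \<Gamma>"
  then obtain \<gamma> where \<gamma>: "\<gamma> \<in> \<Gamma>" "A \<in> \<gamma>" by (auto simp: lifts_def)
  then obtain B where "\<gamma> = {B, - B}" using assms PSL2C_cosetE by blast
  then have "\<gamma> = {A, - A}" using \<gamma>(2) by auto
  then show "{A, - A} \<in> \<Gamma>" using \<gamma>(1) by simp
qed (auto simp: lifts_def)

lemma tendsto_mat2:
  assumes "(a \<longlongrightarrow> a') F" "(b \<longlongrightarrow> b') F" "(c \<longlongrightarrow> c') F" "(d \<longlongrightarrow> d') F"
  shows "((\<lambda>x. mat2 (a x) (b x) (c x) (d x)) \<longlongrightarrow> mat2 a' b' c' d') F"
proof (rule vec_tendstoI, rule vec_tendstoI)
  fix i j :: 2
  show "((\<lambda>x. mat2 (a x) (b x) (c x) (d x) $ i $ j) \<longlongrightarrow> mat2 a' b' c' d' $ i $ j) F"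
    using exhaust_2[of i] exhaust_2[of j] assms by (elim disjE) simp_all
qed

text \<open>
  If a bounded set contained infinitely many elements of \<open>G\<close>, they would accumulate, and the quotient
  of any two of them near the limit would be near the identity. Hence any two of them would agree up
  to sign. This is impossible for three different elements.
\<close>

lemma discrete_SL2I:
  assumes det: "\<And>A. A \<in> G \<Longrightarrow> det A = 1"
    and mult: "\<And>A B. A \<in> G \<Longrightarrow> B \<in> G \<Longrightarrow> A ** B \<in> G"
    and adj: "\<And>A. A \<in> G \<Longrightarrow> adj2 A \<in> G"
    and uminus: "\<And>A. A \<in> G \<Longrightarrow> - A \<in> G"
    and one: "mat 1 \<in> G"
    and e: "e > 0" "\<And>A. A \<in> G \<Longrightarrow> dist A (mat 1) < e \<Longrightarrow> A = mat 1 \<or> A = - mat 1"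
  shows "discrete_SL2 G"
proof
  fix K :: real
  show "finite {A \<in> G. norm A \<le> K}"
  proof (rule ccontr)
    define S where "S = {A \<in> G. norm A \<le> K}"
    assume "infinite {A \<in> G. norm A \<le> K}"
    then have inf: "infinite S" by (simp add: S_def)
    have "bounded S" by (rule boundedI[of _ K]) (auto simp: S_def)
    then obtain l where l: "l islimpt S" using inf bounded_infinite_imp_islimpt by blast
    define F where "F AB = adj2 (fst AB) ** snd AB" for AB :: "(complex^2^2) \<times> (complex^2^2)"
    have cont: "isCont F (l, l)"
    proof -
      have F: "F = (\<lambda>X. mat2 (fst X $2$2 * snd X $1$1 - fst X $1$2 * snd X $2$1)
          (fst X $2$2 * snd X $1$2 - fst X $1$2 * snd X $2$2)
          (fst X $1$1 * snd X $2$1 - fst X $2$1 * snd X $1$1)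
          (fst X $1$1 * snd X $2$2 - fst X $2$1 * snd X $1$2))"
        by (rule ext) (simp add: F_def vec_eq_iff forall_2 adj2_def matrix_matrix_mult_def sum_2)
      show ?thesis unfolding isCont_def F by (intro tendsto_mat2 tendsto_intros)
    qed
    have "det l = 1"
    proof -
      have "continuous_on UNIV (\<lambda>A::complex^2^2. det A)"
        unfolding det_2 by (intro continuous_intros)
      then have "closed ((\<lambda>A::complex^2^2. det A) -` {1})"
        by (intro closed_vimage) auto
      moreover have "S \<subseteq> (\<lambda>A. det A) -` {1}" using det by (auto simp: S_def)
      ultimately have "l \<in> (\<lambda>A. det A) -` {1}" using l closed_limpt islimpt_subset by blast
      then show ?thesis by simp
    qed
    then have Fl: "F (l, l) = mat 1" by (simp add: F_def adj2_inverse)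
    from cont e(1) obtain d where d: "d > 0" "\<And>X. dist X (l, l) < d \<Longrightarrow> dist (F X) (mat 1) < e"
      unfolding continuous_at_eps_delta Fl by blast
    have "infinite (S \<inter> ball l (d / 2))" using l d(1) by (simp add: islimpt_eq_infinite_ball)
    then obtain X where X: "X \<subseteq> S \<inter> ball l (d / 2)" "card X = 3"
      using infinite_arbitrarily_large by blast
    then obtain A B C where ABC: "X = {A, B, C}" "A \<noteq> B" "B \<noteq> C" "A \<noteq> C" by (auto simp: card_3_iff)
    have near: "B = A \<or> B = - A" if "A \<in> S \<inter> ball l (d / 2)" "B \<in> S \<inter> ball l (d / 2)" for A B
    proof -
      have AG: "A \<in> G" "B \<in> G" using that by (auto simp: S_def)
      have "dist (A, B) (l, l) \<le> dist A l + dist B l"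
        by (simp add: dist_Pair_Pair sqrt_sum_squares_le_sum)
      also have "\<dots> < d" using that by (auto simp: dist_commute)
      finally have "dist (F (A, B)) (mat 1) < e" by (rule d(2))
      then have "adj2 A ** B = mat 1 \<or> adj2 A ** B = - mat 1"
        unfolding F_def fst_conv snd_conv using AG by (intro e(2) mult adj)
      moreover have "A ** (adj2 A ** B) = B"
        using AG det by (simp add: matrix_mul_assoc adj2_inverse)
      ultimately show ?thesis using uminus_matrix_mult_2(2)[of A "mat 1"] by auto
    qed
    have "B = - A" "C = - A" using near[of A B] near[of A C] X ABC by auto
    then show False using ABC by simp
  qed
qed (use assms in auto)

lemma discrete_SL2_lifts:
  assumes "kleinian_group \<Gamma>" shows "discrete_SL2 (lifts \<Gamma>)"
proof -
  have sub: "subgroup \<Gamma> PSL2C" and top: "subtopology PSL2C_topology \<Gamma> = discrete_topology \<Gamma>"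
    using assms by (auto simp: kleinian_group_def)
  have carr: "\<Gamma> \<subseteq> carrier PSL2C" using sub by (rule subgroup.subset)
  note mem = mem_lifts_iff[OF carr]
  have det: "det A = 1" if "A \<in> lifts \<Gamma>" for A
  proof -
    have "{A, - A} \<in> carrier PSL2C" using that carr mem by blast
    then obtain B where B: "{A, - A} = {B, - B}" "det B = 1" using PSL2C_cosetE by blast
    then have "A = B \<or> A = - B" by blast
    then show ?thesis using B(2) det_uminus_2[of B] by (elim disjE) simp_all
  qed
  have one: "{mat 1, - mat 1} \<in> \<Gamma>" using subgroup.one_closed[OF sub] by (simp add: one_PSL2C)
  have "openin (subtopology PSL2C_topology \<Gamma>) {{mat 1, - mat 1}}" unfolding top using one by simp
  then obtain U where U: "openin PSL2C_topology U" "U \<inter> \<Gamma> = {{mat 1, - mat 1}}"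
    unfolding openin_subtopology by blast
  then have "openin (top_of_set (carrier SL2C)) (\<Union>U)" by (simp only: openin_PSL2C_topology)
  then obtain V where V: "open V" "\<Union>U = carrier SL2C \<inter> V" unfolding openin_open by blast
  have "{mat 1, - mat 1} \<in> U" using U(2) by blast
  then have "mat 1 \<in> V" using V(2) by blast
  then obtain e where e: "e > 0" "\<And>A. dist A (mat 1) < e \<Longrightarrow> A \<in> V"
    using V(1) unfolding open_dist by blast
  show ?thesis
  proof (rule discrete_SL2I[OF det _ _ _ _ e(1)])
    fix A B assume "A \<in> lifts \<Gamma>" "B \<in> lifts \<Gamma>"
    then show "A ** B \<in> lifts \<Gamma>"
      using subgroup.m_closed[OF sub, of "{A, - A}" "{B, - B}"] by (simp add: mem mult_PSL2C)
  next
    fix A assume A: "A \<in> lifts \<Gamma>"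
    show "adj2 A \<in> lifts \<Gamma>"
      using subgroup.m_inv_closed[OF sub, of "{A, - A}"] A inv_PSL2C[OF det[OF A] adj2_inverse(1)[OF det[OF A]]]
      by (simp add: mem)
    have "{- A, - (- A)} = {A, - A}" by (simp add: insert_commute)
    then show "- A \<in> lifts \<Gamma>" using A unfolding mem by simp
    assume "dist A (mat 1) < e"
    then have "A \<in> V" by (rule e(2))
    moreover have "A \<in> carrier SL2C" using det[OF A] by (simp add: SL2C_def)
    ultimately obtain u where u: "u \<in> U" "A \<in> u" using V(2) by blast
    have "u \<in> carrier PSL2C" using U(1) u(1) unfolding openin_PSL2C_topology by blast
    then obtain B where B: "u = {B, - B}" using PSL2C_cosetE by blast
    then have "A = B \<or> A = - B" using u(2) by blast
    then have "u = {A, - A}" unfolding B by (elim disjE) (simp_all add: insert_commute)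
    then have "{A, - A} \<in> U \<inter> \<Gamma>" using u A mem by blast
    then show "A = mat 1 \<or> A = - mat 1" unfolding U(2) by blast
  qed (simp_all add: mem one)
qed

lemma (in discrete_SL2) countable_G: "countable G"
proof -
  have "G = (\<Union>n::nat. {A \<in> G. norm A \<le> real n})" using real_arch_simple by auto
  also have "countable \<dots>" using finite_bounded by (intro countable_UN) (auto intro: countable_finite)
  finally show ?thesis .
qed

lemma conjugate_undo:
  assumes "det P = 1" shows "adj2 P ** (P ** A ** adj2 P) ** P = A"
proof -
  have "adj2 P ** (P ** A ** adj2 P) ** P = (adj2 P ** P) ** A ** (adj2 P ** P)"
    by (simp add: matrix_mul_assoc)
  then show ?thesis by (simp add: adj2_inverse(2)[OF assms])
qed

lemma trace_conjugate:
  assumes "det P = 1" shows "trace (P ** A ** adj2 P) = trace A"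
proof -
  have "trace (P ** A ** adj2 P) = trace (adj2 P ** (P ** A))" by (rule trace_mul_sym)
  then show ?thesis by (simp add: matrix_mul_assoc adj2_inverse(2)[OF assms])
qed

lemma conjugate_mult:
  assumes "det P = 1"
  shows "(P ** A ** adj2 P) ** (P ** B ** adj2 P) = P ** (A ** B) ** adj2 P"
proof -
  have "(P ** A ** adj2 P) ** (P ** B ** adj2 P) = P ** A ** (adj2 P ** P) ** B ** adj2 P"
    by (simp add: matrix_mul_assoc)
  then show ?thesis by (simp add: adj2_inverse(2)[OF assms] matrix_mul_assoc)
qed

lemma (in discrete_SL2) conjugate_discrete:
  assumes P: "det P = 1" shows "discrete_SL2 ((\<lambda>A. P ** A ** adj2 P) ` G)"
proof
  define c where "c A = P ** A ** adj2 P" for A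
  have PP: "P ** adj2 P = mat 1" "adj2 P ** P = mat 1" using adj2_inverse[OF P] .
  have undo: "adj2 P ** c A ** P = A" for A
    unfolding c_def by (rule conjugate_undo[OF P])
  have cm: "c A ** c B = c (A ** B)" for A B
    unfolding c_def by (rule conjugate_mult[OF P])
  fix K
  show "finite {A \<in> (\<lambda>A. P ** A ** adj2 P) ` G. norm A \<le> K}"
  proof -
    have "linear (\<lambda>B. adj2 P ** B ** P)"
      by (rule linearI) (simp_all add: vec_eq_iff matrix_matrix_mult_def sum_2 algebra_simps)
    then obtain k where k: "k > 0" "\<And>B. norm (adj2 P ** B ** P) \<le> k * norm B"
      using linear_bounded_pos by blast
    have "{A \<in> c ` G. norm A \<le> K} \<subseteq> c ` {A \<in> G. norm A \<le> k * K}"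
    proof
      fix B assume "B \<in> {A \<in> c ` G. norm A \<le> K}"
      then obtain A where A: "A \<in> G" "B = c A" "norm B \<le> K" by blast
      have "norm A \<le> k * norm B" using k(2)[of B] by (simp add: A(2) undo)
      also have "\<dots> \<le> k * K" using k(1) A(3) by simp
      finally show "B \<in> c ` {A \<in> G. norm A \<le> k * K}" using A by blast
    qed
    then show ?thesis unfolding c_def[symmetric] using finite_bounded finite_surj by blast
  qed
  show "mat 1 \<in> (\<lambda>A. P ** A ** adj2 P) ` G"
    using one_mem PP by (intro image_eqI[of _ _ "mat 1"]) simp_all
  fix A B assume "A \<in> (\<lambda>A. P ** A ** adj2 P) ` G"
  then obtain A' where A': "A' \<in> G" "A = c A'" by (auto simp: c_def)
  show "det A = 1" using A' det_mem P by (simp add: c_def det_mul)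
  have "adj2 A = c (adj2 A')" by (simp add: A' c_def adj2_mult matrix_mul_assoc)
  then show "adj2 A \<in> (\<lambda>A. P ** A ** adj2 P) ` G" using adj2_mem A' by (auto simp: c_def)
  have "- A = c (- A')" by (simp add: A' c_def uminus_matrix_mult_2)
  then show "- A \<in> (\<lambda>A. P ** A ** adj2 P) ` G" using uminus_mem A' by (auto simp: c_def)
  assume "B \<in> (\<lambda>A. P ** A ** adj2 P) ` G"
  then obtain B' where "B' \<in> G" "B = c B'" by (auto simp: c_def)
  then show "A ** B \<in> (\<lambda>A. P ** A ** adj2 P) ` G" using A' cm mult_mem by (auto simp: c_def)
qed

section \<open>Elementary groups have infinite covolume\<close>

lemma SL2C_act_upper_unipotent:
  assumes "e = 1 \<or> e = -1" shows "SL2C_act (mat2 e b 0 e) (z, t) = (z + e * b, t)"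
  using assms by (auto simp: SL2C_act_def Let_def)

lemma SL2C_act_diagonal:
  assumes "m \<noteq> 0" shows "SL2C_act (mat2 m 0 0 (1 / m)) (z, t) = (m\<^sup>2 * z, (cmod m)\<^sup>2 * t)"
proof -
  have "cnj m \<noteq> 0" using assms by simp
  then have "m * z * cnj (1 / m) / complex_of_real ((cmod (1 / m))\<^sup>2) = m\<^sup>2 * z"
    unfolding complex_norm_square using assms by (simp add: power2_eq_square field_simps)
  then show ?thesis using assms
    by (simp add: SL2C_act_def Let_def norm_divide power_divide)
qed

context discrete_SL2
begin

text \<open>
  The group acts on the boundary plane by a discrete group of translations. A vertical cylinder
  whose diameter is less than the length of the shortest translation is disjoint from all its other
  translates.
\<close>

lemma unipotent_infinite_wandering:
  assumes uni: "\<And>A. A \<in> G \<Longrightarrow> \<exists>e b. (e = 1 \<or> e = -1) \<and> A = mat2 e b 0 e"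
  shows "\<exists>E. E \<subseteq> H3 \<and> E \<in> sets borel \<and> emeasure H3_volume E = \<infinity> \<and>
    (\<forall>A\<in>G. \<forall>p\<in>E. SL2C_act A p \<in> E \<longrightarrow> A = mat 1 \<or> A = - mat 1)"
proof -
  define F where "F = {A \<in> G. norm A \<le> 4}"
  have "finite F" unfolding F_def by (rule finite_bounded)
  have "\<forall>\<^sub>F r in at_right (0::real). \<forall>A\<in>F. A$1$2 \<noteq> 0 \<longrightarrow> 2 * r < cmod (A$1$2)"
  proof (rule eventually_ball_finite[OF \<open>finite F\<close>], intro ballI)
    fix A
    have "((\<lambda>r. 2 * r) \<longlongrightarrow> 2 * 0) (at_right (0::real))" by (intro tendsto_intros)
    from order_tendstoD(2)[OF this, of "cmod (A$1$2)"]
    show "\<forall>\<^sub>F r in at_right (0::real). A$1$2 \<noteq> 0 \<longrightarrow> 2 * r < cmod (A$1$2)"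
      by (cases "A$1$2 = 0") auto
  qed
  moreover have "\<forall>\<^sub>F r in at_right (0::real). 0 < r \<and> r < 1"
    by (auto simp: eventually_at_right[of "0::real" 1] intro!: exI[of _ 1])
  ultimately have "\<forall>\<^sub>F r in at_right (0::real). (0 < r \<and> r < 1) \<and> (\<forall>A\<in>F. A$1$2 \<noteq> 0 \<longrightarrow> 2 * r < cmod (A$1$2))"
    by eventually_elim blast
  then obtain r where r: "0 < r" "r < 1" "\<And>A. A \<in> F \<Longrightarrow> A$1$2 \<noteq> 0 \<Longrightarrow> 2 * r < cmod (A$1$2)"
    using eventually_happens'[OF trivial_limit_at_right_real] by blast
  define E where "E = ball (0::complex) r \<times> {0::real<..}"
  show ?thesis
  proof (intro exI[of _ E] conjI ballI impI)
    show "E \<subseteq> H3" by (auto simp: E_def H3_def)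
    show "E \<in> sets borel" by (simp add: E_def borel_prod[symmetric])
    show "emeasure H3_volume E = \<infinity>" using emeasure_cylinder_infinite[OF r(1)] by (simp add: E_def)
    fix A p assume A: "A \<in> G" "p \<in> E" "SL2C_act A p \<in> E"
    obtain e b where eb: "e = 1 \<or> e = -1" "A = mat2 e b 0 e" using uni[OF A(1)] by blast
    obtain z t where p: "p = (z, t)" by (cases p)
    have zr: "cmod z < r" "cmod (z + e * b) < r"
      using A(2,3) by (simp_all add: p E_def eb(2) SL2C_act_upper_unipotent[OF eb(1)])
    have "cmod b = cmod ((z + e * b) - z)" using eb(1) by (auto simp: norm_mult)
    also have "\<dots> < 2 * r" using norm_triangle_ineq4[of "z + e * b" z] zr by linarith
    finally have b: "cmod b < 2 * r" .
    have "norm A \<le> 4" using norm_mat2_le[of e b 0 e] eb b r(2) by auto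
    then have "b = 0" using r(3)[of A] b A(1) by (auto simp: F_def eb(2))
    then show "A = mat 1 \<or> A = - mat 1" using eb by (auto simp: mat_1_mat2)
  qed
qed

text \<open>
  The elements act on the height by factors \<open>(cmod m)\<^sup>2\<close>, and by discreteness those different from 1
  stay away from 1. A thin horizontal slab is then disjoint from its other translates.
\<close>

lemma diagonal_infinite_wandering:
  assumes diag: "\<And>A. A \<in> G \<Longrightarrow> \<exists>m. m \<noteq> 0 \<and> A = mat2 m 0 0 (1 / m)"
    and free: "\<And>m. mat2 m 0 0 (1 / m) \<in> G \<Longrightarrow> cmod m = 1 \<Longrightarrow> m = 1 \<or> m = -1"
  shows "\<exists>E. E \<subseteq> H3 \<and> E \<in> sets borel \<and> emeasure H3_volume E = \<infinity> \<and>
    (\<forall>A\<in>G. \<forall>p\<in>E. SL2C_act A p \<in> E \<longrightarrow> A = mat 1 \<or> A = - mat 1)"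
proof -
  define F where "F = {A \<in> G. norm A \<le> 4}"
  have "finite F" unfolding F_def by (rule finite_bounded)
  define near where "near c x \<longleftrightarrow> 1 < x * c \<and> x < c" for c x :: real
  have "\<forall>\<^sub>F c in at_right (1::real). \<forall>A\<in>F. (cmod (A$1$1))\<^sup>2 \<noteq> 1 \<longrightarrow> \<not> near c ((cmod (A$1$1))\<^sup>2)"
  proof (rule eventually_ball_finite[OF \<open>finite F\<close>], intro ballI)
    fix A
    define x where "x = (cmod (A$1$1))\<^sup>2"
    have 1: "((\<lambda>c. c) \<longlongrightarrow> 1) (at_right (1::real))" by (intro tendsto_intros)
    have 2: "((\<lambda>c. x * c) \<longlongrightarrow> x * 1) (at_right (1::real))" by (intro tendsto_intros)
    consider "x = 1" | "x > 1" | "x < 1" by linarith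
    then show "\<forall>\<^sub>F c in at_right (1::real). (cmod (A$1$1))\<^sup>2 \<noteq> 1 \<longrightarrow> \<not> near c ((cmod (A$1$1))\<^sup>2)"
      unfolding x_def[symmetric]
    proof cases
      case 2
      show "\<forall>\<^sub>F c in at_right (1::real). x \<noteq> 1 \<longrightarrow> \<not> near c x"
        using order_tendstoD(2)[OF 1 2] by eventually_elim (simp add: near_def)
    next
      case 3
      show "\<forall>\<^sub>F c in at_right (1::real). x \<noteq> 1 \<longrightarrow> \<not> near c x"
        using order_tendstoD(2)[OF 2, of 1] 3 by (auto simp: near_def elim!: eventually_mono)
    qed simp
  qed
  moreover have "\<forall>\<^sub>F c in at_right (1::real). 1 < c \<and> c < 2"
    by (auto simp: eventually_at_right[of "1::real" 2] intro!: exI[of _ 2])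
  ultimately have "\<forall>\<^sub>F c in at_right (1::real). (1 < c \<and> c < 2) \<and>
      (\<forall>A\<in>F. (cmod (A$1$1))\<^sup>2 \<noteq> 1 \<longrightarrow> \<not> near c ((cmod (A$1$1))\<^sup>2))"
    by eventually_elim blast
  then obtain c where c: "1 < c" "c < 2"
    "\<And>A. A \<in> F \<Longrightarrow> (cmod (A$1$1))\<^sup>2 \<noteq> 1 \<Longrightarrow> \<not> near c ((cmod (A$1$1))\<^sup>2)"
    using eventually_happens'[OF trivial_limit_at_right_real] by blast
  define E where "E = (UNIV :: complex set) \<times> {1..<c}"
  show ?thesis
  proof (intro exI[of _ E] conjI ballI impI)
    show "E \<subseteq> H3" by (auto simp: E_def H3_def)
    show "E \<in> sets borel" by (simp add: E_def borel_prod[symmetric])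
    show "emeasure H3_volume E = \<infinity>" using emeasure_slab_infinite[OF c(1)] by (simp add: E_def)
    fix A p assume A: "A \<in> G" "p \<in> E" "SL2C_act A p \<in> E"
    obtain m where m: "m \<noteq> 0" "A = mat2 m 0 0 (1 / m)" using diag[OF A(1)] by blast
    obtain z t where p: "p = (z, t)" by (cases p)
    define x where "x = (cmod m)\<^sup>2"
    have x0: "x > 0" using m by (simp add: x_def)
    have t: "1 \<le> t" "t < c" "1 \<le> x * t" "x * t < c"
      using A(2,3) by (simp_all add: p E_def m(2) SL2C_act_diagonal[OF m(1)] x_def)
    have "x * t < x * c" using t x0 by simp
    moreover have "x * 1 \<le> x * t" using t x0 by (intro mult_left_mono) auto
    ultimately have near: "near c x" using t by (simp add: near_def)
    have "cmod m < 2"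
    proof (rule ccontr)
      assume "\<not> cmod m < 2"
      then have "2\<^sup>2 \<le> x" unfolding x_def by (intro power_mono) auto
      then show False using near c by (simp add: near_def)
    qed
    moreover have "cmod (1 / m) < 2"
    proof (rule ccontr)
      assume "\<not> cmod (1 / m) < 2"
      then have "2\<^sup>2 \<le> (cmod (1 / m))\<^sup>2" by (intro power_mono) auto
      then have "4 * x \<le> 1" using x0 by (simp add: norm_divide power_divide x_def field_simps)
      moreover have "x * c < x * 2" using c x0 by simp
      ultimately show False using near c by (simp add: near_def)
    qed
    ultimately have "norm A \<le> 4" using norm_mat2_le[of m 0 0 "1 / m"] by (simp add: m(2))
    then have "x = 1" using c(3)[of A] A(1) near by (auto simp: F_def m(2) x_def)
    then have "(cmod m)\<^sup>2 = 1\<^sup>2" by (simp add: x_def)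
    then have "cmod m = 1" by (rule power2_eq_imp_eq) simp_all
    then show "A = mat 1 \<or> A = - mat 1" using free[of m] A(1) m by (auto simp: mat_1_mat2)
  qed
qed

text \<open>
  In a discrete group, an element that fixes one endpoint of the axis of a loxodromic element fixes
  the other: otherwise conjugation by powers of the latter, which multiplies the remaining
  off-diagonal entry by arbitrarily small numbers, gives infinitely many elements in a bounded set.
\<close>

lemma one_entry_zero_imp_diagonal:
  assumes l: "cmod \<mu> > 1" and lG: "mat2 \<mu> 0 0 (1 / \<mu>) \<in> G" and x: "mat2 p q r s \<in> G" and qr: "q = 0 \<or> r = 0"
  shows "q = 0 \<and> r = 0"
proof -
  define K where "K = cmod p + cmod q + cmod r + cmod s"
  have m1: "cmod (\<mu> ^ n) \<ge> 1" for n using l by (simp add: norm_power one_le_power)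
  have m0: "\<mu> \<noteq> 0" using l by auto
  have small: "cmod (w / \<mu> ^ n / \<mu> ^ n) \<le> cmod w" for w n
  proof -
    have "1 \<le> cmod (\<mu> ^ n) * cmod (\<mu> ^ n)" using m1[of n] mult_mono[of 1 "cmod (\<mu> ^ n)" 1 "cmod (\<mu> ^ n)"] by simp
    then have "cmod w / (cmod (\<mu> ^ n) * cmod (\<mu> ^ n)) \<le> cmod w / 1"
      by (intro divide_left_mono) auto
    then show ?thesis by (simp add: norm_divide norm_mult)
  qed
  have inj: "w = 0" if "finite (range (\<lambda>n. w / \<mu> ^ n / \<mu> ^ n))" for w
  proof (rule ccontr)
    assume w: "w \<noteq> 0"
    have "inj (\<lambda>n::nat. w / \<mu> ^ n / \<mu> ^ n)"
    proof (rule injI)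
      fix i j :: nat assume "w / \<mu> ^ i / \<mu> ^ i = w / \<mu> ^ j / \<mu> ^ j"
      then have "\<mu> ^ i * \<mu> ^ i = \<mu> ^ j * \<mu> ^ j" using w m0 by (simp add: field_simps)
      then have "cmod \<mu> ^ (i + i) = cmod \<mu> ^ (j + j)" by (metis norm_power power_add)
      then show "i = j" using power_inject_exp[OF l] by auto
    qed
    then show False using that finite_imageD infinite_UNIV_nat by blast
  qed
  let ?D = "\<lambda>n. mat2 (\<mu> ^ n) 0 0 (1 / \<mu> ^ n)" and ?D' = "\<lambda>n. mat2 (1 / \<mu> ^ n) 0 0 (\<mu> ^ n)"
  from qr show ?thesis
  proof
    assume r: "r = 0"
    have "mat2 p (q / \<mu> ^ n / \<mu> ^ n) 0 s \<in> {A \<in> G. norm A \<le> K}" for n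
    proof -
      have "?D' n ** mat2 p q r s ** ?D n \<in> G" by (intro mult_mem diag_power_mem lG x)
      then show ?thesis using norm_mat2_le[of p "q / \<mu> ^ n / \<mu> ^ n" 0 s] small[of q n] m0 r
        by (simp add: K_def)
    qed
    then have "range (\<lambda>n. q / \<mu> ^ n / \<mu> ^ n) \<subseteq> (\<lambda>A. A$1$2) ` {A \<in> G. norm A \<le> K}"
      by (auto intro!: image_eqI)
    then show ?thesis using inj r finite_subset[OF _ finite_imageI[OF finite_bounded]] by blast
  next
    assume q: "q = 0"
    have "mat2 p 0 (r / \<mu> ^ n / \<mu> ^ n) s \<in> {A \<in> G. norm A \<le> K}" for n
    proof -
      have "?D n ** mat2 p q r s ** ?D' n \<in> G" by (intro mult_mem diag_power_mem lG x)
      then show ?thesis using norm_mat2_le[of p 0 "r / \<mu> ^ n / \<mu> ^ n" s] small[of r n] m0 q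
        by (simp add: K_def)
    qed
    then have "range (\<lambda>n. r / \<mu> ^ n / \<mu> ^ n) \<subseteq> (\<lambda>A. A$2$1) ` {A \<in> G. norm A \<le> K}"
      by (auto intro!: image_eqI)
    then show ?thesis using inj q finite_subset[OF _ finite_imageI[OF finite_bounded]] by blast
  qed
qed

end

text \<open>
  The matrix is conjugate to a diagonal matrix with entries of modulus 1, and this fixes \<open>(0, 1)\<close>.
\<close>

lemma elliptic_fixes_point:
  assumes A: "det A = 1" and x: "trace A = complex_of_real x" "\<bar>x\<bar> < 2"
  shows "\<exists>p\<in>H3. SL2C_act A p = p"
proof -
  define m where "m = cis (arccos (x / 2))"
  have m0: "m \<noteq> 0" by (simp add: m_def)
  have nm: "cmod m = 1" by (simp add: m_def)
  have Re: "Re m = x / 2" using x(2) by (simp add: m_def cos_arccos_abs)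
  have "m * cnj m = 1" unfolding complex_norm_square[symmetric] nm by simp
  then have inv: "1 / m = cnj m" using m0 by (metis nonzero_mult_div_cancel_left)
  have tr: "trace A = m + 1 / m"
    unfolding inv by (simp add: complex_add_cnj Re x(1))
  have m2: "m\<^sup>2 \<noteq> 1" using Re x(2) by (auto simp: power2_eq_1_iff)
  define D where "D = mat2 m 0 0 (1 / m)"
  obtain P where P: "det P = 1" "P ** A = D ** P"
    using diagonalize_2[OF A tr m0 m2] unfolding D_def mat2_def by blast
  have dD: "det D = 1" using m0 by (simp add: D_def)
  have j: "snd (0::complex, 1::real) > 0" by simp
  define p where "p = SL2C_act (adj2 P) (0, 1)"
  have p: "snd p > 0" unfolding p_def using P(1) by (intro SL2C_act_pos) simp_all
  have Pp: "SL2C_act P p = (0, 1)" unfolding p_def by (rule SL2C_act_adj2(1)[OF P(1) j])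
  have "SL2C_act P (SL2C_act A p) = SL2C_act D (SL2C_act P p)"
    using SL2C_act_mult[OF P(1) A p] SL2C_act_mult[OF dD P(1) p] P(2) by simp
  also have "\<dots> = SL2C_act P p" by (simp add: Pp D_def SL2C_act_diagonal[OF m0] nm)
  finally have "SL2C_act (adj2 P) (SL2C_act P (SL2C_act A p)) = SL2C_act (adj2 P) (SL2C_act P p)" by simp
  then have "SL2C_act A p = p"
    using SL2C_act_adj2(2)[OF P(1)] p SL2C_act_pos[OF A p] by simp
  then show ?thesis using p by (intro bexI[of _ p]) (simp_all add: H3_def)
qed

lemma no_elliptic:
  assumes "hyperbolic_manifold_group \<Gamma>" and A: "A \<in> lifts \<Gamma>"
  shows "\<nexists>x. trace A = complex_of_real x \<and> \<bar>x\<bar> < 2"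
proof
  assume "\<exists>x. trace A = complex_of_real x \<and> \<bar>x\<bar> < 2"
  then obtain x where x: "trace A = complex_of_real x" "\<bar>x\<bar> < 2" by blast
  have k: "kleinian_group \<Gamma>" and free: "acts_freely \<Gamma>"
    using assms(1) by (auto simp: hyperbolic_manifold_group_def)
  interpret discrete_SL2 "lifts \<Gamma>" using discrete_SL2_lifts[OF k] .
  have sub: "\<Gamma> \<subseteq> carrier PSL2C" using k subgroup.subset by (auto simp: kleinian_group_def)
  obtain p where p: "p \<in> H3" "SL2C_act A p = p" using elliptic_fixes_point[OF det_mem[OF A] x] by blast
  have "{A, - A} \<in> \<Gamma>" using A by (simp add: mem_lifts_iff[OF sub])
  then have "{A, - A} = \<one>\<^bsub>PSL2C\<^esub>"
    using free p PSL2C_act_coset[of A p] unfolding acts_freely_def by metis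
  then have "A = mat 1 \<or> A = - mat 1" unfolding one_PSL2C by blast
  then have "trace A = 2 \<or> trace A = - 2" by (auto simp: mat_1_mat2)
  then have "Re (trace A) = 2 \<or> Re (trace A) = -2" by auto
  then show False using x by auto
qed

text \<open>
  The element \<open>P\<close> makes it possible to look for the set in coordinates adapted to the group.
\<close>

lemma no_infinite_wandering_set:
  assumes k: "kleinian_group \<Gamma>" and fin: "finite_covolume \<Gamma>" and P: "det P = 1"
    and E: "E \<subseteq> H3" "E \<in> sets borel" "emeasure H3_volume E = \<infinity>"
    and wander: "\<forall>A\<in>(\<lambda>A. P ** A ** adj2 P) ` lifts \<Gamma>. \<forall>p\<in>E. SL2C_act A p \<in> E \<longrightarrow> A = mat 1 \<or> A = - mat 1"
  shows False
proof -
  interpret discrete_SL2 "lifts \<Gamma>" using discrete_SL2_lifts[OF k] .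
  have sub: "subgroup \<Gamma> PSL2C" using k by (auto simp: kleinian_group_def)
  have carr: "\<Gamma> \<subseteq> carrier PSL2C" using sub by (rule subgroup.subset)
  note mem = mem_lifts_iff[OF carr]
  have PP: "P ** adj2 P = mat 1" "adj2 P ** P = mat 1" using adj2_inverse[OF P] .
  have P': "det (adj2 P) = 1" using P by simp
  have cnt: "countable \<Gamma>"
  proof -
    have "\<Gamma> \<subseteq> (\<lambda>A. {A, - A}) ` lifts \<Gamma>"
    proof
      fix \<gamma> assume g: "\<gamma> \<in> \<Gamma>"
      then obtain A where A: "\<gamma> = {A, - A}" using carr PSL2C_cosetE by blast
      then have "A \<in> lifts \<Gamma>" using g mem[of A] by simp
      with A show "\<gamma> \<in> (\<lambda>A. {A, - A}) ` lifts \<Gamma>" by blast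
    qed
    then show ?thesis by (rule countable_subset) (rule countable_image[OF countable_G])
  qed
  define E' where "E' = SL2C_act (adj2 P) ` E"
  have E'H: "E' \<subseteq> H3"
  proof
    fix p assume "p \<in> E'"
    then obtain q where "q \<in> E" "p = SL2C_act (adj2 P) q" unfolding E'_def by blast
    then show "p \<in> H3" using E(1) SL2C_act_pos[OF P', of q] unfolding H3_def by blast
  qed
  have E'b: "E' \<in> sets borel" unfolding E'_def by (rule SL2C_act_image_measurable[OF P' E(1,2)])
  have E'v: "emeasure H3_volume E' = \<infinity>"
    unfolding E'_def using emeasure_H3_volume_image[OF P' E(1,2)] E(3) by simp
  obtain D where D: "fundamental_set \<Gamma> D" "emeasure H3_volume D < \<infinity>"
    using fin by (auto simp: finite_covolume_def)
  have "emeasure H3_volume E' \<le> emeasure H3_volume D"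
  proof (rule emeasure_wandering_le_fundamental_set[OF sub cnt D(1) E'H E'b])
    fix \<gamma> p assume g: "\<gamma> \<in> \<Gamma>" "p \<in> E'" "PSL2C_act \<gamma> p \<in> E'"
    obtain A where A: "\<gamma> = {A, - A}" "det A = 1" using PSL2C_cosetE carr g(1) by blast
    have AG: "A \<in> lifts \<Gamma>" using g(1) mem unfolding A(1) by blast
    obtain p0 where p0: "p0 \<in> E" "p = SL2C_act (adj2 P) p0" using g(2) unfolding E'_def by blast
    obtain p1 where p1: "p1 \<in> E" "SL2C_act A p = SL2C_act (adj2 P) p1"
      using g(3) unfolding E'_def A(1) PSL2C_act_coset by blast
    have pos: "snd p0 > 0" "snd p1 > 0" using p0(1) p1(1) E(1) unfolding H3_def by blast+
    have p: "snd p > 0" unfolding p0(2) by (rule SL2C_act_pos[OF P' pos(1)])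
    have "SL2C_act (P ** A ** adj2 P) p0 = SL2C_act (P ** A) p"
      using SL2C_act_mult[of "P ** A" "adj2 P" p0] P A(2) pos by (simp add: det_mul p0(2))
    also have "\<dots> = SL2C_act P (SL2C_act A p)" by (rule SL2C_act_mult[OF P A(2) p])
    also have "\<dots> = p1" unfolding p1(2) by (rule SL2C_act_adj2(1)[OF P pos(2)])
    finally have "SL2C_act (P ** A ** adj2 P) p0 \<in> E" using p1(1) by simp
    then have "P ** A ** adj2 P = mat 1 \<or> P ** A ** adj2 P = - mat 1"
      using wander[rule_format, OF imageI[OF AG] p0(1)] by blast
    then have "A = mat 1 \<or> A = - mat 1"
    proof
      assume "P ** A ** adj2 P = mat 1"
      then show ?thesis using conjugate_undo[OF P, of A] PP by simp
    next
      assume "P ** A ** adj2 P = - mat 1"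
      then show ?thesis using conjugate_undo[OF P, of A] PP by (simp add: uminus_matrix_mult_2)
    qed
    then show "\<gamma> = \<one>\<^bsub>PSL2C\<^esub>" unfolding A(1) one_PSL2C by (elim disjE) auto
  qed
  then show False using E'v D(2) by simp
qed

lemma exists_eigenvalue_gt_1:
  assumes "\<nexists>x. T = complex_of_real x \<and> \<bar>x\<bar> \<le> 2"
  shows "\<exists>m. cmod m > 1 \<and> m + 1 / m = T"
proof -
  obtain m where m: "cmod m \<ge> 1" "m + 1 / m = T" using exists_eigenvalue_ge_1 by blast
  have "cmod m \<noteq> 1"
  proof
    assume n: "cmod m = 1"
    then have m0: "m \<noteq> 0" by auto
    have "m * cnj m = 1" using n by (simp flip: complex_norm_square)
    then have "1 / m = cnj m" using m0 by (metis nonzero_mult_div_cancel_left)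
    then have "T = complex_of_real (2 * Re m)" using m(2) complex_add_cnj[of m] by simp
    moreover have "\<bar>2 * Re m\<bar> \<le> 2" using abs_Re_le_cmod[of m] n by simp
    ultimately show False using assms by blast
  qed
  with m show ?thesis by (intro exI[of _ m]) simp
qed

text \<open>
  The fixed point \<open>w\<close> of the transformation on the boundary is moved to infinity.
\<close>

lemma triangularize_parabolic:
  assumes A: "det A = 1" and tr: "trace A = 2 * e" and e: "e = 1 \<or> e = -1"
  shows "\<exists>P b. det P = 1 \<and> P ** A ** adj2 P = mat2 e b 0 e"
proof -
  obtain a b c d where abcd: "A = mat2 a b c d" by (metis mat2_eta)
  have det: "a * d - b * c = 1" and t: "d = 2 * e - a" using A tr by (simp_all add: abcd algebra_simps)
  have ee: "e * e = 1" using e by auto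
  show ?thesis
  proof (cases "c = 0")
    case True
    have "(a - e) * (a - e) = 0" using det ee unfolding t True by (simp add: algebra_simps)
    then have "a = e" by simp
    then have "A = mat2 e b 0 e" using t True by (simp add: abcd)
    then show ?thesis by (intro exI[of _ "mat 1"] exI[of _ b]) (simp add: mat_1_mat2)
  next
    case False
    define w where "w = (a - e) / c"
    have cw: "c * w = a - e" using False by (simp add: w_def)
    have "c * b = a * d - 1" using det by (simp add: algebra_simps)
    have "c * (w * (c * w - a + d) - b) = (c * w) * (c * w - a + d) - c * b" by (simp add: algebra_simps)
    also have "\<dots> = 0" unfolding cw \<open>c * b = a * d - 1\<close> t using ee by (simp add: algebra_simps)
    finally have z: "w * (c * w - a + d) - b = 0" using False by simp
    have e1: "c * w + d = e" "a - c * w = e" using cw t by simp_all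
    show ?thesis
    proof (intro exI[of _ "mat2 0 1 (-1) w"] exI[of _ "- c"] conjI)
      show "mat2 0 1 (-1) w ** A ** adj2 (mat2 0 1 (-1) w) = mat2 e (- c) 0 e"
        using e1 z unfolding abcd by (simp add: mult.commute) (simp add: algebra_simps)
    qed simp
  qed
qed

text \<open>
  If the group contains a loxodromic element, it is made diagonal, and every element that is not
  diagonal then has nonzero off-diagonal entries. Its diagonal entries do not both vanish, since
  it would be elliptic otherwise; hence it or its inverse has the required form. If all elements are
  diagonal, there is a wandering slab of infinite volume.

  If there is no loxodromic element, all traces are 2 or -2. Either the group is trivial, or it
  contains a parabolic element, which is moved to a translation \<open>u\<close>. For every \<open>B\<close> in the group, the
  traces of \<open>B\<close>, \<open>u B\<close> and \<open>u u B\<close> are in arithmetic progression, and since they are 2 or -2, they are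
  equal. This forces \<open>B\<close> to fix infinity as well, and there is a wandering cylinder of infinite volume.
\<close>

lemma nonelementary:
  assumes M: "hyperbolic_manifold_group \<Gamma>" and fin: "finite_covolume \<Gamma>"
  shows "\<exists>P \<mu> p q r s. det P = 1 \<and> cmod \<mu> > 1 \<and>
    mat2 \<mu> 0 0 (1 / \<mu>) \<in> (\<lambda>A. P ** A ** adj2 P) ` lifts \<Gamma> \<and>
    mat2 p q r s \<in> (\<lambda>A. P ** A ** adj2 P) ` lifts \<Gamma> \<and> p \<noteq> 0 \<and> q \<noteq> 0 \<and> r \<noteq> 0"
proof -
  have k: "kleinian_group \<Gamma>" using M by (simp add: hyperbolic_manifold_group_def)
  interpret G: discrete_SL2 "lifts \<Gamma>" using discrete_SL2_lifts[OF k] .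
  define H where "H P = (\<lambda>A. P ** A ** adj2 P) ` lifts \<Gamma>" for P
  have Hd: "discrete_SL2 (H P)" if "det P = 1" for P unfolding H_def by (rule G.conjugate_discrete[OF that])
  have no_ell: "\<nexists>x. trace B = complex_of_real x \<and> \<bar>x\<bar> < 2" if B: "B \<in> H P" "det P = 1" for P B
  proof -
    obtain A where A: "A \<in> lifts \<Gamma>" "B = P ** A ** adj2 P" using B(1) unfolding H_def by blast
    show ?thesis using no_elliptic[OF M A(1)] unfolding A(2) trace_conjugate[OF B(2)] .
  qed
  have no_wander: "\<not> (\<exists>E. E \<subseteq> H3 \<and> E \<in> sets borel \<and> emeasure H3_volume E = \<infinity> \<and>
      (\<forall>A\<in>H P. \<forall>p\<in>E. SL2C_act A p \<in> E \<longrightarrow> A = mat 1 \<or> A = - mat 1))" if "det P = 1" for P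
    using no_infinite_wandering_set[OF k fin that] unfolding H_def by blast
  show ?thesis
  proof (cases "\<exists>A\<in>lifts \<Gamma>. \<nexists>x. trace A = complex_of_real x \<and> \<bar>x\<bar> \<le> 2")
    case True
    then obtain A where A: "A \<in> lifts \<Gamma>" "\<nexists>x. trace A = complex_of_real x \<and> \<bar>x\<bar> \<le> 2" by blast
    obtain \<mu> where \<mu>: "cmod \<mu> > 1" "\<mu> + 1 / \<mu> = trace A" using exists_eigenvalue_gt_1[OF A(2)] by blast
    have \<mu>0: "\<mu> \<noteq> 0" "\<mu>\<^sup>2 \<noteq> 1" using \<mu>(1) by (auto simp: power2_eq_1_iff)
    obtain P where P: "det P = 1" "P ** A = mat2 \<mu> 0 0 (1 / \<mu>) ** P"
      using diagonalize_2[OF G.det_mem[OF A(1)] \<mu>(2)[symmetric] \<mu>0] unfolding mat2_def by blast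
    have "P ** A ** adj2 P = mat2 \<mu> 0 0 (1 / \<mu>)"
      unfolding P(2) by (simp add: adj2_inverse[OF P(1)] flip: matrix_mul_assoc)
    then have \<mu>H: "mat2 \<mu> 0 0 (1 / \<mu>) \<in> H P" unfolding H_def using A(1) by (metis image_eqI)
    interpret H: discrete_SL2 "H P" using Hd[OF P(1)] .
    show ?thesis
    proof (cases "\<exists>p q r s. mat2 p q r s \<in> H P \<and> q \<noteq> 0 \<and> r \<noteq> 0")
      case True
      then obtain p q r s where x: "mat2 p q r s \<in> H P" "q \<noteq> 0" "r \<noteq> 0" by blast
      have "\<not> (p = 0 \<and> s = 0)"
      proof
        assume "p = 0 \<and> s = 0"
        then have "trace (mat2 p q r s) = complex_of_real 0 \<and> \<bar>0::real\<bar> < 2" by simp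
        then show False using no_ell[OF x(1) P(1)] by blast
      qed
      then consider "p \<noteq> 0" | "s \<noteq> 0" by blast
      then show ?thesis
      proof cases
        case 1
        show ?thesis unfolding H_def[symmetric]
          by (rule exI[of _ P], rule exI[of _ \<mu>], rule exI[of _ p], rule exI[of _ q],
              rule exI[of _ r], rule exI[of _ s]) (simp add: P(1) \<mu>(1) \<mu>H x 1)
      next
        case 2
        have y: "mat2 s (- q) (- r) p \<in> H P" using H.adj2_mem[OF x(1)] by simp
        show ?thesis unfolding H_def[symmetric]
          by (rule exI[of _ P], rule exI[of _ \<mu>], rule exI[of _ s], rule exI[of _ "- q"],
              rule exI[of _ "- r"], rule exI[of _ p]) (simp add: P(1) \<mu>(1) \<mu>H x y 2)
      qed
    next
      case False
      have "\<exists>E. E \<subseteq> H3 \<and> E \<in> sets borel \<and> emeasure H3_volume E = \<infinity> \<and>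
          (\<forall>A\<in>H P. \<forall>p\<in>E. SL2C_act A p \<in> E \<longrightarrow> A = mat 1 \<or> A = - mat 1)"
      proof (rule H.diagonal_infinite_wandering)
        fix B assume B: "B \<in> H P"
        obtain p q r s where b: "B = mat2 p q r s" by (metis mat2_eta)
        have B': "mat2 p q r s \<in> H P" using B unfolding b .
        then have "q = 0 \<or> r = 0" using False by blast
        then have qr: "q = 0 \<and> r = 0"
          by (rule H.one_entry_zero_imp_diagonal[OF \<mu>(1) \<mu>H B'])
        then have ps: "p * s = 1" using H.det_mem[OF B] by (simp add: b)
        then have "p \<noteq> 0" by auto
        moreover from this ps have "s = 1 / p" by (simp add: eq_divide_eq mult.commute)
        ultimately show "\<exists>m. m \<noteq> 0 \<and> B = mat2 m 0 0 (1 / m)" using qr b by blast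
      next
        fix m assume m: "mat2 m 0 0 (1 / m) \<in> H P" "cmod m = 1"
        then have m0: "m \<noteq> 0" by auto
        have "m * cnj m = 1" using m(2) by (simp flip: complex_norm_square)
        then have "1 / m = cnj m" using m0 by (metis nonzero_mult_div_cancel_left)
        then have "trace (mat2 m 0 0 (1 / m)) = complex_of_real (2 * Re m)" using complex_add_cnj[of m] by simp
        then have "\<not> \<bar>2 * Re m\<bar> < 2" using no_ell[OF m(1) P(1)] by blast
        then have R: "\<bar>Re m\<bar> = 1" using abs_Re_le_cmod[of m] m(2) by linarith
        have "(Re m)\<^sup>2 + (Im m)\<^sup>2 = 1" using cmod_power2[of m] m(2) by simp
        moreover have "(Re m)\<^sup>2 = 1" using power2_abs[of "Re m"] R by simp
        ultimately have "Im m = 0" by simp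
        then show "m = 1 \<or> m = -1" using R by (auto simp: complex_eq_iff abs_if split: if_splits)
      qed
      then show ?thesis using no_wander[OF P(1)] by blast
    qed
  next
    case False
    have tr2: "\<exists>e. (e = 1 \<or> e = -1) \<and> trace B = 2 * e" if B: "B \<in> H P" "det P = 1" for B P
    proof -
      obtain A where A: "A \<in> lifts \<Gamma>" "B = P ** A ** adj2 P" using B(1) unfolding H_def by blast
      have "trace B = trace A" unfolding A(2) by (rule trace_conjugate[OF B(2)])
      then obtain x where x: "trace B = complex_of_real x" "\<bar>x\<bar> \<le> 2" using False A(1) by metis
      have "\<not> \<bar>x\<bar> < 2" using no_ell[OF B] x(1) by blast
      then have "x = 2 \<or> x = -2" using x(2) by linarith
      then show ?thesis
      proof
        assume "x = 2" then show ?thesis using x(1) by (intro exI[of _ 1]) simp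
      next
        assume "x = -2" then show ?thesis using x(1) by (intro exI[of _ "-1"]) simp
      qed
    qed
    have mat1: "det (mat 1 :: complex^2^2) = 1" by simp
    have Hsame: "H (mat 1) = lifts \<Gamma>"
    proof -
      have "adj2 (mat 1) = mat 1" by (simp add: mat_1_mat2)
      then show ?thesis by (simp add: H_def)
    qed
    have "\<exists>P. det P = 1 \<and> (\<forall>B\<in>H P. \<exists>e b. (e = 1 \<or> e = -1) \<and> B = mat2 e b 0 e)"
    proof (cases "\<forall>A\<in>lifts \<Gamma>. A = mat 1 \<or> A = - mat 1")
      case True
      show ?thesis
      proof (intro exI[of _ "mat 1"] conjI ballI)
        fix B assume "B \<in> H (mat 1)"
        then have "B = mat 1 \<or> B = - mat 1" using True unfolding Hsame by blast
        then have "B = mat2 1 0 0 1 \<or> B = mat2 (-1) 0 0 (-1)" unfolding mat_1_mat2 by simp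
        then show "\<exists>e b. (e = 1 \<or> e = -1) \<and> B = mat2 e b 0 e" by blast
      qed simp
    next
      case nontriv: False
      then obtain A where A: "A \<in> lifts \<Gamma>" "A \<noteq> mat 1" "A \<noteq> - mat 1" by blast
      obtain e where e: "e = 1 \<or> e = -1" "trace A = 2 * e" using tr2[of A "mat 1"] A(1) mat1 unfolding Hsame by blast
      obtain P b where P: "det P = 1" "P ** A ** adj2 P = mat2 e b 0 e"
        using triangularize_parabolic[OF G.det_mem[OF A(1)] e(2,1)] by blast
      interpret H: discrete_SL2 "H P" using Hd[OF P(1)] .
      have U: "mat2 e b 0 e \<in> H P" unfolding H_def using A(1) P(2) by (metis image_eqI)
      have b0: "b \<noteq> 0"
      proof
        assume "b = 0"
        then have "P ** A ** adj2 P = mat 1 \<or> P ** A ** adj2 P = - mat 1" using P(2) e(1) by (auto simp: mat_1_mat2)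
        then have "A = mat 1 \<or> A = - mat 1"
        proof
          assume "P ** A ** adj2 P = mat 1"
          then show ?thesis using conjugate_undo[OF P(1), of A] adj2_inverse[OF P(1)] by simp
        next
          assume "P ** A ** adj2 P = - mat 1"
          then show ?thesis using conjugate_undo[OF P(1), of A] adj2_inverse[OF P(1)]
            by (simp add: uminus_matrix_mult_2)
        qed
        then show False using A by blast
      qed
      define \<beta> where "\<beta> = e * b"
      have \<beta>0: "\<beta> \<noteq> 0" using b0 e by (auto simp: \<beta>_def)
      have u: "mat2 1 \<beta> 0 1 \<in> H P" using U H.uminus_mem[OF U] e(1) by (auto simp: \<beta>_def)
      have "\<exists>e b. (e = 1 \<or> e = -1) \<and> B = mat2 e b 0 e" if B: "B \<in> H P" for B
      proof -
        obtain p q r s where b: "B = mat2 p q r s" by (metis mat2_eta)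
        have B1: "mat2 1 \<beta> 0 1 ** B \<in> H P" using u B by (rule H.mult_mem)
        have B2: "mat2 1 \<beta> 0 1 ** (mat2 1 \<beta> 0 1 ** B) \<in> H P" using u B1 by (rule H.mult_mem)
        obtain e0 where e0: "e0 = 1 \<or> e0 = -1" "p + s = 2 * e0" using tr2[OF B P(1)] unfolding b trace_mat2 by blast
        have "trace (mat2 1 \<beta> 0 1 ** B) = p + s + \<beta> * r" by (simp add: b)
        then obtain e1 where e1: "e1 = 1 \<or> e1 = -1" "p + s + \<beta> * r = 2 * e1" using tr2[OF B1 P(1)] by metis
        have "trace (mat2 1 \<beta> 0 1 ** (mat2 1 \<beta> 0 1 ** B)) = p + s + 2 * (\<beta> * r)" by (simp add: b)
        then obtain e2 where e2: "e2 = 1 \<or> e2 = -1" "p + s + 2 * (\<beta> * r) = 2 * e2" using tr2[OF B2 P(1)] by metis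
        have y: "\<beta> * r = 2 * e1 - 2 * e0" "2 * (\<beta> * r) = 2 * e2 - 2 * e0"
          using e0(2) e1(2) e2(2) by (simp_all flip: e0(2) e1(2) e2(2))
        then have "2 * (2 * e1 - 2 * e0) = 2 * e2 - 2 * e0" by simp
        then have "e1 = e0" using e0(1) e1(1) e2(1) by (elim disjE) simp_all
        then have "\<beta> * r = 0" using y(1) by simp
        then have r: "r = 0" using \<beta>0 by simp
        have "p * s = 1" using H.det_mem[OF B] r by (simp add: b)
        moreover have s: "s = 2 * e0 - p" using e0(2) by (simp add: algebra_simps)
        ultimately have "(p - e0) * (p - e0) = 0" using e0(1) by (auto simp: algebra_simps)
        then have "p = e0" by simp
        then have "B = mat2 e0 q 0 e0" using s r by (simp add: b)
        then show ?thesis using e0(1) by blast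
      qed
      then show ?thesis using P(1) by blast
    qed
    then obtain P where P: "det P = 1" "\<forall>B\<in>H P. \<exists>e b. (e = 1 \<or> e = -1) \<and> B = mat2 e b 0 e" by blast
    have "\<exists>E. E \<subseteq> H3 \<and> E \<in> sets borel \<and> emeasure H3_volume E = \<infinity> \<and>
        (\<forall>A\<in>H P. \<forall>p\<in>E. SL2C_act A p \<in> E \<longrightarrow> A = mat 1 \<or> A = - mat 1)"
      by (rule discrete_SL2.unipotent_infinite_wandering[OF Hd[OF P(1)]]) (use P(2) in blast)
    then show ?thesis using no_wander[OF P(1)] by blast
  qed
qed

section \<open>Unbounded multiplicity\<close>

lemma has_complex_length_of_trace:
  assumes A: "det A = 1" and T: "trace A = T" "m + 1 / m = T" "cmod m > 1"
  shows "has_complex_length {A, - A} (2 * Ln m)"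
proof -
  have m0: "m \<noteq> 0" using T by auto
  have "trace A = 2 * cosh (2 * Ln m / 2)"
    using T m0 by (simp add: cosh_def exp_minus scaleR_conv_of_real field_simps)
  moreover have "Re (2 * Ln m) > 0" using T m0 by simp
  moreover have "{A, - A} \<in> carrier PSL2C" using A by (auto simp: carrier_PSL2C)
  ultimately show ?thesis by (auto simp: has_complex_length_iff_trace)
qed

theorem corollary1p3:
  fixes \<Gamma> :: "(complex^2^2) set set"
  assumes "hyperbolic_manifold_group \<Gamma>" and "finite_covolume \<Gamma>"
  shows "\<forall>n::nat. n > 0 \<longrightarrow>
    (\<exists>L. \<exists>C \<subseteq> classes_of_length \<Gamma> L. finite C \<and> card C \<ge> n)"
proof (intro allI impI)
  fix n :: nat
  have k: "kleinian_group \<Gamma>" using assms(1) by (simp add: hyperbolic_manifold_group_def)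
  have sub: "subgroup \<Gamma> PSL2C" using k by (simp add: kleinian_group_def)
  have carr: "\<Gamma> \<subseteq> carrier PSL2C" using sub by (rule subgroup.subset)
  note mem = mem_lifts_iff[OF carr]
  interpret G: discrete_SL2 "lifts \<Gamma>" using discrete_SL2_lifts[OF k] .
  interpret PSL: group PSL2C by (rule group_PSL2C)
  obtain P \<mu> p q r s where P: "det P = 1" and gens: "cmod \<mu> > 1"
    "mat2 \<mu> 0 0 (1 / \<mu>) \<in> (\<lambda>A. P ** A ** adj2 P) ` lifts \<Gamma>"
    "mat2 p q r s \<in> (\<lambda>A. P ** A ** adj2 P) ` lifts \<Gamma>" "p \<noteq> 0" "q \<noteq> 0" "r \<noteq> 0"
    using nonelementary[OF assms] by blast
  define c where "c A = P ** A ** adj2 P" for A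
  have PP: "P ** adj2 P = mat 1" "adj2 P ** P = mat 1" using adj2_inverse[OF P] .
  have cm: "c A ** c B = c (A ** B)" for A B
    unfolding c_def by (rule conjugate_mult[OF P])
  interpret H: discrete_SL2 "c ` lifts \<Gamma>" unfolding c_def by (rule G.conjugate_discrete[OF P])
  obtain Y T where Y: "finite Y" "card Y = 2 ^ n" "Y \<subseteq> c ` lifts \<Gamma>" "cmod T > 2" "\<And>y. y \<in> Y \<Longrightarrow> trace y = T"
    and nonconj: "\<And>y z \<gamma>. y \<in> Y \<Longrightarrow> z \<in> Y \<Longrightarrow> \<gamma> \<in> c ` lifts \<Gamma> \<Longrightarrow> \<gamma> ** y = z ** \<gamma> \<Longrightarrow> y = z"
    using H.many_nonconjugate_same_trace[OF gens(1) gens(2,3)[folded c_def] gens(4-6), of n] by metis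
  have "\<exists>f. \<forall>y\<in>Y. f y \<in> lifts \<Gamma> \<and> c (f y) = y" using Y(3) by (intro bchoice) blast
  then obtain f where f: "\<And>y. y \<in> Y \<Longrightarrow> f y \<in> lifts \<Gamma>" "\<And>y. y \<in> Y \<Longrightarrow> c (f y) = y" by blast
  have trf: "trace (f y) = T" if "y \<in> Y" for y
    using Y(5)[OF that] f(2)[OF that] trace_conjugate[OF P, of "f y"] by (simp add: c_def)
  have detf: "det (f y) = 1" if "y \<in> Y" for y using G.det_mem f(1) that by blast
  define \<gamma> where "\<gamma> y = {f y, - f y}" for y
  have g\<Gamma>: "\<gamma> y \<in> \<Gamma>" if "y \<in> Y" for y using f(1)[OF that] by (simp add: \<gamma>_def mem)
  have "\<nexists>x. T = complex_of_real x \<and> \<bar>x\<bar> \<le> 2" using Y(4) by auto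
  then obtain m where m: "cmod m > 1" "m + 1 / m = T" using exists_eigenvalue_gt_1 by blast
  define L where "L = 2 * Ln m"
  have len: "has_complex_length (\<gamma> y) L" if "y \<in> Y" for y
    unfolding \<gamma>_def L_def using trf[OF that] m by (intro has_complex_length_of_trace[OF detf[OF that]]) auto
  have lox: "loxodromic (\<gamma> y)" if "y \<in> Y" for y
  proof -
    have "T\<^sup>2 \<noteq> complex_of_real x" if "x \<in> {0..4}" for x
    proof
      assume "T\<^sup>2 = complex_of_real x"
      then have "(cmod T)\<^sup>2 = \<bar>x\<bar>" by (metis norm_of_real norm_power real_norm_def)
      moreover have "2\<^sup>2 < (cmod T)\<^sup>2" using Y(4) by (intro power_strict_mono) auto
      ultimately show False using that by simp
    qed
    then have "T\<^sup>2 \<notin> complex_of_real ` {0..4}" by blast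
    then show ?thesis using trf[OF that] by (simp add: loxodromic_def \<gamma>_def trace_sq_coset)
  qed
  define K where "K y = conjugacy_class \<Gamma> (\<gamma> y)" for y
  have inj: "inj_on K Y"
  proof (rule inj_onI)
    fix y z assume yz: "y \<in> Y" "z \<in> Y" "K y = K z"
    have "\<gamma> y \<in> K y"
      unfolding K_def conjugacy_class_def mem_Collect_eq
      using g\<Gamma>[OF yz(1)] carr subgroup.one_closed[OF sub]
      by (intro exI[of _ "\<one>\<^bsub>PSL2C\<^esub>"]) auto
    then obtain h where h: "h \<in> \<Gamma>" "\<gamma> y = h \<otimes>\<^bsub>PSL2C\<^esub> \<gamma> z \<otimes>\<^bsub>PSL2C\<^esub> inv\<^bsub>PSL2C\<^esub> h"
      unfolding yz(3) by (auto simp: K_def conjugacy_class_def)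
    obtain A where A: "h = {A, - A}" "det A = 1" using PSL2C_cosetE carr h(1) by blast
    have AG: "A \<in> lifts \<Gamma>" using h(1) A(1) by (simp add: mem)
    have "\<gamma> y = {A ** f z ** adj2 A, - (A ** f z ** adj2 A)}"
      using h(2) unfolding A(1) \<gamma>_def inv_PSL2C[OF A(2) adj2_inverse(1)[OF A(2)]] mult_PSL2C .
    then have "f y = A ** f z ** adj2 A \<or> f y = - (A ** f z ** adj2 A)" by (auto simp: \<gamma>_def)
    \<comment> \<open>A conjugacy in the projective group lifts to \<open>SL2C\<close> up to sign; as the common trace is not 0,
      the sign is determined.\<close>
    moreover have "f y \<noteq> - (A ** f z ** adj2 A)"
    proof
      assume "f y = - (A ** f z ** adj2 A)"
      then have "T = - T" using trf yz trace_conjugate[OF A(2)] trace_uminus_2 by metis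
      then show False using Y(4) by simp
    qed
    ultimately have "f y = A ** f z ** adj2 A" by blast
    then have "f y ** A = A ** f z"
      by (simp add: adj2_inverse[OF A(2)] flip: matrix_mul_assoc)
    then have "c A ** z = y ** c A" using cm[of A "f z"] cm[of "f y" A] f(2) yz by simp
    then show "y = z" using nonconj[OF yz(2,1)] AG by blast
  qed
  have "K ` Y \<subseteq> classes_of_length \<Gamma> L"
    using g\<Gamma> lox len unfolding classes_of_length_def K_def by blast
  moreover have "card (K ` Y) \<ge> n"
    using card_image[OF inj] Y(2) less_exp[of n] by simp
  ultimately show "\<exists>L. \<exists>C \<subseteq> classes_of_length \<Gamma> L. finite C \<and> card C \<ge> n"
    using Y(1) by blast
qed

end
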